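(* Let $p,q,r\in[1,\infty]$ be numbers with $\frac1r\le\frac1p+\frac1q$ (where $\frac1\infty=0$). The coordinatewise multiplication $\ell_p\times\ell_q\to\ell_r$, $(x,y)\mapsto xy$, preserves unconditional convergence if and only if one of the following conditions is satisfied: (i) $p\le 2$ and $q\le r$; (ii) $2<p<q\le r$; (iii) $2<p=q<r$; (iv) $p=q=r=\infty$; (v) $2\le q<p\le r$; (vi) $q<2<p$ and $\frac1p+\frac1q\ge\frac1r+\frac12$.
   Context: All Banach spaces are over the field $\mathbb F$ of real or complex numbers, and $\omega=\{0,1,2,\dots\}$. For $p\in[1,\infty]$, $\ell_p$ is the Banach space of all sequences $x:\omega\to\mathbb F$ with $\|x\|_{\ell_p}<\infty$, where $\|x\|_{\ell_p}=\big(\sum_{n\in\omega}|x(n)|^p\big)^{1/p}$ if $p<\infty$ and $\|x\|_{\ell_\infty}=\sup_{n\in\omega}|x(n)|$. When $\frac1r\le\frac1p+\frac1q$, the coordinatewise product $xy=(x(n)y(n))_{n\in\omega}$ of $x\in\ell_p$ and $y\in\ell_q$ lies in $\ell_r$, and $(x,y)\mapsto xy$ is a continuous bilinear map $\ell_p\times\ell_q\to\ell_r$ (by the Hölder inequality). A series $\sum_{n\in\omega}x_n$ in a Banach space $X$ converges unconditionally if for every permutation $\sigma$ of $\omega$ the series $\sum_{n\in\omega}x_{\sigma(n)}$ converges in $X$. A Banach action is a continuous bilinear function $A\times X\to Y$, $(a,x)\mapsto ax$, where $A,X,Y$ are Banach spaces. A Banach action $A\times X\to Y$ preserves unconditional convergence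 if for every unconditionally convergent series $\sum_{n\in\omega}x_n$ in $X$ and every bounded sequence $(a_n)_{n\in\omega}$ in $A$ the series $\sum_{n\in\omega}a_nx_n$ converges unconditionally in $Y$. *)

theory Defs
  imports "HOL-Analysis.Analysis" "HOL-Library.Function_Algebras"
begin

text \<open>
  The space \<open>\<ell>\<^sub>p\<close> depends on the number \<open>p\<close>, so it cannot be a type. A normed space is given by
  its set of vectors inside an ambient abelian group, together with a norm that is meaningful
  on that set only. For spaces of sequences the ambient group is the type of all sequences,
  with the pointwise operations of \<open>Function_Algebras\<close>.
\<close>

record 'v nspace =
  vectors :: "'v set"
  vnorm :: "'v \<Rightarrow> real"

definition series_converges :: "'v::ab_group_add nspace \<Rightarrow> (nat \<Rightarrow> 'v) \<Rightarrow> bool" where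
  "series_converges X x \<longleftrightarrow>
     (\<exists>s\<in>vectors X. (\<lambda>N. vnorm X ((\<Sum>n<N. x n) - s)) \<longlonglongrightarrow> 0)"

definition converges_unconditionally :: "'v::ab_group_add nspace \<Rightarrow> (nat \<Rightarrow> 'v) \<Rightarrow> bool" where
  "converges_unconditionally X x \<longleftrightarrow>
     (\<forall>\<sigma>. bij \<sigma> \<longrightarrow> series_converges X (\<lambda>n. x (\<sigma> n)))"

definition bounded_sequence :: "'v nspace \<Rightarrow> (nat \<Rightarrow> 'v) \<Rightarrow> bool" where
  "bounded_sequence A a \<longleftrightarrow> (\<exists>C. \<forall>n. vnorm A (a n) \<le> C)"

text \<open>
  To be applied to a Banach action, that is, to a continuous bilinear map
  \<open>act : A \<times> X \<rightarrow> Y\<close> between Banach spaces.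
\<close>

definition preserves_unconditional_convergence ::
  "'a nspace \<Rightarrow> 'x::ab_group_add nspace \<Rightarrow> 'y::ab_group_add nspace \<Rightarrow> ('a \<Rightarrow> 'x \<Rightarrow> 'y) \<Rightarrow> bool"
where
  "preserves_unconditional_convergence A X Y act \<longleftrightarrow>
     (\<forall>x a. range x \<subseteq> vectors X \<longrightarrow> converges_unconditionally X x \<longrightarrow>
            range a \<subseteq> vectors A \<longrightarrow> bounded_sequence A a \<longrightarrow>
            converges_unconditionally Y (\<lambda>n. act (a n) (x n)))"

text \<open>
  The condition \<open>\<parallel>x\<parallel> < \<infinity>\<close> is expressed by summability, or boundedness if \<open>p = \<infinity>\<close>; the
  real-valued norm \<open>lp_norm\<close> has its intended value only under this condition.
\<close>

definition lp_finite :: "ereal \<Rightarrow> (nat \<Rightarrow> 'a::real_normed_field) \<Rightarrow> bool" where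
  "lp_finite p x \<longleftrightarrow>
     (if p = \<infinity> then bdd_above (range (\<lambda>n. norm (x n)))
      else summable (\<lambda>n. norm (x n) powr real_of_ereal p))"

definition lp_norm :: "ereal \<Rightarrow> (nat \<Rightarrow> 'a::real_normed_field) \<Rightarrow> real" where
  "lp_norm p x =
     (if p = \<infinity> then (SUP n. norm (x n))
      else (\<Sum>n. norm (x n) powr real_of_ereal p) powr (1 / real_of_ereal p))"

definition ell :: "ereal \<Rightarrow> (nat \<Rightarrow> 'a::real_normed_field) nspace" where
  "ell p = \<lparr>vectors = {x. lp_finite p x}, vnorm = lp_norm p\<rparr>"

definition coord_mult :: "(nat \<Rightarrow> 'a::real_normed_field) \<Rightarrow> (nat \<Rightarrow> 'a) \<Rightarrow> nat \<Rightarrow> 'a" where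
  "coord_mult x y = (\<lambda>n. x n * y n)"

end

theory Submission
  imports Defs
begin

text \<open>
  Both directions rest on finite inequalities. A series of vectors of \<open>\<ell>\<^sub>q\<close> converges
  unconditionally iff its finite sums \<open>\<Sum>n\<in>F. x n\<close> become small in norm, uniformly in \<open>F\<close>, once \<open>F\<close>
  avoids a long enough initial segment; then the signed sums over \<open>F\<close> are small too. Hence preservation
  follows from a bound
  \<open>\<parallel>\<Sum>n. \<bar>a n\<bar> \<bar>x n\<bar>\<parallel>\<^sub>r \<le> C\<close> for finite real families with
  \<open>\<parallel>\<Sum>n. \<plusminus> x n\<parallel>\<^sub>q \<le> 1\<close> for all signs and \<open>\<parallel>a n\<parallel>\<^sub>p \<le> 1\<close> for all \<open>n\<close> (\<open>preserves_if_action_bound\<close>; complex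
  sequences are split into real and imaginary parts). If no such \<open>C\<close> exists, rescaled extremal families
  placed one after another give a counterexample (\<open>not_preserves_if_unbounded\<close>).

  Three estimates give the bound.

  For \<open>p = 2\<close> and \<open>r = q\<close>, testing against a nonnegative \<open>y \<in> \<ell>\<^sub>q'\<close> turns the claim into the mixed
  inequality of Littlewood for the matrix \<open>x n k * y k\<close>, which is the Khinchine inequality between \<open>L\<^sub>1\<close> and
  \<open>L\<^sub>2\<close>. A Hoelder argument on top of it gives the case \<open>q < 2 < p\<close>, because
  multiplication by a vector of \<open>\<ell>\<^sub>s\<close> with \<open>1/s = 1/2 - 1/p\<close> maps \<open>\<ell>\<^sub>p\<close> to \<open>\<ell>\<^sub>2\<close>.

  For \<open>p \<noteq> q\<close> and \<open>r = max p q\<close> every index \<open>n\<close> selects one coordinate \<open>k\<close>. Keeping only \<open>x n k\<close> at the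
  selected coordinate is an average over signs, so it does not increase the bound. Selecting at
  random, by thresholds that \<open>\<bar>a n k\<bar> powr p\<close> has to exceed, controls at each coordinate the total mass
  of \<open>\<bar>x n k\<bar>\<close> at every dyadic level of \<open>\<bar>a n k\<bar>\<close> (\<open>random_selection\<close>), and for \<open>p \<noteq> q\<close> the levels sum up
  like a geometric series.

  For \<open>r = \<infinity>\<close> the bound is immediate, and inclusions among the spaces \<open>\<ell>\<^sub>p\<close> reduce all
  listed cases to these.

  Outside the listed cases three examples defeat every constant. If \<open>r < q\<close>, take unit vectors for both
  families. If \<open>p > q \<ge> 2\<close> and \<open>r < p\<close>, or if \<open>q < 2\<close> and \<open>1/p + 1/q < 1/r + 1/2\<close>, take the rows of a Hadamard
  matrix: all signed sums are small by orthogonality, while the multipliers remove all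
  cancellation. The remaining case \<open>p = q = r \<in> (2, \<infinity>)\<close> is a borderline one. There \<open>J\<close> block
  diagonal Hadamard matrices with blocks of sizes \<open>1, 2, 4, \<dots>\<close> are combined: removing the cancellation adds the \<open>J\<close>
  pieces to a norm of order \<open>J\<close>, whereas the signed pieces concentrate on sets of different
  density and combine only to order \<open>J powr (1/q)\<close>.
\<close>

section \<open>Sign averages\<close>

lemma sum_PiE_insert:
  fixes f :: "('k \<Rightarrow> 'b) \<Rightarrow> real"
  assumes "k \<notin> K"
  shows "(\<Sum>s\<in>insert k K \<rightarrow>\<^sub>E S. f s) = (\<Sum>y\<in>S. \<Sum>s\<in>K \<rightarrow>\<^sub>E S. f (s(k := y)))"
proof -
  have inj: "inj_on (\<lambda>(y, g). g(k := y)) (S \<times> (K \<rightarrow>\<^sub>E S))"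
    by (rule inj_combinator) (rule assms)
  show ?thesis
    unfolding PiE_insert_eq sum.reindex[OF inj] sum.cartesian_product
    by (simp add: case_prod_unfold)
qed

abbreviation signs :: "'k set \<Rightarrow> ('k \<Rightarrow> real) set" where
  "signs K \<equiv> K \<rightarrow>\<^sub>E {-1, 1}"

lemma card_signs: "finite K \<Longrightarrow> card (signs K) = 2 ^ card K"
  by (simp add: card_PiE numeral_2_eq_2)

lemma signed_sum_insert:
  fixes c :: "'k \<Rightarrow> real"
  assumes "finite K" "k \<notin> K"
  shows "(\<Sum>l\<in>insert k K. (s(k := y)) l * c l) = y * c k + (\<Sum>l\<in>K. s l * c l)"
proof -
  have "(\<Sum>l\<in>K. (s(k := y)) l * c l) = (\<Sum>l\<in>K. s l * c l)"
    using assms by (intro sum.cong) auto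
  then show ?thesis using assms by simp
qed

lemma rademacher_second_moment:
  fixes c :: "'k \<Rightarrow> real"
  assumes "finite K"
  shows "(\<Sum>s\<in>signs K. (\<Sum>k\<in>K. s k * c k)\<^sup>2) = 2 ^ card K * (\<Sum>k\<in>K. (c k)\<^sup>2)"
  using assms
proof (induction K)
  case (insert k K)
  have "(\<Sum>s\<in>signs (insert k K). (\<Sum>l\<in>insert k K. s l * c l)\<^sup>2) =
     (\<Sum>s\<in>signs K. (- c k + (\<Sum>l\<in>K. s l * c l))\<^sup>2 + (c k + (\<Sum>l\<in>K. s l * c l))\<^sup>2)"
    unfolding sum_PiE_insert[OF insert.hyps(2)] signed_sum_insert[OF insert.hyps]
    by (simp add: sum.distrib)
  also have "\<dots> = (\<Sum>s\<in>signs K. 2 * (\<Sum>l\<in>K. s l * c l)\<^sup>2 + 2 * (c k)\<^sup>2)"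
    by (intro sum.cong) (auto simp: power2_eq_square algebra_simps)
  also have "\<dots> = 2 * (2 ^ card K * (\<Sum>k\<in>K. (c k)\<^sup>2)) + 2 ^ card K * (2 * (c k)\<^sup>2)"
    unfolding sum.distrib sum_distrib_left[symmetric] insert.IH
    using insert.hyps by (simp add: card_signs)
  finally show ?case using insert.hyps by (simp add: algebra_simps)
qed simp

text \<open>
  The constant \<open>3\<close> is the fourth moment of a Gaussian; it survives the induction because
  \<open>(c k) ^ 4\<close> enters with factor \<open>1 \<le> 3\<close>.
\<close>

lemma rademacher_fourth_moment:
  fixes c :: "'k \<Rightarrow> real"
  assumes "finite K"
  shows "(\<Sum>s\<in>signs K. (\<Sum>k\<in>K. s k * c k) ^ 4) \<le> 3 * 2 ^ card K * (\<Sum>k\<in>K. (c k)\<^sup>2)\<^sup>2"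
  using assms
proof (induction K)
  case (insert k K)
  define V where "V = (\<Sum>k\<in>K. (c k)\<^sup>2)"
  have "(\<Sum>s\<in>signs (insert k K). (\<Sum>l\<in>insert k K. s l * c l) ^ 4) =
     (\<Sum>s\<in>signs K. (- c k + (\<Sum>l\<in>K. s l * c l)) ^ 4 + (c k + (\<Sum>l\<in>K. s l * c l)) ^ 4)"
    unfolding sum_PiE_insert[OF insert.hyps(2)] signed_sum_insert[OF insert.hyps]
    by (simp add: sum.distrib)
  also have "\<dots> = (\<Sum>s\<in>signs K. 2 * (\<Sum>l\<in>K. s l * c l) ^ 4
      + 12 * (c k)\<^sup>2 * (\<Sum>l\<in>K. s l * c l)\<^sup>2 + 2 * (c k) ^ 4)"
    by (intro sum.cong) (auto simp: power2_eq_square power4_eq_xxxx algebra_simps)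
  also have "\<dots> = 2 * (\<Sum>s\<in>signs K. (\<Sum>l\<in>K. s l * c l) ^ 4)
      + 12 * (c k)\<^sup>2 * (2 ^ card K * V) + 2 ^ card K * (2 * (c k) ^ 4)"
    unfolding sum.distrib sum_distrib_left[symmetric] V_def
    using insert.hyps by (simp add: card_signs rademacher_second_moment)
  also have "\<dots> \<le> 2 * (3 * 2 ^ card K * V\<^sup>2)
      + 12 * (c k)\<^sup>2 * (2 ^ card K * V) + 2 ^ card K * (6 * (c k) ^ 4)"
    using insert.IH unfolding V_def by (intro add_mono mult_left_mono) auto
  also have "\<dots> = 3 * 2 ^ card (insert k K) * (\<Sum>k\<in>insert k K. (c k)\<^sup>2)\<^sup>2"
    using insert.hyps by (simp add: V_def power2_eq_square power4_eq_xxxx algebra_simps)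
  finally show ?case .
qed simp

text \<open>
  After scaling to \<open>\<sigma> = 1\<close> and with \<open>u = \<bar>v\<bar>\<close>, the difference of the two sides is
  \<open>u * (u - 2)\<^sup>2 * (u + 4) / 16\<close>. Averaged over signs with \<open>\<sigma>\<close> the \<open>L\<^sub>2\<close> norm, the right choice of this
  minorant turns bounds on the second and fourth moments into a lower bound on the first.
\<close>

lemma abs_ge_quartic:
  fixes v \<sigma> :: real
  assumes "0 < \<sigma>"
  shows "3 / 4 * v\<^sup>2 / \<sigma> - v ^ 4 / (16 * \<sigma> ^ 3) \<le> \<bar>v\<bar>"
proof -
  define u where "u = \<bar>v\<bar> / \<sigma>"
  have u: "\<bar>v\<bar> = u * \<sigma>" "v\<^sup>2 = u\<^sup>2 * \<sigma>\<^sup>2" "v ^ 4 = u ^ 4 * \<sigma> ^ 4" "0 \<le> u"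
    using assms by (auto simp: u_def power_divide)
  have "0 \<le> u * ((u - 2)\<^sup>2 * (u + 4) / 16)" using u(4) by simp
  also have "u * ((u - 2)\<^sup>2 * (u + 4) / 16) = u - (3 / 4 * u\<^sup>2 - u ^ 4 / 16)"
    by (simp add: power2_eq_square power4_eq_xxxx field_simps)
  finally have "(3 / 4 * u\<^sup>2 - u ^ 4 / 16) * \<sigma> \<le> u * \<sigma>"
    using assms by (intro mult_right_mono) auto
  moreover have "(3 / 4 * u\<^sup>2 - u ^ 4 / 16) * \<sigma> = 3 / 4 * v\<^sup>2 / \<sigma> - v ^ 4 / (16 * \<sigma> ^ 3)"
    using assms unfolding u by (simp add: field_simps power2_eq_square power4_eq_xxxx power3_eq_cube)
  ultimately show ?thesis using u by simp
qed

lemma khinchine_l1: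
  fixes c :: "'k \<Rightarrow> real"
  assumes "finite K"
  shows "9 / 16 * 2 ^ card K * sqrt (\<Sum>k\<in>K. (c k)\<^sup>2) \<le> (\<Sum>s\<in>signs K. \<bar>\<Sum>k\<in>K. s k * c k\<bar>)"
proof (cases "(\<Sum>k\<in>K. (c k)\<^sup>2) = 0")
  case True
  then show ?thesis by (auto intro: sum_nonneg)
next
  case False
  define V where "V = (\<Sum>k\<in>K. (c k)\<^sup>2)"
  define \<sigma> where "\<sigma> = sqrt V"
  define S where "S s = (\<Sum>k\<in>K. s k * c k)" for s
  have "V > 0" using False by (simp add: V_def order.not_eq_order_implies_strict sum_nonneg)
  then have \<sigma>: "\<sigma> > 0" "V = \<sigma>\<^sup>2" by (auto simp: \<sigma>_def)
  have "9 / 16 * 2 ^ card K * \<sigma> = 3 / (4 * \<sigma>) * (2 ^ card K * V) - 1 / (16 * \<sigma> ^ 3) * (3 * 2 ^ card K * V\<^sup>2)"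
    using \<sigma>(1) unfolding \<sigma>(2) by (simp add: field_simps power2_eq_square power3_eq_cube)
  also have "\<dots> \<le> 3 / (4 * \<sigma>) * (\<Sum>s\<in>signs K. (S s)\<^sup>2) - 1 / (16 * \<sigma> ^ 3) * (\<Sum>s\<in>signs K. S s ^ 4)"
    unfolding S_def V_def rademacher_second_moment[OF assms]
    using \<sigma>(1) by (intro diff_left_mono mult_left_mono rademacher_fourth_moment[OF assms]) auto
  also have "\<dots> = (\<Sum>s\<in>signs K. 3 / 4 * (S s)\<^sup>2 / \<sigma> - S s ^ 4 / (16 * \<sigma> ^ 3))"
    by (simp add: sum_subtractf sum_distrib_left)
  also have "\<dots> \<le> (\<Sum>s\<in>signs K. \<bar>S s\<bar>)"
    by (intro sum_mono abs_ge_quartic \<sigma>)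
  finally show ?thesis by (simp add: \<sigma>_def V_def S_def)
qed

text \<open>
  A sign pattern that is at least as good as the average in the Khinchine inequality, applied to all rows
  of the matrix simultaneously.
\<close>

lemma littlewood_mixed:
  fixes M :: "'i \<Rightarrow> 'k \<Rightarrow> real"
  assumes "finite K"
  obtains s where "\<And>k. s k \<in> {-1, 1}"
    "(\<Sum>n\<in>I. sqrt (\<Sum>k\<in>K. (M n k)\<^sup>2)) \<le> 16 / 9 * (\<Sum>n\<in>I. \<bar>\<Sum>k\<in>K. s k * M n k\<bar>)"
proof -
  define L where "L = (\<Sum>n\<in>I. sqrt (\<Sum>k\<in>K. (M n k)\<^sup>2))"
  define R where "R s = (\<Sum>n\<in>I. \<bar>\<Sum>k\<in>K. s k * M n k\<bar>)" for s
  have "(\<Sum>s\<in>signs K. 9 / 16 * L) = (\<Sum>n\<in>I. 9 / 16 * 2 ^ card K * sqrt (\<Sum>k\<in>K. (M n k)\<^sup>2))"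
    using assms by (simp add: card_signs L_def sum_distrib_left mult_ac)
  also have "\<dots> \<le> (\<Sum>n\<in>I. \<Sum>s\<in>signs K. \<bar>\<Sum>k\<in>K. s k * M n k\<bar>)"
    by (intro sum_mono khinchine_l1 assms)
  also have "\<dots> = (\<Sum>s\<in>signs K. R s)" unfolding R_def by (rule sum.swap)
  finally have *: "(\<Sum>s\<in>signs K. 9 / 16 * L) \<le> (\<Sum>s\<in>signs K. R s)" .
  have "\<exists>s\<in>signs K. 9 / 16 * L \<le> R s"
  proof (rule ccontr)
    assume "\<not> ?thesis"
    then have "(\<Sum>s\<in>signs K. R s) < (\<Sum>s\<in>signs K. 9 / 16 * L)"
      using assms by (intro sum_strict_mono) (auto simp: finite_PiE PiE_eq_empty_iff)
    then show False using * by simp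
  qed
  then obtain s where s: "s \<in> signs K" "9 / 16 * L \<le> R s" by blast
  have "(\<Sum>k\<in>K. s k * M n k) = (\<Sum>k\<in>K. (if k \<in> K then s k else 1) * M n k)" for n
    by (intro sum.cong) auto
  then show ?thesis
    using s that[of "\<lambda>k. if k \<in> K then s k else 1"]
    by (fastforce simp: L_def R_def PiE_iff)
qed

section \<open>Square summable multipliers\<close>

text \<open>
  As an operator from \<open>\<ell>\<^sub>\<infinity>\<close>, which sends \<open>t\<close> to \<open>\<Sum>n\<in>I. t n * x n\<close>, the family has norm at most \<open>1\<close> into \<open>\<ell>\<^sub>q\<close>: the
  norm is attained at signs, the extreme points of the unit ball.
\<close>

definition sign_bounded :: "real \<Rightarrow> 'i set \<Rightarrow> 'k set \<Rightarrow> ('i \<Rightarrow> 'k \<Rightarrow> real) \<Rightarrow> bool" where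
  "sign_bounded q I K x \<longleftrightarrow>
     (\<forall>t. (\<forall>n. t n \<in> {-1, 1}) \<longrightarrow> (\<Sum>k\<in>K. \<bar>\<Sum>n\<in>I. t n * x n k\<bar> powr q) \<le> 1)"

text \<open>
  A crude form of Young's inequality for conjugate exponents; unlike the usual one it includes
  \<open>q = 1\<close> without change.
\<close>

lemma mult_powr_split:
  fixes u f q :: real
  assumes "0 \<le> u" "0 \<le> f" "1 \<le> q"
  shows "u * f powr (q - 1) \<le> f powr q / 2 + 2 powr (q - 1) * u powr q"
proof (cases "u \<le> f / 2")
  case True
  have "u * f powr (q - 1) \<le> f / 2 * f powr (q - 1)" by (intro mult_right_mono True) auto
  also have "\<dots> = f powr q / 2" using assms by (simp add: powr_mult_base)
  finally show ?thesis by (smt (verit) powr_ge_zero mult_nonneg_nonneg)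
next
  case False
  have "u * f powr (q - 1) \<le> u * (2 * u) powr (q - 1)"
    using False assms by (intro mult_left_mono powr_mono2) auto
  also have "\<dots> = 2 powr (q - 1) * u powr q" using assms by (simp add: powr_mult powr_mult_base)
  finally show ?thesis by (simp add: add_increasing)
qed

text \<open>
  With \<open>f k = (\<Sum>n. \<bar>a n k\<bar> * \<bar>x n k\<bar>)\<close>, the extremal functional is \<open>y = f powr (q - 1)\<close>. Cauchy--Schwarz removes \<open>a\<close>,
  the mixed inequality for \<open>x n k * y k\<close> supplies signs, and \<open>mult_powr_split\<close> absorbs half of
  the left-hand side.
\<close>

lemma finite_action_l2:
  fixes x a :: "'i \<Rightarrow> 'k \<Rightarrow> real"
  assumes "finite I" "finite K" "1 \<le> q" and x: "sign_bounded q I K x"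
    and a: "\<And>n. n \<in> I \<Longrightarrow> (\<Sum>k\<in>K. (a n k)\<^sup>2) \<le> 1"
  shows "(\<Sum>k\<in>K. (\<Sum>n\<in>I. \<bar>a n k\<bar> * \<bar>x n k\<bar>) powr q) \<le> (32 / 9) powr q"
proof -
  define f where "f k = (\<Sum>n\<in>I. \<bar>a n k\<bar> * \<bar>x n k\<bar>)" for k
  define y where "y k = f k powr (q - 1)" for k
  define F where "F = (\<Sum>k\<in>K. f k powr q)"
  have f0: "0 \<le> f k" and y0: "0 \<le> y k" for k by (auto simp: f_def y_def intro: sum_nonneg)
  obtain s where s: "\<And>k. s k \<in> {-1, 1}"
    "(\<Sum>n\<in>I. sqrt (\<Sum>k\<in>K. (x n k * y k)\<^sup>2)) \<le> 16 / 9 * (\<Sum>n\<in>I. \<bar>\<Sum>k\<in>K. s k * (x n k * y k)\<bar>)"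
    using littlewood_mixed[OF assms(2), of "\<lambda>n k. x n k * y k" I] by blast
  \<comment> \<open>The signs \<open>t\<close> on the index and \<open>s\<close> on the coordinates linearize the right-hand side.\<close>
  define t where "t n = (if (\<Sum>k\<in>K. s k * (x n k * y k)) < 0 then -1 else 1 :: real)" for n
  define u where "u k = \<bar>\<Sum>n\<in>I. t n * x n k\<bar>" for k
  have u: "(\<Sum>k\<in>K. u k powr q) \<le> 1" using x by (auto simp: sign_bounded_def u_def t_def)
  have "F = (\<Sum>k\<in>K. f k * y k)"
    unfolding F_def y_def using f0 by (intro sum.cong) (auto simp: powr_mult_base)
  also have "\<dots> = (\<Sum>n\<in>I. \<Sum>k\<in>K. \<bar>a n k\<bar> * \<bar>x n k * y k\<bar>)"
    unfolding f_def sum_distrib_right using y0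
    by (subst sum.swap) (simp add: abs_mult mult.assoc)
  also have "\<dots> \<le> (\<Sum>n\<in>I. sqrt (\<Sum>k\<in>K. (x n k * y k)\<^sup>2))"
  proof (rule sum_mono)
    fix n assume n: "n \<in> I"
    have "(\<Sum>k\<in>K. \<bar>a n k\<bar> * \<bar>x n k * y k\<bar>) \<le> L2_set (a n) K * L2_set (\<lambda>k. x n k * y k) K"
      by (rule L2_set_mult_ineq)
    also have "\<dots> \<le> 1 * L2_set (\<lambda>k. x n k * y k) K"
      using a[OF n] by (intro mult_right_mono) (auto simp: L2_set_def sum_nonneg)
    finally show "(\<Sum>k\<in>K. \<bar>a n k\<bar> * \<bar>x n k * y k\<bar>) \<le> sqrt (\<Sum>k\<in>K. (x n k * y k)\<^sup>2)"
      by (simp add: L2_set_def)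
  qed
  also note s(2)
  also have "(\<Sum>n\<in>I. \<bar>\<Sum>k\<in>K. s k * (x n k * y k)\<bar>) = (\<Sum>n\<in>I. \<Sum>k\<in>K. t n * (s k * (x n k * y k)))"
    by (intro sum.cong refl) (auto simp: t_def sum_negf)
  also have "\<dots> = (\<Sum>k\<in>K. s k * y k * (\<Sum>n\<in>I. t n * x n k))"
    by (subst sum.swap) (simp add: sum_distrib_left mult_ac)
  also have "\<dots> \<le> (\<Sum>k\<in>K. y k * u k)"
  proof (rule sum_mono)
    fix k
    have "s k * y k * (\<Sum>n\<in>I. t n * x n k) \<le> \<bar>s k * y k * (\<Sum>n\<in>I. t n * x n k)\<bar>" by simp
    also have "\<dots> = y k * u k" using s(1)[of k] y0[of k] by (auto simp: abs_mult u_def)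
    finally show "s k * y k * (\<Sum>n\<in>I. t n * x n k) \<le> y k * u k" .
  qed
  also have "16 / 9 * (\<Sum>k\<in>K. y k * u k) = (\<Sum>k\<in>K. (16 / 9 * u k) * f k powr (q - 1))"
    by (simp add: y_def sum_distrib_left mult_ac)
  finally have "F \<le> (\<Sum>k\<in>K. (16 / 9 * u k) * f k powr (q - 1))" by simp
  also have "\<dots> \<le> (\<Sum>k\<in>K. f k powr q / 2 + 2 powr (q - 1) * (16 / 9 * u k) powr q)"
    by (intro sum_mono mult_powr_split) (use f0 assms in \<open>auto simp: u_def\<close>)
  also have "\<dots> = F / 2 + 2 powr (q - 1) * (16 / 9) powr q * (\<Sum>k\<in>K. u k powr q)"
  proof -
    have "(16 / 9 * u k) powr q = (16 / 9) powr q * u k powr q" for k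
      by (rule powr_mult)
    then show ?thesis
      by (simp add: sum.distrib F_def sum_divide_distrib sum_distrib_left mult.assoc)
  qed
  also have "\<dots> \<le> F / 2 + 2 powr (q - 1) * (16 / 9) powr q * 1"
    by (intro add_left_mono mult_left_mono u) auto
  finally have "F \<le> 2 * 2 powr (q - 1) * (16 / 9) powr q" by simp
  also have "\<dots> = (2 * (16 / 9)) powr q" by (simp add: powr_mult_base powr_mult[symmetric])
  finally show ?thesis by (simp add: F_def f_def)
qed

text \<open>
  The converse of the Hoelder inequality: \<open>\<parallel>f\<parallel>\<^sub>r\<close> is \<open>\<parallel>f * v\<parallel>\<^sub>q\<close> for a suitable \<open>v\<close> in the unit
  sphere of \<open>\<ell>\<^sub>s\<close>, where \<open>1/s = 1/2 - \<pi>\<close> and \<open>v = w powr (1/s)\<close>. For this \<open>v\<close> the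
  products \<open>a n * v\<close> lie in the unit ball of \<open>\<ell>\<^sub>2\<close>. The multipliers are described by weights \<open>b\<close>, which
  covers \<open>p = \<infinity>\<close> as \<open>\<pi> = 0\<close> with \<open>b\<close> constant.
\<close>

lemma finite_action_interpolated:
  fixes x a b :: "'i \<Rightarrow> 'k \<Rightarrow> real"
  assumes fin: "finite I" "finite K" and q: "1 \<le> q" and x: "sign_bounded q I K x"
    and \<pi>: "0 \<le> \<pi>" "\<pi> < 1 / 2" and r: "0 < r" "1 / r = \<pi> + 1 / q - 1 / 2"
    and b: "\<And>n k. n \<in> I \<Longrightarrow> k \<in> K \<Longrightarrow> 0 \<le> b n k" "\<And>n. n \<in> I \<Longrightarrow> (\<Sum>k\<in>K. b n k) \<le> 1"
    and a: "\<And>n k. n \<in> I \<Longrightarrow> k \<in> K \<Longrightarrow> \<bar>a n k\<bar> \<le> b n k powr \<pi>"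
  shows "(\<Sum>k\<in>K. (\<Sum>n\<in>I. \<bar>a n k\<bar> * \<bar>x n k\<bar>) powr r) \<le> (32 / 9) powr r"
proof -
  define f where "f k = (\<Sum>n\<in>I. \<bar>a n k\<bar> * \<bar>x n k\<bar>)" for k
  define F where "F = (\<Sum>k\<in>K. f k powr r)"
  define w where "w k = f k powr r / F" for k
  define \<beta> where "\<beta> = 1 / 2 - \<pi>"
  have f0: "0 \<le> f k" for k by (auto simp: f_def intro: sum_nonneg)
  have F0: "0 \<le> F" by (auto simp: F_def intro: sum_nonneg)
  show ?thesis
  proof (cases "F = 0")
    case True
    then show ?thesis by (simp add: F_def f_def)
  next
    case False
    then have F: "0 < F" using F0 by simp
    have w0: "0 \<le> w k" for k using F by (simp add: w_def)
    have w1: "(\<Sum>k\<in>K. w k) = 1" using F by (simp add: w_def F_def flip: sum_divide_distrib)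
    have a': "(\<Sum>k\<in>K. (a n k * w k powr \<beta>)\<^sup>2) \<le> 1" if n: "n \<in> I" for n
    proof -
      have "(a n k * w k powr \<beta>)\<^sup>2 \<le> 2 * \<pi> * b n k + 2 * \<beta> * w k" if k: "k \<in> K" for k
      proof (cases "w k = 0 \<or> b n k = 0")
        case True
        then have "a n k * w k powr \<beta> = 0" using a[OF n k] by auto
        moreover have "0 \<le> 2 * \<pi> * b n k + 2 * \<beta> * w k"
          using \<pi> b(1)[OF n k] w0[of k] by (auto simp: \<beta>_def)
        ultimately show ?thesis by (simp only: power_zero_numeral)
      next
        case False
        then have "0 < w k" "0 < b n k" using w0[of k] b(1)[OF n k] by auto
        have "(a n k * w k powr \<beta>)\<^sup>2 \<le> (b n k powr \<pi> * w k powr \<beta>)\<^sup>2"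
          using a[OF n k] by (simp add: abs_le_square_iff[symmetric] abs_mult mult_right_mono)
        also have "\<dots> = b n k powr (2 * \<pi>) * w k powr (2 * \<beta>)"
        proof -
          have "(z powr e)\<^sup>2 = z powr (2 * e)" for z e :: real
            by (simp add: power2_eq_square flip: powr_add)
          then show ?thesis by (simp add: power_mult_distrib)
        qed
        also have "\<dots> \<le> 2 * \<pi> * b n k + 2 * \<beta> * w k"
          using \<pi> \<open>0 < w k\<close> \<open>0 < b n k\<close> by (intro Youngs_inequality_0) (auto simp: \<beta>_def)
        finally show ?thesis .
      qed
      then have "(\<Sum>k\<in>K. (a n k * w k powr \<beta>)\<^sup>2) \<le> (\<Sum>k\<in>K. 2 * \<pi> * b n k + 2 * \<beta> * w k)"
        by (rule sum_mono)
      also have "\<dots> = 2 * \<pi> * (\<Sum>k\<in>K. b n k) + 2 * \<beta>"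
        using w1 by (simp add: sum.distrib sum_distrib_left[symmetric])
      also have "\<dots> \<le> 2 * \<pi> * 1 + 2 * \<beta>"
        using \<pi> b(2)[OF n] by (intro add_right_mono mult_left_mono) auto
      finally show ?thesis by (simp add: \<beta>_def)
    qed
    have \<beta>q: "r * (\<beta> * q) + q = r" "q / r = 1 - \<beta> * q"
      using r q by (auto simp: \<beta>_def field_simps)
    have "f k powr r * F powr (- (\<beta> * q)) = (\<Sum>n\<in>I. \<bar>a n k * w k powr \<beta>\<bar> * \<bar>x n k\<bar>) powr q" for k
    proof -
      have "(\<Sum>n\<in>I. \<bar>a n k * w k powr \<beta>\<bar> * \<bar>x n k\<bar>) = f k * w k powr \<beta>"
        by (simp add: f_def abs_mult sum_distrib_left mult_ac)
      also have "\<dots> powr q = f k powr q * w k powr (\<beta> * q)"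
        using f0 by (simp add: powr_mult powr_powr)
      also have "\<dots> = f k powr q * f k powr (r * (\<beta> * q)) * F powr (- (\<beta> * q))"
        using F f0 by (simp add: w_def powr_divide powr_powr powr_minus_divide)
      also have "f k powr q * f k powr (r * (\<beta> * q)) = f k powr r"
        unfolding powr_add[symmetric] using \<beta>q by (simp add: add.commute)
      finally show ?thesis by simp
    qed
    then have "F * F powr (- (\<beta> * q)) = (\<Sum>k\<in>K. (\<Sum>n\<in>I. \<bar>a n k * w k powr \<beta>\<bar> * \<bar>x n k\<bar>) powr q)"
      by (simp add: F_def sum_distrib_right)
    also have "\<dots> \<le> (32 / 9) powr q"
      by (rule finite_action_l2[OF fin q x a'])
    finally have "F powr (q / r) \<le> (32 / 9) powr q"
      using F \<beta>q by (simp add: powr_mult_base)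
    then have "(F powr (q / r)) powr (r / q) \<le> ((32 / 9) powr q) powr (r / q)"
      using q r by (intro powr_mono2) auto
    then have "F \<le> (32 / 9) powr r" using q r F by (simp add: powr_powr)
    then show ?thesis by (simp add: F_def f_def)
  qed
qed

section \<open>Random selection of a coordinate\<close>

lemma convex_on_powr_nonneg:
  assumes "1 \<le> q"
  shows "convex_on {0..} (\<lambda>x::real. x powr q)"
proof (rule convex_onI)
  fix t x y :: real
  assume t: "0 < t" "t < 1" and xy: "x \<in> {0..}" "y \<in> {0..}"
  have shrink: "(c * z) powr q \<le> c * z powr q" if "0 < c" "c < 1" "0 \<le> z" for c z :: real
    using that assms powr_mono'[of 1 q c] by (simp add: powr_mult mult_right_mono)
  show "((1 - t) *\<^sub>R x + t *\<^sub>R y) powr q \<le> (1 - t) * x powr q + t * y powr q"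
  proof (cases "x = 0 \<or> y = 0")
    case True
    then show ?thesis using shrink[of t y] shrink[of "1 - t" x] t xy by auto
  next
    case False
    then show ?thesis
      using convex_onD[OF powr_convex[OF assms], of t x y] t xy by auto
  qed
qed auto

lemma abs_powr_midpoint:
  fixes u v :: real
  assumes "1 \<le> q"
  shows "2 * \<bar>v\<bar> powr q \<le> \<bar>v + u\<bar> powr q + \<bar>- v + u\<bar> powr q"
    and "2 * \<bar>v\<bar> powr q \<le> \<bar>u + v\<bar> powr q + \<bar>- u + v\<bar> powr q"
proof -
  have "\<bar>v\<bar> powr q \<le> (1 / 2 * \<bar>v + u\<bar> + 1 / 2 * \<bar>- v + u\<bar>) powr q"
    using assms by (intro powr_mono2) (auto simp: abs_if field_simps)
  also have "\<dots> \<le> 1 / 2 * \<bar>v + u\<bar> powr q + 1 / 2 * \<bar>- v + u\<bar> powr q"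
    using convex_onD[OF convex_on_powr_nonneg[OF assms], of "1 / 2" "\<bar>v + u\<bar>" "\<bar>- v + u\<bar>"] by simp
  finally show first: "2 * \<bar>v\<bar> powr q \<le> \<bar>v + u\<bar> powr q + \<bar>- v + u\<bar> powr q" by simp
  have "\<bar>- u + v\<bar> = \<bar>- v + u\<bar>" by linarith
  with first show "2 * \<bar>v\<bar> powr q \<le> \<bar>u + v\<bar> powr q + \<bar>- u + v\<bar> powr q"
    by (simp only: add.commute[of u v])
qed

lemma powr_mean_le:
  fixes g :: "'w \<Rightarrow> real"
  assumes "1 \<le> q" "finite \<Omega>" "\<And>\<omega>. \<omega> \<in> \<Omega> \<Longrightarrow> 0 \<le> g \<omega>"
  shows "real (card \<Omega>) * ((\<Sum>\<omega>\<in>\<Omega>. g \<omega>) / card \<Omega>) powr q \<le> (\<Sum>\<omega>\<in>\<Omega>. g \<omega> powr q)"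
proof (cases "\<Omega> = {}")
  case False
  have "(\<Sum>\<omega>\<in>\<Omega>. (1 / card \<Omega>) *\<^sub>R g \<omega>) powr q \<le> (\<Sum>\<omega>\<in>\<Omega>. (1 / card \<Omega>) * g \<omega> powr q)"
    using assms False by (intro convex_on_sum[OF _ _ convex_on_powr_nonneg]) auto
  then show ?thesis
    using False assms(2) by (simp add: sum_divide_distrib[symmetric] field_simps card_gt_0_iff)
qed simp

text \<open>
  By convexity, averaging over a sign in front of one vector \<open>z l\<close> can only decrease the norm and isolates
  that vector at its own coordinate \<open>l\<close>; so some choice of signs is at least as large as the diagonal.
\<close>

lemma sign_choice_diagonal:
  fixes z :: "'k \<Rightarrow> 'k \<Rightarrow> real"
  assumes "finite L" "finite K" "L \<subseteq> K" "1 \<le> q"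
  shows "\<exists>e. (\<forall>l. e l \<in> {-1, 1}) \<and>
    (\<Sum>k\<in>L. \<bar>z k k\<bar> powr q) \<le> (\<Sum>k\<in>K. \<bar>\<Sum>l\<in>L. e l * z l k\<bar> powr q)"
  using assms
proof (induction L arbitrary: K)
  case empty
  then show ?case by (intro exI[of _ "\<lambda>_. 1"]) (auto intro: sum_nonneg)
next
  case (insert l L)
  have "L \<subseteq> K - {l}" using insert by auto
  then obtain e where e: "\<And>k. e k \<in> {-1, 1 :: real}"
    "(\<Sum>k\<in>L. \<bar>z k k\<bar> powr q) \<le> (\<Sum>k\<in>K - {l}. \<bar>\<Sum>l\<in>L. e l * z l k\<bar> powr q)"
    using insert.IH[of "K - {l}"] insert.prems by blast
  define u where "u k = (\<Sum>l\<in>L. e l * z l k)" for k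
  define T where "T \<tau> = (\<Sum>k\<in>K. \<bar>\<tau> * z l k + u k\<bar> powr q)" for \<tau> :: real
  have K: "K = insert l (K - {l})" using insert.prems by auto
  have "2 * (\<bar>z l l\<bar> powr q + (\<Sum>k\<in>K - {l}. \<bar>u k\<bar> powr q))
     = 2 * \<bar>z l l\<bar> powr q + (\<Sum>k\<in>K - {l}. 2 * \<bar>u k\<bar> powr q)"
    by (simp add: sum_distrib_left)
  also have "\<dots> \<le> (\<bar>z l l + u l\<bar> powr q + \<bar>- z l l + u l\<bar> powr q)
       + (\<Sum>k\<in>K - {l}. \<bar>z l k + u k\<bar> powr q + \<bar>- z l k + u k\<bar> powr q)"
    by (rule add_mono[OF abs_powr_midpoint(1)[OF insert.prems(3)]], rule sum_mono,
      rule abs_powr_midpoint(2)[OF insert.prems(3)])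
  also have "\<dots> = T 1 + T (- 1)"
  proof -
    have "T \<tau> = \<bar>\<tau> * z l l + u l\<bar> powr q + (\<Sum>k\<in>K - {l}. \<bar>\<tau> * z l k + u k\<bar> powr q)" for \<tau>
      unfolding T_def using insert.prems by (intro sum.remove) auto
    then show ?thesis by (simp add: sum.distrib)
  qed
  finally have "\<bar>z l l\<bar> powr q + (\<Sum>k\<in>K - {l}. \<bar>u k\<bar> powr q) \<le> T 1 \<or>
                \<bar>z l l\<bar> powr q + (\<Sum>k\<in>K - {l}. \<bar>u k\<bar> powr q) \<le> T (- 1)"
    by argo
  then obtain \<tau> :: real where \<tau>: "\<tau> \<in> {-1, 1}"
    "\<bar>z l l\<bar> powr q + (\<Sum>k\<in>K - {l}. \<bar>u k\<bar> powr q) \<le> T \<tau>" by blast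
  have "(\<Sum>m\<in>insert l L. (e(l := \<tau>)) m * z m k) = \<tau> * z l k + u k" for k
    unfolding u_def by (rule signed_sum_insert) (use insert.hyps in auto)
  moreover have "(\<Sum>k\<in>insert l L. \<bar>z k k\<bar> powr q) \<le> T \<tau>"
    using insert.hyps e(2) \<tau>(2) by (simp add: u_def)
  ultimately show ?case
    using e(1) \<tau>(1) by (intro exI[of _ "e(l := \<tau>)"]) (auto simp: T_def)
qed

text \<open>
  The vectors with the same selected coordinate are grouped; the sign of each group comes from the diagonal
  lemma, and the inner signs make \<open>x n (sel n)\<close> positive.
\<close>

lemma selection_bound:
  fixes x :: "'i \<Rightarrow> 'k \<Rightarrow> real"
  assumes "finite I" "finite K" "1 \<le> q" and x: "sign_bounded q I K x" and sel: "sel ` I \<subseteq> K"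
  shows "(\<Sum>k\<in>K. (\<Sum>n\<in>{n \<in> I. sel n = k}. \<bar>x n k\<bar>) powr q) \<le> 1"
proof -
  \<comment> \<open>The value at \<open>x n (sel n) = 0\<close> is \<open>1\<close>, so that \<open>g\<close> is an admissible choice of signs.\<close>
  define g where "g n = (if x n (sel n) < 0 then -1 else 1 :: real)" for n
  define z where "z l k = (\<Sum>n\<in>{n \<in> I. sel n = l}. g n * x n k)" for l k
  have z: "z k k = (\<Sum>n\<in>{n \<in> I. sel n = k}. \<bar>x n k\<bar>)" for k
    unfolding z_def by (intro sum.cong) (auto simp: g_def)
  obtain e where e: "\<And>l. e l \<in> {-1, 1 :: real}"
    "(\<Sum>k\<in>K. \<bar>z k k\<bar> powr q) \<le> (\<Sum>k\<in>K. \<bar>\<Sum>l\<in>K. e l * z l k\<bar> powr q)"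
    using sign_choice_diagonal[OF assms(2,2) subset_refl assms(3), of z] by blast
  have "(\<Sum>l\<in>K. e l * z l k) = (\<Sum>n\<in>I. e (sel n) * g n * x n k)" for k
  proof -
    have "(\<Sum>l\<in>K. e l * z l k) = (\<Sum>l\<in>K. \<Sum>n\<in>{n \<in> I. sel n = l}. e (sel n) * g n * x n k)"
      unfolding z_def sum_distrib_left by (intro sum.cong) (auto simp: mult.assoc)
    also have "\<dots> = (\<Sum>n\<in>I. e (sel n) * g n * x n k)"
      by (rule sum.group[OF assms(1,2) sel])
    finally show ?thesis .
  qed
  moreover have "(\<Sum>k\<in>K. \<bar>\<Sum>n\<in>I. e (sel n) * g n * x n k\<bar> powr q) \<le> 1"
  proof -
    have "\<forall>n. e (sel n) * g n \<in> {-1, 1}" using e(1) by (auto simp: g_def)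
    then show ?thesis
      using x[unfolded sign_bounded_def, THEN spec, of "\<lambda>n. e (sel n) * g n"] by simp
  qed
  ultimately have "(\<Sum>k\<in>K. \<bar>z k k\<bar> powr q) \<le> 1" using e(2) by simp
  moreover have "\<bar>z k k\<bar> = (\<Sum>n\<in>{n \<in> I. sel n = k}. \<bar>x n k\<bar>)" for k
    unfolding z by (simp add: sum_nonneg)
  ultimately show ?thesis by simp
qed

text \<open>
  The union bound: a uniform threshold in \<open>{1..4 * M}\<close> is at most \<open>c k\<close> with probability at most
  \<open>c k / (4 * M)\<close>.
\<close>

lemma card_some_active_le:
  fixes c :: "'k \<Rightarrow> real" and M :: nat
  assumes K: "finite K" and M: "0 < M" and c: "\<And>k. k \<in> K \<Longrightarrow> 0 \<le> c k" "(\<Sum>k\<in>K. c k) \<le> 2 * M"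
  shows "2 * real (card {\<omega> \<in> K \<rightarrow>\<^sub>E {1..4 * M}. \<exists>k\<in>K. real (\<omega> k) \<le> c k})
     \<le> card (K \<rightarrow>\<^sub>E {1..4 * M})"
proof -
  let ?\<Omega> = "K \<rightarrow>\<^sub>E {1..4 * M}"
  have one: "4 * M * real (card {\<omega> \<in> ?\<Omega>. real (\<omega> k) \<le> c k}) \<le> c k * card ?\<Omega>" if k: "k \<in> K" for k
  proof -
    let ?T = "{u \<in> {1..4 * M}. real u \<le> c k}"
    have "{\<omega> \<in> ?\<Omega>. real (\<omega> k) \<le> c k} = (\<Pi>\<^sub>E j\<in>K. if j = k then ?T else {1..4 * M})"
      using k by (auto simp: PiE_iff extensional_def split: if_splits)
    then have "card {\<omega> \<in> ?\<Omega>. real (\<omega> k) \<le> c k} = (\<Prod>j\<in>K. card (if j = k then ?T else {1..4 * M}))"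
      using K by (simp add: card_PiE)
    also have "\<dots> = card ?T * (4 * M) ^ (card K - 1)"
    proof -
      have "(\<Prod>j\<in>K - {k}. card (if j = k then ?T else {1..4 * M})) = (\<Prod>j\<in>K - {k}. 4 * M)"
        by (intro prod.cong) auto
      then show ?thesis using K k by (simp add: prod.remove[of _ k])
    qed
    finally have card: "card {\<omega> \<in> ?\<Omega>. real (\<omega> k) \<le> c k} = card ?T * (4 * M) ^ (card K - 1)" .
    have "?T \<subseteq> {1..nat \<lfloor>c k\<rfloor>}" by (auto simp: le_nat_floor)
    then have "card ?T \<le> nat \<lfloor>c k\<rfloor>" using card_mono[of "{1..nat \<lfloor>c k\<rfloor>}" ?T] by simp
    then have T: "real (card ?T) \<le> c k" using of_nat_floor[OF c(1)[OF k]] by linarith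
    have "card K \<noteq> 0" using K k by auto
    then have \<Omega>: "card ?\<Omega> = 4 * M * (4 * M) ^ (card K - 1)"
      using K by (simp add: card_PiE power_eq_if)
    have "4 * M * real (card {\<omega> \<in> ?\<Omega>. real (\<omega> k) \<le> c k}) = real (card ?T) * card ?\<Omega>"
      unfolding card \<Omega> by simp
    also have "\<dots> \<le> c k * card ?\<Omega>" by (intro mult_right_mono T) simp
    finally show ?thesis .
  qed
  have "card {\<omega> \<in> ?\<Omega>. \<exists>k\<in>K. real (\<omega> k) \<le> c k} = card (\<Union>k\<in>K. {\<omega> \<in> ?\<Omega>. real (\<omega> k) \<le> c k})"
    by (rule arg_cong[where f = card]) auto
  also have "\<dots> \<le> (\<Sum>k\<in>K. card {\<omega> \<in> ?\<Omega>. real (\<omega> k) \<le> c k})" by (rule card_UN_le[OF K])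
  finally have "4 * M * real (card {\<omega> \<in> ?\<Omega>. \<exists>k\<in>K. real (\<omega> k) \<le> c k})
      \<le> 4 * M * real (\<Sum>k\<in>K. card {\<omega> \<in> ?\<Omega>. real (\<omega> k) \<le> c k})"
    by (intro mult_left_mono of_nat_mono) auto
  also have "\<dots> = (\<Sum>k\<in>K. 4 * M * real (card {\<omega> \<in> ?\<Omega>. real (\<omega> k) \<le> c k}))"
    by (simp add: sum_distrib_left)
  also have "\<dots> \<le> (\<Sum>k\<in>K. c k * card ?\<Omega>)" by (intro sum_mono one)
  also have "\<dots> \<le> (2 * real M) * real (card ?\<Omega>)"
    unfolding sum_distrib_right[symmetric] using c(2) by (intro mult_right_mono) auto
  finally show ?thesis using M by simp
qed

text \<open>
  Every coordinate \<open>k\<close> draws a threshold \<open>\<omega> k\<close> uniformly from \<open>{1..4 * M}\<close> and is active for \<open>n\<close> if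
  \<open>\<omega> k \<le> M * b n k\<close>; each \<open>n\<close> selects a coordinate that is active for it. The number \<open>A k\<close> is the mean of the
  \<open>q\<close>-th power of the mass selecting \<open>k\<close>. With probability \<open>v / (4 * M)\<close> the threshold of \<open>k\<close> is at most \<open>v\<close>; then
  every \<open>n\<close> with \<open>v \<le> M * b n k\<close> finds \<open>k\<close> active, and with probability at least \<open>1 / 2\<close> no other coordinate
  is, so that \<open>n\<close> selects \<open>k\<close>. The same \<open>A\<close> serves all levels \<open>v\<close>.
\<close>

lemma random_selection:
  fixes x b :: "'i \<Rightarrow> 'k \<Rightarrow> real" and M :: nat
  assumes fin: "finite I" "finite K" and q: "1 \<le> q" and x: "sign_bounded q I K x" and M: "0 < M"
    and b: "\<And>n k. n \<in> I \<Longrightarrow> k \<in> K \<Longrightarrow> 0 \<le> b n k" "\<And>n. n \<in> I \<Longrightarrow> (\<Sum>k\<in>K. b n k) \<le> 2"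
  shows "\<exists>A. (\<forall>k. 0 \<le> A k) \<and> (\<Sum>k\<in>K. A k) \<le> 1 \<and> (\<forall>k\<in>K. \<forall>v\<le>M.
       real v / (4 * real M) * ((\<Sum>n\<in>{n \<in> I. real v \<le> real M * b n k}. \<bar>x n k\<bar>) / 2) powr q \<le> A k)"
proof (cases "K = {}")
  case True
  then show ?thesis by (intro exI[of _ "\<lambda>_. 0"]) simp
next
  case False
  define S where "S = {1..4 * M}"
  define sel where "sel \<omega> n = (if \<exists>k\<in>K. real (\<omega> k) \<le> M * b n k
      then SOME k. k \<in> K \<and> real (\<omega> k) \<le> M * b n k else (SOME k. k \<in> K))" for \<omega> :: "'k \<Rightarrow> nat" and n
  define d where "d \<omega> k = (\<Sum>n\<in>{n \<in> I. sel \<omega> n = k}. \<bar>x n k\<bar>)" for \<omega> k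
  define \<Omega> where "\<Omega> = K \<rightarrow>\<^sub>E S"
  define A where "A k = (\<Sum>\<omega>\<in>\<Omega>. d \<omega> k powr q) / card \<Omega>" for k
  have S: "finite S" "card S = 4 * M" by (auto simp: S_def)
  have \<Omega>: "finite \<Omega>" "0 < card \<Omega>"
    using fin M by (auto simp: \<Omega>_def S_def card_PiE finite_PiE)
  have sel_in: "sel \<omega> n \<in> K" for \<omega> n
  proof (cases "\<exists>k\<in>K. real (\<omega> k) \<le> M * b n k")
    case True
    then have "\<exists>k. k \<in> K \<and> real (\<omega> k) \<le> M * b n k" by blast
    from someI_ex[OF this] show ?thesis using True by (simp add: sel_def)
  next
    case F: False
    then show ?thesis using False by (simp add: sel_def some_in_eq)
  qed
  have d0: "0 \<le> d \<omega> k" for \<omega> k by (auto simp: d_def intro: sum_nonneg)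
  have "0 \<le> A k" for k by (auto simp: A_def intro!: divide_nonneg_nonneg sum_nonneg)
  moreover have "(\<Sum>k\<in>K. A k) \<le> 1"
  proof -
    have "(\<Sum>k\<in>K. \<Sum>\<omega>\<in>\<Omega>. d \<omega> k powr q) = (\<Sum>\<omega>\<in>\<Omega>. \<Sum>k\<in>K. d \<omega> k powr q)" by (rule sum.swap)
    also have "\<dots> \<le> (\<Sum>\<omega>\<in>\<Omega>. 1)"
      unfolding d_def using sel_in by (intro sum_mono selection_bound[OF fin q x]) auto
    finally have "(\<Sum>k\<in>K. \<Sum>\<omega>\<in>\<Omega>. d \<omega> k powr q) \<le> card \<Omega>" by simp
    then show ?thesis using \<Omega> by (simp add: A_def sum_divide_distrib[symmetric])
  qed
  moreover have "real v / (4 * real M) * ((\<Sum>n\<in>{n \<in> I. real v \<le> real M * b n k}. \<bar>x n k\<bar>) / 2) powr q \<le> A k"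
    if k: "k \<in> K" and v: "v \<le> M" for k v
  proof -
    define K' where "K' = K - {k}"
    define \<Omega>' where "\<Omega>' = K' \<rightarrow>\<^sub>E S"
    define N where "N = {n \<in> I. real v \<le> M * b n k}"
    define m where "m = (\<Sum>n\<in>N. \<bar>x n k\<bar>)"
    \<comment> \<open>The thresholds of the other coordinates for which none of them is active for \<open>n\<close>.\<close>
    define quiet where "quiet n = {\<omega> \<in> \<Omega>'. \<forall>l\<in>K'. \<not> real (\<omega> l) \<le> M * b n l}" for n
    have K: "K = insert k K'" "k \<notin> K'" "finite K'" using k fin by (auto simp: K'_def)
    have \<Omega>': "finite \<Omega>'" "0 < card \<Omega>'" "card \<Omega> = 4 * M * card \<Omega>'"
      using K M S by (auto simp: \<Omega>_def \<Omega>'_def card_PiE finite_PiE)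
    have m0: "0 \<le> m" by (auto simp: m_def intro: sum_nonneg)
    have quiet: "card \<Omega>' \<le> 2 * real (card (quiet n))" if n: "n \<in> I" for n
    proof -
      have "(\<Sum>l\<in>K'. b n l) \<le> (\<Sum>l\<in>K. b n l)"
        using K fin b(1)[OF n] by (intro sum_mono2) auto
      then have "(\<Sum>l\<in>K'. M * b n l) \<le> real M * 2"
        unfolding sum_distrib_left[symmetric] using b(2)[OF n] by (intro mult_left_mono) auto
      then have "2 * real (card {\<omega> \<in> \<Omega>'. \<exists>l\<in>K'. real (\<omega> l) \<le> M * b n l}) \<le> card \<Omega>'"
        unfolding \<Omega>'_def S_def using K b(1)[OF n] M by (intro card_some_active_le) auto
      moreover have "card (quiet n) = card (\<Omega>' - {\<omega> \<in> \<Omega>'. \<exists>l\<in>K'. real (\<omega> l) \<le> M * b n l})"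
        by (rule arg_cong[where f = card]) (auto simp: quiet_def)
      then have "real (card (quiet n)) = card \<Omega>' - real (card {\<omega> \<in> \<Omega>'. \<exists>l\<in>K'. real (\<omega> l) \<le> M * b n l})"
        using \<Omega>' by (simp add: card_Diff_subset of_nat_diff card_mono)
      ultimately show ?thesis by simp
    qed
    have layer: "real (card \<Omega>') * (m / 2) powr q \<le> (\<Sum>\<omega>\<in>\<Omega>'. d (fun_upd \<omega> k u) k powr q)" if u: "u \<le> v" for u :: nat
    proof -
      have "(\<Sum>n\<in>N. \<bar>x n k\<bar> * (if \<omega> \<in> quiet n then 1 else 0)) \<le> d (fun_upd \<omega> k u) k"
        if \<omega>: "\<omega> \<in> \<Omega>'" for \<omega>
      proof -
        have "sel (fun_upd \<omega> k u) n = k" if n: "n \<in> N" "\<omega> \<in> quiet n" for n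
        proof -
          have act: "l = k \<longleftrightarrow> l \<in> K \<and> real ((fun_upd \<omega> k u) l) \<le> M * b n l" for l
            using n u K by (auto simp: N_def quiet_def)
          then have "\<exists>l\<in>K. real ((fun_upd \<omega> k u) l) \<le> M * b n l" by blast
          then show ?thesis unfolding sel_def act[symmetric] by simp
        qed
        then have "(\<Sum>n\<in>N. \<bar>x n k\<bar> * (if \<omega> \<in> quiet n then 1 else 0))
          \<le> (\<Sum>n\<in>N. if sel (fun_upd \<omega> k u) n = k then \<bar>x n k\<bar> else 0)"
          by (intro sum_mono) auto
        also have "\<dots> = (\<Sum>n\<in>{n \<in> N. sel (fun_upd \<omega> k u) n = k}. \<bar>x n k\<bar>)"
          by (rule sum.inter_filter[symmetric]) (use fin in \<open>simp add: N_def\<close>)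
        also have "\<dots> \<le> d (fun_upd \<omega> k u) k"
          unfolding d_def using fin by (intro sum_mono2) (auto simp: N_def)
        finally show ?thesis .
      qed
      then have "(\<Sum>\<omega>\<in>\<Omega>'. \<Sum>n\<in>N. \<bar>x n k\<bar> * (if \<omega> \<in> quiet n then 1 else 0))
         \<le> (\<Sum>\<omega>\<in>\<Omega>'. d (fun_upd \<omega> k u) k)" by (rule sum_mono)
      also have "(\<Sum>\<omega>\<in>\<Omega>'. \<Sum>n\<in>N. \<bar>x n k\<bar> * (if \<omega> \<in> quiet n then 1 else 0))
         = (\<Sum>n\<in>N. \<bar>x n k\<bar> * real (card (quiet n)))"
      proof (subst sum.swap, intro sum.cong refl)
        fix n
        have "quiet n \<subseteq> \<Omega>'" by (auto simp: quiet_def)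
        then show "(\<Sum>\<omega>\<in>\<Omega>'. \<bar>x n k\<bar> * (if \<omega> \<in> quiet n then 1 else 0)) = \<bar>x n k\<bar> * card (quiet n)"
          using \<Omega>' by (simp add: sum_distrib_left[symmetric] Int_absorb1 flip: sum.inter_restrict)
      qed
      also have "(\<Sum>n\<in>N. \<bar>x n k\<bar> * real (card (quiet n))) \<ge> (\<Sum>n\<in>N. \<bar>x n k\<bar> * (real (card \<Omega>') / 2))"
        using quiet by (intro sum_mono mult_left_mono) (fastforce simp: N_def)+
      finally have "real (card \<Omega>') * (m / 2) \<le> (\<Sum>\<omega>\<in>\<Omega>'. d (fun_upd \<omega> k u) k)"
        unfolding sum_distrib_right[symmetric] m_def[symmetric] by (simp only: mult.commute times_divide_eq_left times_divide_eq_right)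
      then have "m / 2 \<le> (\<Sum>\<omega>\<in>\<Omega>'. d (fun_upd \<omega> k u) k) / real (card \<Omega>')"
        using \<Omega>' by (simp add: field_simps)
      then have "real (card \<Omega>') * (m / 2) powr q \<le> real (card \<Omega>') * ((\<Sum>\<omega>\<in>\<Omega>'. d (fun_upd \<omega> k u) k) / real (card \<Omega>')) powr q"
        using m0 q by (intro mult_left_mono powr_mono2) auto
      also have "\<dots> \<le> (\<Sum>\<omega>\<in>\<Omega>'. d (fun_upd \<omega> k u) k powr q)"
        by (rule powr_mean_le[OF q]) (use \<Omega>' d0 in auto)
      finally show ?thesis .
    qed
    have "real v * (real (card \<Omega>') * (m / 2) powr q) = (\<Sum>u\<in>{1..v}. real (card \<Omega>') * (m / 2) powr q)" by simp
    also have "\<dots> \<le> (\<Sum>u\<in>{1..v}. \<Sum>\<omega>\<in>\<Omega>'. d (fun_upd \<omega> k u) k powr q)"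
      by (intro sum_mono layer) auto
    also have "\<dots> \<le> (\<Sum>u\<in>S. \<Sum>\<omega>\<in>\<Omega>'. d (fun_upd \<omega> k u) k powr q)"
      using v S by (intro sum_mono2) (auto simp: S_def intro: sum_nonneg)
    also have "\<dots> = (\<Sum>\<omega>\<in>\<Omega>. d \<omega> k powr q)"
      unfolding \<Omega>_def \<Omega>'_def K(1) by (rule sum_PiE_insert[symmetric]) (rule K)
    also have "\<dots> = A k * (4 * M * card \<Omega>')" using \<Omega>' M by (auto simp: A_def)
    finally have "real v / (4 * real M) * (m / 2) powr q \<le> A k"
      using \<Omega>' M by (simp add: field_simps)
    then show ?thesis by (simp add: m_def N_def)
  qed
  ultimately show ?thesis by blast
qed

section \<open>Summation over dyadic levels\<close>

lemma sum_power_inj_le: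
  fixes \<rho> :: real
  assumes "0 < \<rho>" "\<rho> < 1" "finite J" "inj_on g J"
  shows "(\<Sum>j\<in>J. \<rho> ^ g j) \<le> 1 / (1 - \<rho>)"
proof -
  have "(\<Sum>j\<in>J. \<rho> ^ g j) = (\<Sum>i\<in>g ` J. \<rho> ^ i)" by (simp add: sum.reindex assms)
  also have "\<dots> \<le> (\<Sum>i. \<rho> ^ i)"
    using assms by (intro sum_le_suminf summable_geometric) auto
  also have "\<dots> = 1 / (1 - \<rho>)" using assms by (intro suminf_geometric) auto
  finally show ?thesis .
qed

text \<open>
  On each side of \<open>s\<close> the integer parts of the distances to \<open>s\<close> are distinct.
\<close>

lemma sum_geometric_two_sided_le:
  fixes \<rho> s :: real
  assumes \<rho>: "0 < \<rho>" "\<rho> < 1" and J: "finite (J :: nat set)"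
  shows "(\<Sum>j\<in>J. \<rho> powr \<bar>j - s\<bar>) \<le> 2 / (1 - \<rho>)"
proof -
  define P where "P = {j \<in> J. s \<le> real j}"
  define g where "g j = nat \<lfloor>\<bar>real j - s\<bar>\<rfloor>" for j
  have fl: "\<lfloor>real j - s\<rfloor> = int j + \<lfloor>- s\<rfloor>" "\<lfloor>s - real j\<rfloor> = \<lfloor>s\<rfloor> - int j" for j
    by linarith+
  have "inj_on g P"
  proof (rule inj_onI)
    fix i j assume "i \<in> P" "j \<in> P" and eq: "g i = g j"
    then have ij: "s \<le> real i" "s \<le> real j" by (auto simp: P_def)
    then have "\<lfloor>real i - s\<rfloor> = \<lfloor>real j - s\<rfloor>" using eq by (simp add: g_def eq_nat_nat_iff)
    then show "i = j" by (simp add: fl)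
  qed
  moreover have "inj_on g (J - P)"
  proof (rule inj_onI)
    fix i j assume "i \<in> J - P" "j \<in> J - P" and eq: "g i = g j"
    then have ij: "real i < s" "real j < s" by (auto simp: P_def)
    then have "\<lfloor>s - real i\<rfloor> = \<lfloor>s - real j\<rfloor>" using eq by (simp add: g_def eq_nat_nat_iff)
    then show "i = j" by (simp add: fl)
  qed
  ultimately have *: "(\<Sum>j\<in>P. \<rho> ^ g j) \<le> 1 / (1 - \<rho>)" "(\<Sum>j\<in>J - P. \<rho> ^ g j) \<le> 1 / (1 - \<rho>)"
    using J \<rho> by (auto intro!: sum_power_inj_le simp: P_def)
  have "\<rho> powr \<bar>real j - s\<bar> \<le> \<rho> ^ g j" for j
  proof -
    have "\<rho> powr \<bar>real j - s\<bar> \<le> \<rho> powr real (g j)"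
      using \<rho> by (intro powr_mono') (auto simp: g_def)
    then show ?thesis using \<rho> by (simp add: powr_realpow)
  qed
  then have "(\<Sum>j\<in>J. \<rho> powr \<bar>j - s\<bar>) \<le> (\<Sum>j\<in>J. \<rho> ^ g j)" by (rule sum_mono)
  also have "\<dots> = (\<Sum>j\<in>J - P. \<rho> ^ g j) + (\<Sum>j\<in>P. \<rho> ^ g j)"
    using J by (intro sum.subset_diff) (auto simp: P_def)
  finally show ?thesis using * by simp
qed

lemma dyadic_layers:
  fixes w b :: "'i \<Rightarrow> real"
  assumes I: "finite I" and w: "\<And>n. n \<in> I \<Longrightarrow> 0 \<le> w n"
    and b: "\<And>n. n \<in> I \<Longrightarrow> 2 powr (- real L) \<le> b n" "\<And>n. n \<in> I \<Longrightarrow> b n \<le> 1" and e: "0 \<le> e"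
  shows "(\<Sum>n\<in>I. w n * b n powr e) \<le>
     2 powr e * (\<Sum>j\<le>L. 2 powr (- (real j * e)) * (\<Sum>n\<in>{n \<in> I. 2 powr (- real j) \<le> b n}. w n))"
proof -
  have "w n * b n powr e \<le> 2 powr e * (\<Sum>j\<le>L. 2 powr (- (real j * e)) * (if 2 powr (- real j) \<le> b n then w n else 0))"
    if n: "n \<in> I" for n
  proof -
    define i where "i = (LEAST j. 2 powr (- real j) \<le> b n)"
    have i: "2 powr (- real i) \<le> b n" "i \<le> L"
      using LeastI[of "\<lambda>j. 2 powr (- real j) \<le> b n" L] Least_le[of "\<lambda>j. 2 powr (- real j) \<le> b n" L] b(1)[OF n]
      by (auto simp: i_def)
    have "b n \<le> 2 powr (1 - real i)"
    proof (cases i)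
      case 0
      then show ?thesis using b(2)[OF n] by simp
    next
      case (Suc i')
      then have "\<not> 2 powr (- real i') \<le> b n" using not_less_Least[of i' "\<lambda>j. 2 powr (- real j) \<le> b n"] by (simp add: i_def)
      then show ?thesis using Suc by simp
    qed
    moreover have "0 \<le> b n" using i(1) by (smt (verit) powr_ge_zero)
    ultimately have "b n powr e \<le> (2 powr (1 - real i)) powr e" using e by (intro powr_mono2) auto
    also have "\<dots> = 2 powr e * 2 powr (- (real i * e))"
      by (simp add: powr_powr algebra_simps flip: powr_add)
    finally have "w n * b n powr e \<le> w n * (2 powr e * 2 powr (- (real i * e)))"
      by (intro mult_left_mono w n)
    also have "\<dots> = 2 powr e * (2 powr (- (real i * e)) * (if 2 powr (- real i) \<le> b n then w n else 0))"
      using i by simp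
    also have "\<dots> \<le> 2 powr e * (\<Sum>j\<le>L. 2 powr (- (real j * e)) * (if 2 powr (- real j) \<le> b n then w n else 0))"
      using i w[OF n] by (intro mult_left_mono member_le_sum[where f = "\<lambda>j. 2 powr (- (real j * e)) * (if 2 powr (- real j) \<le> b n then w n else 0)"]) auto
    finally show ?thesis .
  qed
  then have "(\<Sum>n\<in>I. w n * b n powr e) \<le>
    (\<Sum>n\<in>I. 2 powr e * (\<Sum>j\<le>L. 2 powr (- (real j * e)) * (if 2 powr (- real j) \<le> b n then w n else 0)))"
    by (rule sum_mono)
  also have "\<dots> = 2 powr e * (\<Sum>j\<le>L. 2 powr (- (real j * e)) * (\<Sum>n\<in>I. if 2 powr (- real j) \<le> b n then w n else 0))"
    unfolding sum_distrib_left[symmetric] by (subst sum.swap) (simp add: sum_distrib_left)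
  finally show ?thesis using I by (simp add: sum.inter_filter)
qed

lemma sign_bounded_column:
  fixes x :: "'i \<Rightarrow> 'k \<Rightarrow> real"
  assumes "finite K" "0 < q" "sign_bounded q I K x" "k \<in> K"
  shows "(\<Sum>n\<in>I. \<bar>x n k\<bar>) \<le> 1"
proof -
  define t where "t n = (if x n k < 0 then -1 else 1 :: real)" for n
  have eq: "(\<Sum>n\<in>I. t n * x n k) = (\<Sum>n\<in>I. \<bar>x n k\<bar>)" by (intro sum.cong) (auto simp: t_def)
  have "(\<Sum>n\<in>I. \<bar>x n k\<bar>) powr q = \<bar>\<Sum>n\<in>I. t n * x n k\<bar> powr q"
    unfolding eq by (simp add: sum_nonneg)
  also have "\<dots> \<le> (\<Sum>k\<in>K. \<bar>\<Sum>n\<in>I. t n * x n k\<bar> powr q)"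
    using assms by (intro member_le_sum[where f = "\<lambda>k. \<bar>\<Sum>n\<in>I. t n * x n k\<bar> powr q"]) auto
  also have "\<dots> \<le> 1" using assms(3) by (simp add: sign_bounded_def t_def)
  finally have "((\<Sum>n\<in>I. \<bar>x n k\<bar>) powr q) powr (1 / q) \<le> 1 powr (1 / q)"
    using assms by (intro powr_mono2) auto
  then show ?thesis using assms by (simp add: powr_powr sum_nonneg)
qed

text \<open>
  The values \<open>\<bar>a n k\<bar> powr p\<close> are raised to at least \<open>2 powr (- L)\<close>, where \<open>card K < 2 ^ L\<close>; this adds at most \<open>1\<close> to their
  sum over \<open>k\<close> and leaves finitely many dyadic levels. The number \<open>m k j\<close> is the mass of \<open>\<bar>x n k\<bar>\<close> over those \<open>n\<close> whose raised
  value is at least \<open>2 powr (- j)\<close>, and its bound is the case \<open>v = 2 ^ (L - j)\<close> of the random selection.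
\<close>

lemma action_layers:
  fixes x a :: "'i \<Rightarrow> 'k \<Rightarrow> real"
  assumes fin: "finite I" "finite K" and q: "1 \<le> q" and x: "sign_bounded q I K x" and p: "1 \<le> p"
    and a: "\<forall>n\<in>I. (\<Sum>k\<in>K. \<bar>a n k\<bar> powr p) \<le> 1"
  shows "\<exists>A L m. (\<forall>k. 0 \<le> A k) \<and> (\<Sum>k\<in>K. A k) \<le> 1 \<and> (\<forall>k\<in>K. \<forall>j. 0 \<le> m k j \<and> m k j \<le> 1) \<and>
    (\<forall>k\<in>K. \<forall>j\<le>L. m k j \<le> 8 * (2 powr real j * A k) powr (1 / q)) \<and>
    (\<forall>k\<in>K. (\<Sum>n\<in>I. \<bar>a n k\<bar> * \<bar>x n k\<bar>) \<le> 2 * (\<Sum>j\<le>L. 2 powr (- (real j / p)) * m k j))"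
proof -
  obtain L where "card K < 2 ^ L" using less_exp by blast
  then have L: "real (card K) \<le> 2 ^ L" by (metis less_imp_le of_nat_le_iff of_nat_numeral of_nat_power)
  define b where "b n k = max (\<bar>a n k\<bar> powr p) (2 powr (- real L))" for n k
  define m where "m k j = (\<Sum>n\<in>{n \<in> I. 2 powr (- real j) \<le> b n k}. \<bar>x n k\<bar>)" for k j
  have b0: "0 \<le> b n k" "2 powr (- real L) \<le> b n k" for n k
    by (auto simp: b_def intro: max.coboundedI2)
  have b1: "b n k \<le> 1" if "n \<in> I" "k \<in> K" for n k
  proof -
    have "\<bar>a n k\<bar> powr p \<le> (\<Sum>k\<in>K. \<bar>a n k\<bar> powr p)" using that fin by (intro member_le_sum) auto
    then have "\<bar>a n k\<bar> powr p \<le> 1" using a that(1) by fastforce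
    moreover have "2 powr (- real L) \<le> 2 powr 0" by (intro powr_mono) auto
    ultimately show ?thesis by (simp add: b_def)
  qed
  have b2: "(\<Sum>k\<in>K. b n k) \<le> 2" if n: "n \<in> I" for n
  proof -
    have "(\<Sum>k\<in>K. b n k) \<le> (\<Sum>k\<in>K. \<bar>a n k\<bar> powr p + 2 powr (- real L))"
      by (intro sum_mono) (auto simp: b_def)
    also have "\<dots> \<le> 1 + card K * 2 powr (- real L)" using a n by (simp add: sum.distrib)
    also have "\<dots> \<le> 1 + 2 ^ L * 2 powr (- real L)"
      using L by (intro add_left_mono mult_right_mono) auto
    also have "\<dots> = 2" by (simp add: powr_minus powr_realpow)
    finally show ?thesis .
  qed
  have pow: "0 < (2::nat) ^ L" by simp
  obtain A where A0: "\<forall>k. 0 \<le> A k" and A1: "(\<Sum>k\<in>K. A k) \<le> 1"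
    and A2: "\<forall>k\<in>K. \<forall>v\<le>2 ^ L. real v / (4 * real (2 ^ L)) *
      ((\<Sum>n\<in>{n \<in> I. real v \<le> real (2 ^ L) * b n k}. \<bar>x n k\<bar>) / 2) powr q \<le> A k"
  proof -
    have "\<exists>A. (\<forall>k. 0 \<le> A k) \<and> (\<Sum>k\<in>K. A k) \<le> 1 \<and>
      (\<forall>k\<in>K. \<forall>v\<le>2 ^ L. real v / (4 * real (2 ^ L)) *
        ((\<Sum>n\<in>{n \<in> I. real v \<le> real (2 ^ L) * b n k}. \<bar>x n k\<bar>) / 2) powr q \<le> A k)"
      by (rule random_selection[OF fin q x pow b0(1) b2])
    then show thesis by (elim exE conjE) (rule that; assumption)
  qed
  note A = A0[rule_format] A1 A2[rule_format]
  have m0: "0 \<le> m k j" for k j by (auto simp: m_def intro: sum_nonneg)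
  moreover have "m k j \<le> 1" if k: "k \<in> K" for k j
  proof -
    have "m k j \<le> (\<Sum>n\<in>I. \<bar>x n k\<bar>)" unfolding m_def using fin by (intro sum_mono2) auto
    also have "\<dots> \<le> 1" using sign_bounded_column[OF fin(2) _ x k] q by simp
    finally show ?thesis .
  qed
  moreover have "m k j \<le> 8 * (2 powr real j * A k) powr (1 / q)" if k: "k \<in> K" and j: "j \<le> L" for k j
  proof -
    have v: "real (2 ^ (L - j)) = 2 ^ L * 2 powr (- real j)"
    proof -
      have "(2::real) ^ L = 2 ^ (L - j) * 2 ^ j" using j by (simp flip: power_add)
      then show ?thesis by (simp add: powr_minus powr_realpow)
    qed
    have "{n \<in> I. real (2 ^ (L - j)) \<le> real (2 ^ L) * b n k} = {n \<in> I. 2 powr (- real j) \<le> b n k}"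
      unfolding v by auto
    then have "real (2 ^ (L - j)) / (4 * real (2 ^ L)) * (m k j / 2) powr q \<le> A k"
      using A(3)[OF k, of "2 ^ (L - j)"] by (simp add: m_def)
    then have "2 powr (- real j) * (m k j / 2) powr q \<le> 4 * A k"
      unfolding v by (simp add: field_simps)
    then have "(m k j / 2) powr q \<le> 4 * (2 powr real j * A k)"
      by (simp add: powr_minus field_simps)
    then have "((m k j / 2) powr q) powr (1 / q) \<le> (4 * (2 powr real j * A k)) powr (1 / q)"
      using q by (intro powr_mono2) auto
    also have "\<dots> = 4 powr (1 / q) * (2 powr real j * A k) powr (1 / q)"
      by (rule powr_mult)
    also have "\<dots> \<le> 4 powr 1 * (2 powr real j * A k) powr (1 / q)"
      using q by (intro mult_right_mono powr_mono) auto
    finally show ?thesis using q m0[of k j] by (simp add: powr_powr)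
  qed
  moreover have "(\<Sum>n\<in>I. \<bar>a n k\<bar> * \<bar>x n k\<bar>) \<le> 2 * (\<Sum>j\<le>L. 2 powr (- (real j / p)) * m k j)"
    if k: "k \<in> K" for k
  proof -
    have "\<bar>a n k\<bar> \<le> b n k powr (1 / p)" for n
    proof -
      have "\<bar>a n k\<bar> = (\<bar>a n k\<bar> powr p) powr (1 / p)" using p by (simp add: powr_powr)
      also have "\<dots> \<le> b n k powr (1 / p)" using p by (intro powr_mono2) (auto simp: b_def)
      finally show ?thesis .
    qed
    then have "(\<Sum>n\<in>I. \<bar>a n k\<bar> * \<bar>x n k\<bar>) \<le> (\<Sum>n\<in>I. \<bar>x n k\<bar> * b n k powr (1 / p))"
      by (intro sum_mono) (metis abs_ge_zero mult.commute mult_left_mono)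
    also have "\<dots> \<le> 2 powr (1 / p) * (\<Sum>j\<le>L. 2 powr (- (real j * (1 / p))) * m k j)"
      unfolding m_def using fin b0 b1 k p by (intro dyadic_layers) auto
    also have "\<dots> \<le> 2 powr 1 * (\<Sum>j\<le>L. 2 powr (- (real j * (1 / p))) * m k j)"
      using p m0 by (intro mult_right_mono powr_mono sum_nonneg) auto
    finally show ?thesis by simp
  qed
  ultimately show ?thesis using A0 A1 by blast
qed

text \<open>
  Since \<open>1/p > 1/q\<close>, the contribution of level \<open>j\<close> to \<open>\<Sum>n. \<bar>a n k\<bar> * \<bar>x n k\<bar>\<close> is at most a constant times
  \<open>A k powr (1/q)\<close> with a factor that decays geometrically in \<open>j\<close>.
\<close>

lemma finite_action_below:
  assumes p: "1 \<le> p" and q: "p < q"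
  obtains C where "0 < C"
    "\<And>(I :: 'i set) (K :: 'k set) x a. finite I \<Longrightarrow> finite K \<Longrightarrow> sign_bounded q I K x \<Longrightarrow>
       (\<forall>n\<in>I. (\<Sum>k\<in>K. \<bar>a n k\<bar> powr p) \<le> 1) \<Longrightarrow>
       (\<Sum>k\<in>K. (\<Sum>n\<in>I. \<bar>a n k\<bar> * \<bar>x n k\<bar>) powr q) \<le> C powr q"
proof -
  define \<rho> where "\<rho> = 2 powr (1 / q - 1 / p)"
  define C where "C = 16 / (1 - \<rho>)"
  have "1 / q < 1 / p" using p q by (simp add: field_simps)
  then have "\<rho> < 2 powr 0" unfolding \<rho>_def by (intro powr_less_mono) auto
  then have \<rho>: "0 < \<rho>" "\<rho> < 1" by (auto simp: \<rho>_def)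
  have C: "0 < C" using \<rho> by (simp add: C_def)
  have "(\<Sum>k\<in>K. (\<Sum>n\<in>I. \<bar>a n k\<bar> * \<bar>x n k\<bar>) powr q) \<le> C powr q"
    if fin: "finite I" "finite K" and x: "sign_bounded q I K x"
      and a: "\<forall>n\<in>I. (\<Sum>k\<in>K. \<bar>a n k\<bar> powr p) \<le> 1"
    for I :: "'i set" and K :: "'k set" and x a
  proof -
    have q1: "1 \<le> q" using p q by simp
    obtain A L m where A0: "\<forall>k. 0 \<le> A k" and A1: "(\<Sum>k\<in>K. A k) \<le> 1"
      and m': "\<forall>k\<in>K. \<forall>j\<le>L. m k j \<le> 8 * (2 powr real j * A k) powr (1 / q)"
      and f': "\<forall>k\<in>K. (\<Sum>n\<in>I. \<bar>a n k\<bar> * \<bar>x n k\<bar>) \<le> 2 * (\<Sum>j\<le>L. 2 powr (- (real j / p)) * m k j)"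
      using action_layers[OF fin q1 x p a] by (elim exE conjE) (rule that; assumption)
    note A = A0[rule_format] A1 and m = m'[rule_format] and f = f'[rule_format]
    have "(\<Sum>n\<in>I. \<bar>a n k\<bar> * \<bar>x n k\<bar>) powr q \<le> C powr q * A k" if k: "k \<in> K" for k
    proof -
      have "2 powr (- (real j / p)) * m k j \<le> 8 * A k powr (1 / q) * \<rho> ^ j" if "j \<in> {..L}" for j
      proof -
        have "2 powr (- (real j / p)) * m k j \<le> 2 powr (- (real j / p)) * (8 * (2 powr real j * A k) powr (1 / q))"
          using m[OF k] that by (intro mult_left_mono) auto
        also have "\<dots> = 8 * A k powr (1 / q) * (2 powr (- (real j / p)) * 2 powr (real j / q))"
          using A(1) by (simp add: powr_mult powr_powr)
        also have "2 powr (- (real j / p)) * 2 powr (real j / q) = \<rho> powr real j"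
          unfolding \<rho>_def powr_powr powr_add[symmetric] by (simp add: algebra_simps)
        also have "\<dots> = \<rho> ^ j" using \<rho> by (simp add: powr_realpow)
        finally show ?thesis .
      qed
      then have "(\<Sum>j\<le>L. 2 powr (- (real j / p)) * m k j) \<le> (\<Sum>j\<le>L. 8 * A k powr (1 / q) * \<rho> ^ j)"
        by (rule sum_mono)
      also have "\<dots> \<le> 8 * A k powr (1 / q) * (1 / (1 - \<rho>))"
        unfolding sum_distrib_left[symmetric]
        using sum_power_inj_le[OF \<rho>, of "{..L}" "\<lambda>j. j"] by (intro mult_left_mono) auto
      finally have "(\<Sum>n\<in>I. \<bar>a n k\<bar> * \<bar>x n k\<bar>) \<le> C * A k powr (1 / q)"
        using f[OF k] by (simp add: C_def)
      then have "(\<Sum>n\<in>I. \<bar>a n k\<bar> * \<bar>x n k\<bar>) powr q \<le> (C * A k powr (1 / q)) powr q"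
        using q1 by (intro powr_mono2) (auto intro!: sum_nonneg)
      also have "\<dots> = C powr q * A k"
        using C A(1) q1 by (simp add: powr_mult powr_powr)
      finally show ?thesis .
    qed
    then have "(\<Sum>k\<in>K. (\<Sum>n\<in>I. \<bar>a n k\<bar> * \<bar>x n k\<bar>) powr q) \<le> C powr q * (\<Sum>k\<in>K. A k)"
      unfolding sum_distrib_left by (rule sum_mono)
    also have "\<dots> \<le> C powr q * 1" by (intro mult_left_mono A) auto
    finally show ?thesis by simp
  qed
  then show ?thesis using that C by blast
qed

text \<open>
  Here \<open>1/p < 1/q\<close> and the selection bound grows with \<open>j\<close>, but the masses \<open>m k j\<close> are also at most \<open>1\<close>. The minimum
  of the two bounds for level \<open>j\<close> peaks where \<open>2 powr (- j)\<close> is about \<open>A k\<close>, with value of order \<open>A k powr (1/p)\<close>, and decays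
  geometrically on both sides.
\<close>

lemma finite_action_above:
  assumes q: "1 \<le> q" and p: "q < p"
  obtains C where "0 < C"
    "\<And>(I :: 'i set) (K :: 'k set) x a. finite I \<Longrightarrow> finite K \<Longrightarrow> sign_bounded q I K x \<Longrightarrow>
       (\<forall>n\<in>I. (\<Sum>k\<in>K. \<bar>a n k\<bar> powr p) \<le> 1) \<Longrightarrow>
       (\<Sum>k\<in>K. (\<Sum>n\<in>I. \<bar>a n k\<bar> * \<bar>x n k\<bar>) powr p) \<le> C powr p"
proof -
  define \<delta> where "\<delta> = min (1 / p) (1 / q - 1 / p)"
  define \<rho> where "\<rho> = 2 powr (- \<delta>)"
  define C where "C = 32 / (1 - \<rho>)"
  have p1: "1 \<le> p" using p q by simp
  have "1 / p < 1 / q" using p q by (simp add: field_simps)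
  then have "0 < \<delta>" using p1 by (simp add: \<delta>_def)
  then have "\<rho> < 2 powr 0" unfolding \<rho>_def by (intro powr_less_mono) auto
  then have \<rho>: "0 < \<rho>" "\<rho> < 1" by (auto simp: \<rho>_def)
  have C: "0 < C" using \<rho> by (simp add: C_def)
  have "(\<Sum>k\<in>K. (\<Sum>n\<in>I. \<bar>a n k\<bar> * \<bar>x n k\<bar>) powr p) \<le> C powr p"
    if fin: "finite I" "finite K" and x: "sign_bounded q I K x"
      and a: "\<forall>n\<in>I. (\<Sum>k\<in>K. \<bar>a n k\<bar> powr p) \<le> 1"
    for I :: "'i set" and K :: "'k set" and x a
  proof -
    obtain A L m where A0: "\<forall>k. 0 \<le> A k" and A1: "(\<Sum>k\<in>K. A k) \<le> 1"
      and m01: "\<forall>k\<in>K. \<forall>j. 0 \<le> m k j \<and> m k j \<le> 1"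
      and m': "\<forall>k\<in>K. \<forall>j\<le>L. m k j \<le> 8 * (2 powr real j * A k) powr (1 / q)"
      and f': "\<forall>k\<in>K. (\<Sum>n\<in>I. \<bar>a n k\<bar> * \<bar>x n k\<bar>) \<le> 2 * (\<Sum>j\<le>L. 2 powr (- (real j / p)) * m k j)"
      using action_layers[OF fin q x p1 a] by (elim exE conjE) (rule that; assumption)
    note A = A0[rule_format] A1 and m = m'[rule_format] and f = f'[rule_format]
    have m0: "0 \<le> m k j" and m1: "m k j \<le> 1" if "k \<in> K" for k j using m01 that by auto
    have "(\<Sum>n\<in>I. \<bar>a n k\<bar> * \<bar>x n k\<bar>) powr p \<le> C powr p * A k" if k: "k \<in> K" for k
    proof (cases "A k = 0")
      case True
      then have "m k j = 0" if "j \<le> L" for j using m[OF k that] m0[OF k, of j] by simp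
      then have "(\<Sum>n\<in>I. \<bar>a n k\<bar> * \<bar>x n k\<bar>) \<le> 0" using f[OF k] by simp
      then have "(\<Sum>n\<in>I. \<bar>a n k\<bar> * \<bar>x n k\<bar>) = 0" by (intro antisym sum_nonneg) auto
      then show ?thesis using True by simp
    next
      case False
      \<comment> \<open>The critical level: \<open>A k = 2 powr (- s)\<close>.\<close>
      define s where "s = - log 2 (A k)"
      have A0: "0 < A k" using False A(1)[of k] by simp
      have As: "A k = 2 powr (- s)" using A0 by (simp add: s_def powr_log_cancel)
      have "2 powr (- (real j / p)) * m k j \<le> 8 * A k powr (1 / p) * \<rho> powr \<bar>j - s\<bar>" if "j \<in> {..L}" for j
      proof (cases "s \<le> real j")
        case True
        have "2 powr (- (real j / p)) * m k j \<le> 2 powr (- (real j / p)) * 1"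
          by (intro mult_left_mono m1 k) auto
        also have "\<dots> = A k powr (1 / p) * 2 powr (- ((real j - s) * (1 / p)))"
          unfolding As powr_powr by (simp add: algebra_simps diff_divide_distrib flip: powr_add)
        also have "\<dots> \<le> A k powr (1 / p) * 2 powr (- ((real j - s) * \<delta>))"
        proof -
          have "(real j - s) * \<delta> \<le> (real j - s) * (1 / p)"
            by (rule mult_left_mono) (use True in \<open>auto simp: \<delta>_def\<close>)
          then show ?thesis by (intro mult_left_mono powr_mono) auto
        qed
        also have "2 powr (- ((real j - s) * \<delta>)) = \<rho> powr \<bar>j - s\<bar>"
          using True by (simp add: \<rho>_def powr_powr mult.commute)
        also have "A k powr (1 / p) * \<rho> powr \<bar>j - s\<bar> \<le> 8 * (A k powr (1 / p) * \<rho> powr \<bar>j - s\<bar>)"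
          by simp
        finally show ?thesis by (simp only: mult.assoc)
      next
        case False
        have "2 powr (- (real j / p)) * m k j \<le> 2 powr (- (real j / p)) * (8 * (2 powr real j * A k) powr (1 / q))"
          using m[OF k] that by (intro mult_left_mono) auto
        also have "\<dots> = 8 * A k powr (1 / p) * 2 powr (- ((s - real j) * (1 / q - 1 / p)))"
          unfolding As powr_powr powr_add[symmetric] mult.assoc mult.left_commute[of _ 8]
          by (simp add: algebra_simps diff_divide_distrib add_divide_distrib flip: powr_add)
        also have "\<dots> \<le> 8 * A k powr (1 / p) * 2 powr (- ((s - real j) * \<delta>))"
        proof -
          have "(s - real j) * \<delta> \<le> (s - real j) * (1 / q - 1 / p)"
            by (rule mult_left_mono) (use False in \<open>auto simp: \<delta>_def\<close>)
          then show ?thesis by (intro mult_left_mono powr_mono) auto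
        qed
        also have "2 powr (- ((s - real j) * \<delta>)) = \<rho> powr \<bar>j - s\<bar>"
          using False by (simp add: \<rho>_def powr_powr mult.commute)
        finally show ?thesis .
      qed
      then have "(\<Sum>j\<le>L. 2 powr (- (real j / p)) * m k j) \<le> (\<Sum>j\<le>L. 8 * A k powr (1 / p) * \<rho> powr \<bar>j - s\<bar>)"
        by (rule sum_mono)
      also have "\<dots> \<le> 8 * A k powr (1 / p) * (2 / (1 - \<rho>))"
        unfolding sum_distrib_left[symmetric]
        by (intro mult_left_mono sum_geometric_two_sided_le \<rho>) auto
      finally have "(\<Sum>n\<in>I. \<bar>a n k\<bar> * \<bar>x n k\<bar>) \<le> C * A k powr (1 / p)"
        using f[OF k] by (simp add: C_def)
      then have "(\<Sum>n\<in>I. \<bar>a n k\<bar> * \<bar>x n k\<bar>) powr p \<le> (C * A k powr (1 / p)) powr p"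
        using p1 by (intro powr_mono2) (auto intro!: sum_nonneg)
      also have "\<dots> = C powr p * A k"
        using C A(1) p1 by (simp add: powr_mult powr_powr)
      finally show ?thesis .
    qed
    then have "(\<Sum>k\<in>K. (\<Sum>n\<in>I. \<bar>a n k\<bar> * \<bar>x n k\<bar>) powr p) \<le> C powr p * (\<Sum>k\<in>K. A k)"
      unfolding sum_distrib_left by (rule sum_mono)
    also have "\<dots> \<le> C powr p * 1" by (intro mult_left_mono A) auto
    finally show ?thesis by simp
  qed
  then show ?thesis using that C by blast
qed

section \<open>Balls of the sequence spaces\<close>

text \<open>
  The inequality \<open>\<parallel>f\<parallel>\<^sub>p \<le> B\<close> on the coordinate set \<open>K\<close>. A predicate instead of a norm treats \<open>p = \<infinity>\<close> and \<open>p < \<infinity>\<close> alike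
  and turns comparisons of norms into comparisons of sums of powers.
\<close>

definition lp_bound :: "ereal \<Rightarrow> 'k set \<Rightarrow> ('k \<Rightarrow> 'a::real_normed_vector) \<Rightarrow> real \<Rightarrow> bool" where
  "lp_bound p K f B \<longleftrightarrow> 0 \<le> B \<and>
     (if p = \<infinity> then \<forall>k\<in>K. norm (f k) \<le> B
      else (\<Sum>k\<in>K. norm (f k) powr real_of_ereal p) \<le> B powr real_of_ereal p)"

lemma real_of_exponent:
  assumes "1 \<le> p" "p \<noteq> \<infinity>"
  shows "1 \<le> real_of_ereal p" "p = ereal (real_of_ereal p)"
  using assms by (cases p; simp)+

lemma lp_bound_nonneg: "lp_bound p K f B \<Longrightarrow> 0 \<le> B"
  by (simp add: lp_bound_def)

lemma lp_bound_dominated: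
  assumes "1 \<le> p" "lp_bound p K f B" "\<And>k. k \<in> K \<Longrightarrow> norm (g k) \<le> norm (f k)"
  shows "lp_bound p K g B"
proof (cases "p = \<infinity>")
  case True
  then show ?thesis using assms unfolding lp_bound_def by (auto intro: order_trans)
next
  case False
  have "(\<Sum>k\<in>K. norm (g k) powr real_of_ereal p) \<le> (\<Sum>k\<in>K. norm (f k) powr real_of_ereal p)"
    using assms real_of_exponent[OF assms(1) False] by (intro sum_mono powr_mono2) auto
  then show ?thesis using assms False by (simp add: lp_bound_def)
qed

lemma lp_bound_mono:
  assumes "1 \<le> p" "lp_bound p K f B" "B \<le> B'"
  shows "lp_bound p K f B'"
proof (cases "p = \<infinity>")
  case True
  then show ?thesis using assms unfolding lp_bound_def by fastforce
next
  case False
  have "B powr real_of_ereal p \<le> B' powr real_of_ereal p"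
    using assms real_of_exponent[OF assms(1) False] by (intro powr_mono2) (auto simp: lp_bound_def)
  then show ?thesis using assms False by (simp add: lp_bound_def)
qed

lemma lp_bound_scale:
  assumes "1 \<le> p" "lp_bound p K f B" "0 \<le> c" "\<And>k. k \<in> K \<Longrightarrow> norm (g k) = c * norm (f k)"
  shows "lp_bound p K g (c * B)"
proof (cases "p = \<infinity>")
  case True
  then show ?thesis using assms by (simp add: lp_bound_def mult_left_mono)
next
  case False
  have "(\<Sum>k\<in>K. norm (g k) powr real_of_ereal p) = c powr real_of_ereal p * (\<Sum>k\<in>K. norm (f k) powr real_of_ereal p)"
    using assms by (simp add: powr_mult sum_distrib_left)
  then show ?thesis using assms False by (simp add: lp_bound_def powr_mult mult_left_mono)
qed

lemma lp_bound_component: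
  assumes "1 \<le> p" "finite K" "lp_bound p K f B" "k \<in> K"
  shows "norm (f k) \<le> B"
proof (cases "p = \<infinity>")
  case True
  then show ?thesis using assms by (simp add: lp_bound_def)
next
  case False
  have "norm (f k) powr real_of_ereal p \<le> (\<Sum>k\<in>K. norm (f k) powr real_of_ereal p)"
    using assms by (intro member_le_sum) auto
  also have "\<dots> \<le> B powr real_of_ereal p" using assms False by (simp add: lp_bound_def)
  finally show ?thesis
    using real_of_exponent[OF assms(1) False] assms(3)
    by (meson less_le_not_le lp_bound_nonneg not_le norm_ge_zero powr_less_mono2 order_less_le_trans zero_less_one)
qed

lemma lp_bound_zero_iff:
  assumes "1 \<le> p" "finite K"
  shows "lp_bound p K f 0 \<longleftrightarrow> (\<forall>k\<in>K. f k = 0)"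
  using lp_bound_component[OF assms, of f 0] by (auto simp: lp_bound_def)

text \<open>
  The Minkowski inequality: \<open>(f + g) / (A + B)\<close> is a convex combination of \<open>f / A\<close> and \<open>g / B\<close>.
\<close>

lemma lp_bound_add:
  assumes p: "1 \<le> p" and K: "finite K" and f: "lp_bound p K f A" and g: "lp_bound p K g B"
  shows "lp_bound p K (\<lambda>k. f k + g k) (A + B)"
proof (cases "p = \<infinity>")
  case True
  then show ?thesis using f g by (auto simp: lp_bound_def intro: norm_triangle_mono)
next
  case False
  let ?p = "real_of_ereal p"
  note p' = real_of_exponent[OF p False]
  show ?thesis
  proof (cases "A = 0 \<or> B = 0")
    case True
    then show ?thesis
    proof
      assume "A = 0"
      then show ?thesis
        using f g by (auto simp: lp_bound_zero_iff[OF p K] intro!: lp_bound_dominated[OF p g])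
    next
      assume "B = 0"
      then show ?thesis
        using f g by (auto simp: lp_bound_zero_iff[OF p K] intro!: lp_bound_dominated[OF p f])
    qed
  next
    case nz: False
    then have AB: "0 < A" "0 < B" using f g by (auto simp: lp_bound_def)
    define t where "t = B / (A + B)"
    have t: "0 \<le> t" "t \<le> 1" "(1 - t) = A / (A + B)" using AB by (auto simp: t_def field_simps)
    have "norm (f k + g k) powr ?p \<le> (A + B) powr ?p *
        ((1 - t) / A powr ?p * norm (f k) powr ?p + t / B powr ?p * norm (g k) powr ?p)" for k
    proof -
      have "norm (f k + g k) \<le> (A + B) * ((1 - t) * (norm (f k) / A) + t * (norm (g k) / B))"
        unfolding t using AB norm_triangle_ineq[of "f k" "g k"] by (simp add: t_def distrib_left)
      then have "norm (f k + g k) powr ?p \<le> ((A + B) * ((1 - t) * (norm (f k) / A) + t * (norm (g k) / B))) powr ?p"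
        using p' by (intro powr_mono2) auto
      also have "\<dots> = (A + B) powr ?p * ((1 - t) * (norm (f k) / A) + t * (norm (g k) / B)) powr ?p"
        by (simp add: powr_mult)
      also have "\<dots> \<le> (A + B) powr ?p * ((1 - t) * (norm (f k) / A) powr ?p + t * (norm (g k) / B) powr ?p)"
        using convex_onD[OF convex_on_powr_nonneg[OF p'(1)], of t "norm (f k) / A" "norm (g k) / B"] t AB
        by (intro mult_left_mono) auto
      finally show ?thesis using AB by (simp add: powr_divide)
    qed
    then have "(\<Sum>k\<in>K. norm (f k + g k) powr ?p) \<le> (\<Sum>k\<in>K. (A + B) powr ?p *
        ((1 - t) / A powr ?p * norm (f k) powr ?p + t / B powr ?p * norm (g k) powr ?p))"
      by (rule sum_mono)
    also have "\<dots> = (A + B) powr ?p * ((1 - t) / A powr ?p * (\<Sum>k\<in>K. norm (f k) powr ?p)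
         + t / B powr ?p * (\<Sum>k\<in>K. norm (g k) powr ?p))"
      by (simp add: sum.distrib sum_distrib_left distrib_left)
    also have "\<dots> \<le> (A + B) powr ?p * ((1 - t) / A powr ?p * A powr ?p + t / B powr ?p * B powr ?p)"
      using f g False t(1,2) by (intro mult_left_mono add_mono) (auto simp: lp_bound_def)
    also have "\<dots> = (A + B) powr ?p" using AB by simp
    finally show ?thesis using AB False by (simp add: lp_bound_def)
  qed
qed

lemma lp_bound_sum:
  assumes "1 \<le> p" "finite K" "finite T" "\<And>i. i \<in> T \<Longrightarrow> lp_bound p K (f i) (B i)"
  shows "lp_bound p K (\<lambda>k. \<Sum>i\<in>T. f i k) (\<Sum>i\<in>T. B i)"
  using assms(3,4)
proof (induction T)
  case empty
  then show ?case by (simp add: lp_bound_def)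
next
  case (insert i T)
  then show ?case using lp_bound_add[OF assms(1,2), of "f i" "B i"] by simp
qed

text \<open>
  All coordinates are at most \<open>B\<close>, so the surplus of the exponent is estimated by a power of \<open>B\<close>.
\<close>

lemma lp_bound_exponent_mono:
  assumes p: "1 \<le> p" "p \<le> q" and K: "finite K" and f: "lp_bound p K f B"
  shows "lp_bound q K f B"
proof (cases "q = \<infinity>")
  case True
  then show ?thesis
    using lp_bound_component[OF p(1) K f] lp_bound_nonneg[OF f] by (simp add: lp_bound_def)
next
  case False
  then have pq: "p \<noteq> \<infinity>" "1 \<le> q" "real_of_ereal p \<le> real_of_ereal q" using p
    by (cases p; cases q; force)+
  note p' = real_of_exponent[OF p(1) pq(1)]
  show ?thesis
  proof (cases "B = 0")
    case True
    then show ?thesis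
      using f lp_bound_zero_iff[OF p(1) K] lp_bound_zero_iff[OF pq(2) K] by blast
  next
    case nz: False
    then have B: "0 < B" using f by (simp add: lp_bound_def)
    have "norm (f k) powr real_of_ereal q \<le>
        B powr (real_of_ereal q - real_of_ereal p) * norm (f k) powr real_of_ereal p" if "k \<in> K" for k
    proof -
      have "norm (f k) powr real_of_ereal q
          = norm (f k) powr (real_of_ereal q - real_of_ereal p) * norm (f k) powr real_of_ereal p"
        by (simp flip: powr_add)
      also have "\<dots> \<le> B powr (real_of_ereal q - real_of_ereal p) * norm (f k) powr real_of_ereal p"
        using lp_bound_component[OF p(1) K f that] pq by (intro mult_right_mono powr_mono2) auto
      finally show ?thesis .
    qed
    then have "(\<Sum>k\<in>K. norm (f k) powr real_of_ereal q) \<le>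
        B powr (real_of_ereal q - real_of_ereal p) * (\<Sum>k\<in>K. norm (f k) powr real_of_ereal p)"
      unfolding sum_distrib_left by (rule sum_mono)
    also have "\<dots> \<le> B powr (real_of_ereal q - real_of_ereal p) * B powr real_of_ereal p"
      using f pq by (intro mult_left_mono) (auto simp: lp_bound_def)
    also have "\<dots> = B powr real_of_ereal q" by (simp flip: powr_add)
    finally show ?thesis using False B by (simp add: lp_bound_def)
  qed
qed

lemma lp_bound_two_iff: "lp_bound 2 K f B \<longleftrightarrow> 0 \<le> B \<and> (\<Sum>k\<in>K. (norm (f k))\<^sup>2) \<le> B\<^sup>2"
proof -
  have "norm z powr real_of_ereal 2 = (norm z)\<^sup>2" for z :: 'b
    using powr_realpow'[of "norm z" 2] by simp
  moreover have "0 \<le> B \<Longrightarrow> B powr real_of_ereal 2 = B\<^sup>2"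
    using powr_realpow'[of B 2] by simp
  moreover have "(2 :: ereal) \<noteq> \<infinity>" by simp
  ultimately show ?thesis unfolding lp_bound_def by (metis (no_types, lifting) sum.cong)
qed

definition lp_ball :: "ereal \<Rightarrow> (nat \<Rightarrow> 'a::real_normed_vector) \<Rightarrow> real \<Rightarrow> bool" where
  "lp_ball p f B \<longleftrightarrow> (\<forall>K. finite K \<longrightarrow> lp_bound p K f B)"

lemma lp_ballD: "lp_ball p f B \<Longrightarrow> finite K \<Longrightarrow> lp_bound p K f B"
  by (simp add: lp_ball_def)

lemma lp_ball_nonneg: "lp_ball p f B \<Longrightarrow> 0 \<le> B"
  using lp_bound_nonneg lp_ballD by blast

lemma lp_ball_dominated:
  "1 \<le> p \<Longrightarrow> lp_ball p f B \<Longrightarrow> (\<And>k. norm (g k) \<le> norm (f k)) \<Longrightarrow> lp_ball p g B"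
  unfolding lp_ball_def by (intro allI impI, rule lp_bound_dominated) auto

lemma lp_ball_mono: "1 \<le> p \<Longrightarrow> lp_ball p f B \<Longrightarrow> B \<le> B' \<Longrightarrow> lp_ball p f B'"
  unfolding lp_ball_def by (intro allI impI, rule lp_bound_mono) auto

lemma lp_ball_add:
  "1 \<le> p \<Longrightarrow> lp_ball p f A \<Longrightarrow> lp_ball p g B \<Longrightarrow> lp_ball p (\<lambda>k. f k + g k) (A + B)"
  unfolding lp_ball_def by (intro allI impI, rule lp_bound_add) auto

lemma lp_ball_minus: "1 \<le> p \<Longrightarrow> lp_ball p f B \<Longrightarrow> lp_ball p (\<lambda>k. - f k) B"
  by (erule lp_ball_dominated) auto

lemma lp_ball_diff:
  "1 \<le> p \<Longrightarrow> lp_ball p f A \<Longrightarrow> lp_ball p g B \<Longrightarrow> lp_ball p (\<lambda>k. f k - g k) (A + B)"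
  using lp_ball_add[OF _ _ lp_ball_minus, of p f A g B] by simp

lemma lp_ball_zero: "lp_ball p (\<lambda>k. 0) 0"
  by (simp add: lp_ball_def lp_bound_def)

lemma lp_ball_sum:
  assumes "1 \<le> p" "finite T" "\<And>i. i \<in> T \<Longrightarrow> lp_ball p (f i) (B i)"
  shows "lp_ball p (\<lambda>k. \<Sum>i\<in>T. f i k) (\<Sum>i\<in>T. B i)"
  using assms by (simp add: lp_ball_def lp_bound_sum)

lemma lp_ball_truncate:
  assumes "finite K" "lp_bound p K f B"
  shows "lp_ball p (\<lambda>k. if k \<in> K then f k else 0) B"
  unfolding lp_ball_def
proof (intro allI impI)
  fix J :: "nat set" assume J: "finite J"
  show "lp_bound p J (\<lambda>k. if k \<in> K then f k else 0) B"
  proof (cases "p = \<infinity>")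
    case False
    have "(\<Sum>k\<in>J. norm (if k \<in> K then f k else 0) powr real_of_ereal p)
        = (\<Sum>k\<in>J \<inter> K. norm (f k) powr real_of_ereal p)"
      using J by (simp add: sum.inter_restrict if_distrib[of norm] if_distribR cong: if_cong)
         (auto intro: sum.cong)
    also have "\<dots> \<le> (\<Sum>k\<in>K. norm (f k) powr real_of_ereal p)"
      using assms by (intro sum_mono2) auto
    finally show ?thesis using assms False by (simp add: lp_bound_def)
  qed (use assms in \<open>auto simp: lp_bound_def\<close>)
qed

lemma lp_ball_imp_finite_norm:
  fixes f :: "nat \<Rightarrow> 'a::real_normed_field"
  assumes p: "1 \<le> p" and f: "lp_ball p f B"
  shows "lp_finite p f" "lp_norm p f \<le> B"
proof -
  have "lp_finite p f \<and> lp_norm p f \<le> B"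
  proof (cases "p = \<infinity>")
    case True
    have "norm (f k) \<le> B" for k using lp_bound_component[OF p _ lp_ballD[OF f], of "{k}" k] by simp
    then show ?thesis using True by (auto simp: lp_finite_def lp_norm_def intro!: bdd_aboveI2 cSUP_least)
  next
    case False
    note p' = real_of_exponent[OF p False]
    have *: "(\<Sum>k<n. norm (f k) powr real_of_ereal p) \<le> B powr real_of_ereal p" for n
      using lp_ballD[OF f, of "{..<n}"] False by (simp add: lp_bound_def)
    have s: "summable (\<lambda>k. norm (f k) powr real_of_ereal p)"
      by (rule summableI_nonneg_bounded[OF _ *]) simp
    have "(\<Sum>k. norm (f k) powr real_of_ereal p) \<le> B powr real_of_ereal p"
      by (rule suminf_le_const[OF s *])
    then have "(\<Sum>k. norm (f k) powr real_of_ereal p) powr (1 / real_of_ereal p)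
        \<le> (B powr real_of_ereal p) powr (1 / real_of_ereal p)"
      using p' s by (intro powr_mono2 suminf_nonneg) auto
    then show ?thesis
      using s p' False lp_ball_nonneg[OF f] by (simp add: lp_finite_def lp_norm_def powr_powr)
  qed
  then show "lp_finite p f" "lp_norm p f \<le> B" by auto
qed

lemma lp_finite_imp_ball:
  fixes f :: "nat \<Rightarrow> 'a::real_normed_field"
  assumes p: "1 \<le> p" and f: "lp_finite p f"
  shows "lp_ball p f (lp_norm p f)"
proof (cases "p = \<infinity>")
  case True
  then have "norm (f k) \<le> lp_norm p f" for k
    using f cSUP_upper[of k UNIV "\<lambda>n. norm (f n)"] by (simp add: lp_finite_def lp_norm_def)
  moreover from this[of 0] have "0 \<le> lp_norm p f" by (rule order_trans[OF norm_ge_zero])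
  ultimately show ?thesis using True by (simp add: lp_ball_def lp_bound_def)
next
  case False
  note p' = real_of_exponent[OF p False]
  have s: "summable (\<lambda>k. norm (f k) powr real_of_ereal p)"
    using f False by (simp add: lp_finite_def)
  have "(\<Sum>k\<in>K. norm (f k) powr real_of_ereal p) \<le> lp_norm p f powr real_of_ereal p" if "finite K" for K
  proof -
    have "(\<Sum>k\<in>K. norm (f k) powr real_of_ereal p) \<le> (\<Sum>k. norm (f k) powr real_of_ereal p)"
      using s that by (intro sum_le_suminf) auto
    also have "\<dots> = lp_norm p f powr real_of_ereal p"
      using p' s False by (simp add: lp_norm_def powr_powr suminf_nonneg)
    finally show ?thesis .
  qed
  then show ?thesis using False by (simp add: lp_ball_def lp_bound_def lp_norm_def)
qed

lemma lp_finite_iff_ball: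
  fixes f :: "nat \<Rightarrow> 'a::real_normed_field"
  assumes "1 \<le> p"
  shows "lp_finite p f \<longleftrightarrow> (\<exists>B. lp_ball p f B)"
  using lp_ball_imp_finite_norm(1)[OF assms] lp_finite_imp_ball[OF assms] by blast

lemma lp_ball_limit:
  fixes S :: "nat \<Rightarrow> nat \<Rightarrow> 'a::real_normed_vector"
  assumes p: "1 \<le> p" and lim: "\<And>k. (\<lambda>n. S n k) \<longlonglongrightarrow> s k"
    and ev: "\<And>n. N \<le> n \<Longrightarrow> lp_ball p (S n) B"
  shows "lp_ball p s B"
  unfolding lp_ball_def
proof (intro allI impI)
  fix K :: "nat set" assume K: "finite K"
  have B: "0 \<le> B" using lp_ball_nonneg[OF ev[of N]] by simp
  show "lp_bound p K s B"
  proof (cases "p = \<infinity>")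
    case True
    have "norm (s k) \<le> B" if "k \<in> K" for k
      using ev lp_ballD[OF ev K] that True
      by (intro LIMSEQ_le_const2[OF tendsto_norm[OF lim]] exI[of _ N]) (auto simp: lp_bound_def)
    then show ?thesis using True B by (simp add: lp_bound_def)
  next
    case False
    note p' = real_of_exponent[OF p False]
    have "(\<lambda>n. \<Sum>k\<in>K. norm (S n k) powr real_of_ereal p) \<longlonglongrightarrow> (\<Sum>k\<in>K. norm (s k) powr real_of_ereal p)"
      using p' by (intro tendsto_sum tendsto_powr' tendsto_norm lim tendsto_const) auto
    then have "(\<Sum>k\<in>K. norm (s k) powr real_of_ereal p) \<le> B powr real_of_ereal p"
      using lp_ballD[OF ev K] False
      by (intro LIMSEQ_le_const2[of _ _ "B powr real_of_ereal p"] exI[of _ N]) (auto simp: lp_bound_def)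
    then show ?thesis using False B by (simp add: lp_bound_def)
  qed
qed

text \<open>
  The limit is taken coordinatewise; closed balls are closed under coordinatewise limits.
\<close>

lemma lp_complete:
  fixes S :: "nat \<Rightarrow> nat \<Rightarrow> 'a::{real_normed_field,banach}"
  assumes p: "1 \<le> p" and S: "\<And>n. lp_finite p (S n)"
    and cauchy: "\<And>\<epsilon>. 0 < \<epsilon> \<Longrightarrow> \<exists>M. \<forall>m\<ge>M. \<forall>n\<ge>m. lp_ball p (\<lambda>k. S n k - S m k) \<epsilon>"
  shows "\<exists>s. lp_finite p s \<and> (\<forall>\<epsilon>>0. \<exists>M. \<forall>n\<ge>M. lp_ball p (\<lambda>k. S n k - s k) \<epsilon>)"
proof -
  have "\<exists>l. (\<lambda>n. S n k) \<longlonglongrightarrow> l" for k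
  proof -
    have "Cauchy (\<lambda>n. S n k)"
    proof (rule metric_CauchyI)
      fix e :: real assume "0 < e"
      then obtain M where M: "\<forall>m\<ge>M. \<forall>n\<ge>m. lp_ball p (\<lambda>k. S n k - S m k) (e / 2)"
        using cauchy[of "e / 2"] by auto
      have *: "dist (S m k) (S n k) < e" if "M \<le> m" "m \<le> n" for m n
      proof -
        have "lp_ball p (\<lambda>k. S n k - S m k) (e / 2)" using M that by blast
        from lp_bound_component[OF p _ lp_ballD[OF this], of "{k}" k] show ?thesis
          using \<open>0 < e\<close> by (simp add: dist_norm norm_minus_commute)
      qed
      show "\<exists>M. \<forall>m\<ge>M. \<forall>n\<ge>M. dist (S m k) (S n k) < e"
        using * by (metis dist_commute nle_le)
    qed
    then show ?thesis using Cauchy_convergent convergent_def by blast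
  qed
  then obtain s where s: "\<And>k. (\<lambda>n. S n k) \<longlonglongrightarrow> s k" by metis
  have close: "\<exists>M. \<forall>n\<ge>M. lp_ball p (\<lambda>k. S n k - s k) \<epsilon>" if eps: "0 < \<epsilon>" for \<epsilon>
  proof -
    obtain M where M: "\<forall>m\<ge>M. \<forall>n\<ge>m. lp_ball p (\<lambda>k. S n k - S m k) \<epsilon>"
      using cauchy[OF eps] by blast
    have "lp_ball p (\<lambda>k. S m k - s k) \<epsilon>" if "M \<le> m" for m
    proof -
      have "lp_ball p (\<lambda>k. s k - S m k) \<epsilon>"
        by (rule lp_ball_limit[OF p, of "\<lambda>n k. S n k - S m k" _ m])
          (use M that s in \<open>auto intro!: tendsto_diff\<close>)
      from lp_ball_minus[OF p this] show ?thesis by simp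
    qed
    then show ?thesis by blast
  qed
  obtain M where M: "lp_ball p (\<lambda>k. S M k - s k) 1" using close[of 1] by auto
  have "lp_ball p (\<lambda>k. S M k - (S M k - s k)) (lp_norm p (S M) + 1)"
    by (rule lp_ball_diff[OF p lp_finite_imp_ball[OF p S] M])
  then have "lp_finite p s" using lp_finite_iff_ball[OF p] by auto
  then show ?thesis using close by blast
qed

section \<open>Unconditional convergence as an unordered Cauchy condition\<close>

text \<open>
  The Cauchy condition for the net of finite partial sums, which does not mention permutations.
\<close>

definition unordered_cauchy :: "ereal \<Rightarrow> (nat \<Rightarrow> nat \<Rightarrow> 'a::real_normed_vector) \<Rightarrow> bool" where
  "unordered_cauchy p x \<longleftrightarrow>
     (\<forall>\<epsilon>>0. \<exists>N. \<forall>F. finite F \<longrightarrow> F \<subseteq> {N..} \<longrightarrow> lp_ball p (\<lambda>k. \<Sum>n\<in>F. x n k) \<epsilon>)"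

lemma sum_fun_eq: "(\<Sum>n\<in>F. x n) = (\<lambda>k. \<Sum>n\<in>F. (x n k :: 'a::ab_group_add))"
  by (induction F rule: infinite_finite_induct) (auto simp: fun_eq_iff)

lemma lp_finite_sum:
  fixes x :: "nat \<Rightarrow> nat \<Rightarrow> 'a::real_normed_field"
  assumes "1 \<le> p" "finite F" "\<And>n. lp_finite p (x n)"
  shows "lp_finite p (\<lambda>k. \<Sum>n\<in>F. x n k)"
  using lp_ball_sum[OF assms(1,2), of x "\<lambda>n. lp_norm p (x n)"] lp_finite_imp_ball[OF assms(1,3)]
    lp_finite_iff_ball[OF assms(1)] by blast

lemma series_converges_ell:
  fixes x :: "nat \<Rightarrow> nat \<Rightarrow> 'a::real_normed_field"
  assumes p: "1 \<le> p" and x: "\<And>n. lp_finite p (x n)"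
  shows "series_converges (ell p) x \<longleftrightarrow>
    (\<exists>s. lp_finite p s \<and> (\<forall>\<epsilon>>0. \<exists>M. \<forall>n\<ge>M. lp_ball p (\<lambda>k. (\<Sum>i<n. x i k) - s k) \<epsilon>))"
proof -
  have "((\<lambda>N. vnorm (ell p) ((\<Sum>n<N. x n) - s)) \<longlonglongrightarrow> 0) \<longleftrightarrow>
     (\<forall>\<epsilon>>0. \<exists>M. \<forall>n\<ge>M. lp_ball p (\<lambda>k. (\<Sum>i<n. x i k) - s k) \<epsilon>)" if s: "lp_finite p s" for s
  proof -
    define d where "d n = (\<lambda>k. (\<Sum>i<n. x i k) - s k)" for n
    have d: "(\<Sum>i<n. x i) - s = d n" for n by (simp add: d_def sum_fun_eq fun_eq_iff)
    have fin: "lp_finite p (d n)" for n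
      unfolding d_def
      by (rule lp_ball_imp_finite_norm(1)[OF p lp_ball_diff[OF p
            lp_finite_imp_ball[OF p lp_finite_sum[OF p _ x]] lp_finite_imp_ball[OF p s]]]) simp
    have ball: "lp_ball p (d n) \<epsilon> \<longleftrightarrow> lp_norm p (d n) \<le> \<epsilon>" for n \<epsilon>
      using lp_ball_imp_finite_norm(2)[OF p, of "d n" \<epsilon>] lp_ball_mono[OF p lp_finite_imp_ball[OF p fin[of n]], of \<epsilon>]
      by (rule iffI)
    have n0: "0 \<le> lp_norm p (d n)" for n using lp_ball_nonneg[OF lp_finite_imp_ball[OF p fin]] .
    have "((\<lambda>N. lp_norm p (d N)) \<longlonglongrightarrow> 0) \<longleftrightarrow> (\<forall>\<epsilon>>0. \<exists>M. \<forall>n\<ge>M. lp_norm p (d n) \<le> \<epsilon>)"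
    proof
      assume "(\<lambda>N. lp_norm p (d N)) \<longlonglongrightarrow> 0"
      then show "\<forall>\<epsilon>>0. \<exists>M. \<forall>n\<ge>M. lp_norm p (d n) \<le> \<epsilon>"
        using n0 by (force simp: LIMSEQ_iff dest: less_imp_le)
    next
      assume R: "\<forall>\<epsilon>>0. \<exists>M. \<forall>n\<ge>M. lp_norm p (d n) \<le> \<epsilon>"
      show "(\<lambda>N. lp_norm p (d N)) \<longlonglongrightarrow> 0"
      proof (rule LIMSEQ_I)
        fix e :: real assume "0 < e"
        then obtain M where "\<forall>n\<ge>M. lp_norm p (d n) \<le> e / 2" using R[rule_format, of "e / 2"] by auto
        then show "\<exists>M. \<forall>n\<ge>M. norm (lp_norm p (d n) - 0) < e"
          using n0 \<open>0 < e\<close> by (intro exI[of _ M]) (smt (verit) field_sum_of_halves real_norm_def)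
      qed
    qed
    then show ?thesis by (simp add: d ball ell_def flip: d_def)
  qed
  then show ?thesis by (auto simp: series_converges_def ell_def)
qed

lemma unordered_cauchy_imp_unconditional:
  fixes x :: "nat \<Rightarrow> nat \<Rightarrow> 'a::{real_normed_field,banach}"
  assumes p: "1 \<le> p" and x: "\<And>n. lp_finite p (x n)" and U: "unordered_cauchy p x"
  shows "converges_unconditionally (ell p) x"
  unfolding converges_unconditionally_def
proof (intro allI impI)
  fix \<sigma> :: "nat \<Rightarrow> nat" assume \<sigma>: "bij \<sigma>"
  define S where "S n = (\<lambda>k. \<Sum>i<n. x (\<sigma> i) k)" for n
  have cauchy: "\<exists>M. \<forall>m\<ge>M. \<forall>n\<ge>m. lp_ball p (\<lambda>k. S n k - S m k) \<epsilon>" if eps: "0 < \<epsilon>" for \<epsilon>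
  proof -
    obtain N where N: "\<forall>F. finite F \<longrightarrow> F \<subseteq> {N..} \<longrightarrow> lp_ball p (\<lambda>k. \<Sum>n\<in>F. x n k) \<epsilon>"
      using U eps unfolding unordered_cauchy_def by blast
    obtain M where M: "\<forall>i\<in>inv \<sigma> ` {..<N}. i < M"
      using finite_nat_set_iff_bounded[of "inv \<sigma> ` {..<N}"] by auto
    have "lp_ball p (\<lambda>k. S n k - S m k) \<epsilon>" if mn: "M \<le> m" "m \<le> n" for m n
    proof -
      have "S n k - S m k = (\<Sum>j\<in>\<sigma> ` {m..<n}. x j k)" for k
      proof -
        have "(\<Sum>i<n. x (\<sigma> i) k) = (\<Sum>i<m. x (\<sigma> i) k) + (\<Sum>i\<in>{m..<n}. x (\<sigma> i) k)"
          using mn by (metis atLeast0LessThan sum.atLeastLessThan_concat zero_le)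
        then show ?thesis
          using bij_is_inj[OF \<sigma>] by (simp add: S_def sum.reindex inj_on_subset)
      qed
      moreover have "\<sigma> ` {m..<n} \<subseteq> {N..}"
      proof (intro image_subsetI)
        fix i assume i: "i \<in> {m..<n}"
        show "\<sigma> i \<in> {N..}"
        proof (rule ccontr)
          assume "\<sigma> i \<notin> {N..}"
          then have "inv \<sigma> (\<sigma> i) \<in> inv \<sigma> ` {..<N}" by auto
          then have "inv \<sigma> (\<sigma> i) < M" using M by blast
          then show False using i mn inv_f_f[OF bij_is_inj[OF \<sigma>], of i] by simp
        qed
      qed
      ultimately show ?thesis using N by simp
    qed
    then show ?thesis by blast
  qed
  have S: "lp_finite p (S n)" for n unfolding S_def by (rule lp_finite_sum[OF p _ x]) simp
  show "series_converges (ell p) (\<lambda>n. x (\<sigma> n))"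
    unfolding series_converges_ell[OF p x] using lp_complete[OF p S cauchy] by (simp only: S_def)
qed

lemma permutation_of_interval:
  fixes l u :: nat
  assumes A: "A \<subseteq> {l..<u}"
  shows "\<exists>\<pi>. bij_betw \<pi> {l..<u} {l..<u} \<and> \<pi> ` {l..<l + card A} = A"
proof -
  have fin: "finite A" using A finite_subset by blast
  have le: "card A \<le> card {l..<u}" using A by (intro card_mono) auto
  obtain f where f: "bij_betw f {l..<l + card A} A"
    using finite_same_card_bij[of "{l..<l + card A}" A] fin by auto
  obtain g where g: "bij_betw g {l + card A..<u} ({l..<u} - A)"
    using finite_same_card_bij[of "{l + card A..<u}" "{l..<u} - A"] fin A by (auto simp: card_Diff_subset)
  define \<pi> where "\<pi> n = (if n < l + card A then f n else g n)" for n
  have 1: "bij_betw \<pi> {l..<l + card A} A"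
    using f by (rule iffD1[OF bij_betw_cong, rotated]) (auto simp: \<pi>_def)
  have 2: "bij_betw \<pi> {l + card A..<u} ({l..<u} - A)"
    using g by (rule iffD1[OF bij_betw_cong, rotated]) (auto simp: \<pi>_def)
  have "bij_betw \<pi> ({l..<l + card A} \<union> {l + card A..<u}) (A \<union> ({l..<u} - A))"
    by (rule bij_betw_combine[OF 1 2]) auto
  moreover have "{l..<l + card A} \<union> {l + card A..<u} = {l..<u}"
    using le A by (cases "A = {}") (auto simp: subset_iff)
  moreover have "A \<union> ({l..<u} - A) = {l..<u}" using A by auto
  ultimately show ?thesis using 1 by (auto simp: bij_betw_def)
qed

text \<open>
  The permutation rearranges every interval \<open>{b i..<b (Suc i)}\<close> separately, moving \<open>F i\<close> to its beginning.
\<close>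

lemma block_permutation:
  fixes b :: "nat \<Rightarrow> nat"
  assumes b: "strict_mono b" "b 0 = 0" and F: "\<And>i. F i \<subseteq> {b i..<b (Suc i)}"
  shows "\<exists>\<sigma>. bij \<sigma> \<and> (\<forall>i. \<sigma> ` {b i..<b i + card (F i)} = F i)"
proof -
  define B where "B i = {b i..<b (Suc i)}" for i
  have "\<forall>i. \<exists>\<pi>. bij_betw \<pi> (B i) (B i) \<and> \<pi> ` {b i..<b i + card (F i)} = F i"
    unfolding B_def using permutation_of_interval[OF F] by blast
  then obtain \<pi> where \<pi>: "\<And>i. bij_betw (\<pi> i) (B i) (B i)" "\<And>i. \<pi> i ` {b i..<b i + card (F i)} = F i"
    by metis
  have ex: "\<exists>i. n \<in> B i" for n
  proof -
    define j where "j = (LEAST j. n < b j)"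
    have "n < b (Suc n)" using strict_mono_imp_increasing[OF b(1), of "Suc n"] by simp
    then have j: "n < b j" unfolding j_def by (rule LeastI)
    then obtain i where i: "j = Suc i" using b(2) by (cases j) auto
    then have "\<not> n < b i" using not_less_Least[of i "\<lambda>j. n < b j"] by (simp add: j_def)
    then show ?thesis using i j by (intro exI[of _ i]) (auto simp: B_def)
  qed
  have uniq: "i = j" if "n \<in> B i" "n \<in> B j" for n i j
  proof (rule ccontr)
    assume "i \<noteq> j"
    then have "Suc i \<le> j \<or> Suc j \<le> i" by auto
    then have "b (Suc i) \<le> b j \<or> b (Suc j) \<le> b i" using strict_mono_less_eq[OF b(1)] by blast
    then show False using that by (auto simp: B_def)
  qed
  define \<sigma> where "\<sigma> n = \<pi> (SOME i. n \<in> B i) n" for n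
  have \<sigma>: "\<sigma> n = \<pi> i n" if "n \<in> B i" for n i
    using uniq[OF someI[of "\<lambda>i. n \<in> B i", OF that] that] by (simp add: \<sigma>_def)
  have "bij_betw \<sigma> (\<Union>i\<in>UNIV. B i) (\<Union>i\<in>UNIV. B i)"
  proof (rule bij_betw_UNION_disjoint)
    show "disjoint_family_on B UNIV" using uniq by (force simp: disjoint_family_on_def)
    show "bij_betw \<sigma> (B i) (B i)" for i
      using \<pi>(1)[of i] by (rule iffD1[OF bij_betw_cong, rotated]) (simp add: \<sigma>)
  qed
  moreover have "(\<Union>i\<in>UNIV. B i) = UNIV" using ex by auto
  moreover have "\<sigma> ` {b i..<b i + card (F i)} = F i" for i
  proof -
    have "card (F i) \<le> card (B i)" using F by (intro card_mono) (auto simp: B_def)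
    then have "{b i..<b i + card (F i)} \<subseteq> B i"
      using strict_monoD[OF b(1), of i "Suc i"] by (auto simp: B_def)
    then have "\<sigma> ` {b i..<b i + card (F i)} = \<pi> i ` {b i..<b i + card (F i)}"
      by (intro image_cong) (auto simp: \<sigma>)
    then show ?thesis using \<pi>(2) by simp
  qed
  ultimately show ?thesis by auto
qed

text \<open>
  If large sums over finite sets occur arbitrarily far out, a block permutation makes infinitely many of
  these sets contiguous, and the rearranged series violates the Cauchy criterion.
\<close>

lemma unconditional_imp_unordered_cauchy:
  fixes x :: "nat \<Rightarrow> nat \<Rightarrow> 'a::real_normed_field"
  assumes p: "1 \<le> p" and x: "\<And>n. lp_finite p (x n)" and conv: "converges_unconditionally (ell p) x"
  shows "unordered_cauchy p x"
proof (rule ccontr)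
  assume "\<not> unordered_cauchy p x"
  then have "\<exists>\<epsilon>>0. \<forall>N. \<exists>F. finite F \<and> F \<subseteq> {N..} \<and> \<not> lp_ball p (\<lambda>k. \<Sum>n\<in>F. x n k) \<epsilon>"
    by (simp add: unordered_cauchy_def)
  then obtain \<epsilon> where \<epsilon>: "0 < \<epsilon>"
    "\<forall>N. \<exists>F. finite F \<and> F \<subseteq> {N..} \<and> \<not> lp_ball p (\<lambda>k. \<Sum>n\<in>F. x n k) \<epsilon>"
    by (elim exE conjE)
  obtain G where "\<forall>N. finite (G N) \<and> G N \<subseteq> {N..} \<and> \<not> lp_ball p (\<lambda>k. \<Sum>n\<in>G N. x n k) \<epsilon>"
    using choice[OF \<epsilon>(2)] by (elim exE)
  then have G: "\<And>N. finite (G N)" "\<And>N. G N \<subseteq> {N..}"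
    "\<And>N. \<not> lp_ball p (\<lambda>k. \<Sum>n\<in>G N. x n k) \<epsilon>" by auto
  \<comment> \<open>A number beyond \<open>G N\<close>, so that the sets \<open>G (b i)\<close> occupy successive intervals.\<close>
  define nxt where "nxt N = Suc (Max (insert N (G N)))" for N
  define b where "b i = (nxt ^^ i) 0" for i
  have nxt: "N < nxt N" "G N \<subseteq> {N..<nxt N}" for N
    using G(1,2)[of N] by (auto simp: nxt_def less_Suc_eq_le)
  have b: "strict_mono b" "b 0 = 0" "b (Suc i) = nxt (b i)" for i
    using nxt by (auto simp: b_def strict_mono_Suc_iff)
  have F: "\<And>i. G (b i) \<subseteq> {b i..<b (Suc i)}" unfolding b(3) by (rule nxt(2))
  obtain \<sigma> where \<sigma>: "bij \<sigma>" "\<And>i. \<sigma> ` {b i..<b i + card (G (b i))} = G (b i)"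
    using block_permutation[of b "\<lambda>i. G (b i)", OF b(1,2) F] by blast
  have "series_converges (ell p) (\<lambda>n. x (\<sigma> n))"
    using conv \<sigma>(1) by (simp add: converges_unconditionally_def)
  then obtain s where "\<forall>\<epsilon>>0. \<exists>M. \<forall>n\<ge>M. lp_ball p (\<lambda>k. (\<Sum>i<n. x (\<sigma> i) k) - s k) \<epsilon>"
    unfolding series_converges_ell[OF p x] by blast
  then obtain M where M: "\<forall>n\<ge>M. lp_ball p (\<lambda>k. (\<Sum>i<n. x (\<sigma> i) k) - s k) (\<epsilon> / 2)"
    using \<epsilon>(1) by (meson half_gt_zero)
  define m where "m = b M"
  define n where "n = b M + card (G (b M))"
  have mn: "M \<le> m" "m \<le> n" using strict_mono_imp_increasing[OF b(1), of M] by (auto simp: m_def n_def)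
  have "lp_ball p (\<lambda>k. ((\<Sum>i<n. x (\<sigma> i) k) - s k) - ((\<Sum>i<m. x (\<sigma> i) k) - s k)) (\<epsilon> / 2 + \<epsilon> / 2)"
    using M mn by (intro lp_ball_diff[OF p]) auto
  moreover have "((\<Sum>i<n. x (\<sigma> i) k) - s k) - ((\<Sum>i<m. x (\<sigma> i) k) - s k) = (\<Sum>j\<in>G m. x j k)" for k
  proof -
    have "(\<Sum>i<n. x (\<sigma> i) k) = (\<Sum>i<m. x (\<sigma> i) k) + (\<Sum>i\<in>{m..<n}. x (\<sigma> i) k)"
      using mn by (metis atLeast0LessThan sum.atLeastLessThan_concat zero_le)
    moreover have "(\<Sum>i\<in>{m..<n}. x (\<sigma> i) k) = (\<Sum>j\<in>\<sigma> ` {m..<n}. x j k)"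
      using bij_is_inj[OF \<sigma>(1)] by (simp add: sum.reindex inj_on_subset)
    ultimately show ?thesis using \<sigma>(2)[of M] by (simp add: m_def n_def)
  qed
  ultimately show False using G(3)[of m] by simp
qed

text \<open>
  A signed sum is the difference of the sums over the positive and over the negative signs.
\<close>

lemma unordered_cauchy_signed:
  fixes x :: "nat \<Rightarrow> nat \<Rightarrow> 'a::real_normed_algebra_1"
  assumes p: "1 \<le> p" and F: "finite F"
    and N: "\<And>G. G \<subseteq> F \<Longrightarrow> lp_ball p (\<lambda>k. \<Sum>n\<in>G. x n k) \<epsilon>" and t: "\<forall>n. t n \<in> {-1, 1::real}"
  shows "lp_ball p (\<lambda>k. \<Sum>n\<in>F. t n *\<^sub>R x n k) (2 * \<epsilon>)"
proof -
  define P where "P = {n \<in> F. t n = 1}"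
  have "lp_ball p (\<lambda>k. (\<Sum>n\<in>P. x n k) - (\<Sum>n\<in>F - P. x n k)) (\<epsilon> + \<epsilon>)"
    by (intro lp_ball_diff[OF p] N) (auto simp: P_def)
  moreover have "(\<Sum>n\<in>P. x n k) - (\<Sum>n\<in>F - P. x n k) = (\<Sum>n\<in>F. t n *\<^sub>R x n k)" for k
  proof -
    have "(\<Sum>n\<in>F. t n *\<^sub>R x n k) = (\<Sum>n\<in>F - P. t n *\<^sub>R x n k) + (\<Sum>n\<in>P. t n *\<^sub>R x n k)"
      using F by (intro sum.subset_diff) (auto simp: P_def)
    also have "(\<Sum>n\<in>F - P. t n *\<^sub>R x n k) = (\<Sum>n\<in>F - P. - x n k)"
    proof (intro sum.cong refl)
      fix n assume "n \<in> F - P"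
      then have "t n = - 1" using t[THEN spec, of n] by (auto simp: P_def)
      then show "t n *\<^sub>R x n k = - x n k" by simp
    qed
    also have "(\<Sum>n\<in>P. t n *\<^sub>R x n k) = (\<Sum>n\<in>P. x n k)"
      by (intro sum.cong) (auto simp: P_def)
    finally show ?thesis by (simp add: sum_negf)
  qed
  ultimately show ?thesis by simp
qed

section \<open>From a uniform finite bound to preservation\<close>

text \<open>
  The finite inequality with constant \<open>C\<close> behind preservation of unconditional convergence. It bounds the sum
  of absolute values, so that it also covers changing signs of the multipliers and complex multipliers.
\<close>

definition action_bound :: "ereal \<Rightarrow> ereal \<Rightarrow> ereal \<Rightarrow> real \<Rightarrow> bool" where
  "action_bound p q r C \<longleftrightarrow> 0 \<le> C \<and> (\<forall>(I :: nat set) (K :: nat set) (x :: nat \<Rightarrow> nat \<Rightarrow> real) (a :: nat \<Rightarrow> nat \<Rightarrow> real).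
     finite I \<longrightarrow> finite K \<longrightarrow>
     (\<forall>t. (\<forall>n. t n \<in> {-1, 1}) \<longrightarrow> lp_bound q K (\<lambda>k. \<Sum>n\<in>I. t n * x n k) 1) \<longrightarrow>
     (\<forall>n\<in>I. lp_bound p K (a n) 1) \<longrightarrow> lp_bound r K (\<lambda>k. \<Sum>n\<in>I. \<bar>a n k\<bar> * \<bar>x n k\<bar>) C)"

lemma action_bound_homogeneous:
  fixes x a :: "nat \<Rightarrow> nat \<Rightarrow> real"
  assumes exps: "1 \<le> p" "1 \<le> q" "1 \<le> r" and C: "action_bound p q r C" and I: "finite I"
    and D: "0 < D" and x: "\<And>t. (\<forall>n. t n \<in> {-1, 1}) \<Longrightarrow> lp_ball q (\<lambda>k. \<Sum>n\<in>I. t n * x n k) D"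
    and A: "0 < A" and a: "\<And>n. n \<in> I \<Longrightarrow> lp_ball p (a n) A"
  shows "lp_ball r (\<lambda>k. \<Sum>n\<in>I. \<bar>a n k\<bar> * \<bar>x n k\<bar>) (C * A * D)"
  unfolding lp_ball_def
proof (intro allI impI)
  fix K :: "nat set" assume K: "finite K"
  define x' where "x' n k = x n k / D" for n k
  define a' where "a' n k = a n k / A" for n k
  have 1: "lp_bound q K (\<lambda>k. \<Sum>n\<in>I. t n * x' n k) 1" if t: "\<forall>n. t n \<in> {-1, 1}" for t
  proof -
    have eq: "(\<Sum>n\<in>I. t n * x' n k) = (1 / D) * (\<Sum>n\<in>I. t n * x n k)" for k
      by (simp add: x'_def sum_distrib_left)
    have "lp_bound q K (\<lambda>k. \<Sum>n\<in>I. t n * x' n k) (1 / D * D)"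
      by (rule lp_bound_scale[OF exps(2) lp_ballD[OF x[OF t] K]])
        (use D in \<open>auto simp: eq abs_mult\<close>)
    then show ?thesis using D by simp
  qed
  have 2: "lp_bound p K (a' n) 1" if n: "n \<in> I" for n
  proof -
    have "lp_bound p K (a' n) (1 / A * A)"
      by (rule lp_bound_scale[OF exps(1) lp_ballD[OF a[OF n] K]]) (use A in \<open>auto simp: a'_def\<close>)
    then show ?thesis using A by simp
  qed
  have "lp_bound r K (\<lambda>k. \<Sum>n\<in>I. \<bar>a' n k\<bar> * \<bar>x' n k\<bar>) C"
    using C[unfolded action_bound_def, THEN conjunct2, THEN spec, THEN spec, THEN spec, THEN spec,
        THEN mp, THEN mp, THEN mp, THEN mp, OF I K, of x' a'] 1 2 by blast
  then have "lp_bound r K (\<lambda>k. \<Sum>n\<in>I. \<bar>a n k\<bar> * \<bar>x n k\<bar>) (A * D * C)"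
  proof (rule lp_bound_scale[OF exps(3)])
    fix k
    have "(\<Sum>n\<in>I. \<bar>a n k\<bar> * \<bar>x n k\<bar>) = A * D * (\<Sum>n\<in>I. \<bar>a' n k\<bar> * \<bar>x' n k\<bar>)"
      using A D by (simp add: a'_def x'_def sum_distrib_left)
    then show "norm (\<Sum>n\<in>I. \<bar>a n k\<bar> * \<bar>x n k\<bar>) = A * D * norm (\<Sum>n\<in>I. \<bar>a' n k\<bar> * \<bar>x' n k\<bar>)"
      using A D by (simp add: abs_mult)
  qed (use A D in auto)
  then show "lp_bound r K (\<lambda>k. \<Sum>n\<in>I. \<bar>a n k\<bar> * \<bar>x n k\<bar>) (C * A * D)" by (simp add: mult_ac)
qed

text \<open>
  Far out, the signed sums of \<open>x\<close> are small in \<open>\<ell>\<^sub>q\<close>; they remain so under \<open>R1\<close> and \<open>R2\<close>, and the homogeneous form of the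
  finite bound makes the sums of \<open>a n * x n\<close> small in \<open>\<ell>\<^sub>r\<close>. The functionals \<open>R1\<close> and \<open>R2\<close> are \<open>Re\<close> and \<open>Im\<close> for
  complex sequences, and the identity and \<open>0\<close> for real ones.
\<close>

lemma preserves_if_action_bound:
  fixes R1 R2 :: "'a::{real_normed_field,banach} \<Rightarrow> real"
  assumes exps: "1 \<le> p" "1 \<le> q" "1 \<le> r" and C: "action_bound p q r C"
    and lin: "linear R1" "linear R2" and le: "\<And>z. \<bar>R1 z\<bar> \<le> norm z" "\<And>z. \<bar>R2 z\<bar> \<le> norm z"
    and ge: "\<And>z. norm z \<le> \<bar>R1 z\<bar> + \<bar>R2 z\<bar>"
  shows "preserves_unconditional_convergence (ell p) (ell q) (ell r)
    (coord_mult :: (nat \<Rightarrow> 'a) \<Rightarrow> (nat \<Rightarrow> 'a) \<Rightarrow> nat \<Rightarrow> 'a)"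
  unfolding preserves_unconditional_convergence_def
proof (intro allI impI)
  fix x a :: "nat \<Rightarrow> nat \<Rightarrow> 'a"
  assume "range x \<subseteq> vectors (ell q)" and conv: "converges_unconditionally (ell q) x"
    and "range a \<subseteq> vectors (ell p)" and "bounded_sequence (ell p) a"
  then have x: "\<And>n. lp_finite q (x n)" and a: "\<And>n. lp_finite p (a n)"
    and "\<exists>A. \<forall>n. lp_norm p (a n) \<le> A"
    by (auto simp: ell_def bounded_sequence_def)
  then obtain A0 where A0: "\<And>n. lp_norm p (a n) \<le> A0" by blast
  \<comment> \<open>Strictly positive, as a divisor.\<close>
  define A where "A = max 1 A0"
  have A: "0 < A" by (simp add: A_def)
  have aA: "lp_ball p (a n) A" for n
    using lp_ball_mono[OF exps(1) lp_finite_imp_ball[OF exps(1) a[of n]]] A0[of n] by (simp add: A_def)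
  have U: "unordered_cauchy q x"
    by (rule unconditional_imp_unordered_cauchy[OF exps(2) x conv])
  have C0: "0 \<le> C" using C by (simp add: action_bound_def)
  have part: "lp_ball r (\<lambda>k. \<Sum>n\<in>F. norm (a n k) * \<bar>R (x n k)\<bar>) (C * A * (2 * \<epsilon>))"
    if F: "finite F" and \<epsilon>: "0 < \<epsilon>" and sub: "\<And>G. G \<subseteq> F \<Longrightarrow> lp_ball q (\<lambda>k. \<Sum>n\<in>G. x n k) \<epsilon>"
      and R: "linear R" "\<And>z. \<bar>R z\<bar> \<le> norm z" for R :: "'a \<Rightarrow> real" and F \<epsilon>
  proof -
    have "lp_ball q (\<lambda>k. \<Sum>n\<in>F. t n * R (x n k)) (2 * \<epsilon>)" if t: "\<forall>n. t n \<in> {-1, 1}" for t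
    proof (rule lp_ball_dominated[OF exps(2) unordered_cauchy_signed[OF exps(2) F sub t]])
      fix k
      have "(\<Sum>n\<in>F. t n * R (x n k)) = R (\<Sum>n\<in>F. t n *\<^sub>R x n k)"
        using R(1) by (simp add: linear_sum linear_scale)
      then show "norm (\<Sum>n\<in>F. t n * R (x n k)) \<le> norm (\<Sum>n\<in>F. t n *\<^sub>R x n k)"
        using R(2) by simp
    qed
    moreover have "lp_ball p (\<lambda>k. norm (a n k)) A" for n
      by (rule lp_ball_dominated[OF exps(1) aA[of n]]) simp
    ultimately have "lp_ball r (\<lambda>k. \<Sum>n\<in>F. \<bar>norm (a n k)\<bar> * \<bar>R (x n k)\<bar>) (C * A * (2 * \<epsilon>))"
      using \<epsilon> A by (intro action_bound_homogeneous[OF exps C F]) auto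
    then show ?thesis by simp
  qed
  have both: "lp_ball r (\<lambda>k. \<Sum>n\<in>F. coord_mult (a n) (x n) k) (4 * C * A * \<epsilon>)"
    if F: "finite F" and \<epsilon>: "0 < \<epsilon>" and sub: "\<And>G. G \<subseteq> F \<Longrightarrow> lp_ball q (\<lambda>k. \<Sum>n\<in>G. x n k) \<epsilon>" for F \<epsilon>
  proof -
    have "lp_ball r (\<lambda>k. (\<Sum>n\<in>F. norm (a n k) * \<bar>R1 (x n k)\<bar>) + (\<Sum>n\<in>F. norm (a n k) * \<bar>R2 (x n k)\<bar>))
        (C * A * (2 * \<epsilon>) + C * A * (2 * \<epsilon>))"
      by (intro lp_ball_add[OF exps(3)] part F \<epsilon> sub lin le)
    then have "lp_ball r (\<lambda>k. \<Sum>n\<in>F. coord_mult (a n) (x n) k) (C * A * (2 * \<epsilon>) + C * A * (2 * \<epsilon>))"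
    proof (rule lp_ball_dominated[OF exps(3)])
      fix k
      have "norm (\<Sum>n\<in>F. coord_mult (a n) (x n) k) \<le> (\<Sum>n\<in>F. norm (a n k) * norm (x n k))"
        by (rule sum_norm_le) (simp add: coord_mult_def norm_mult)
      also have "\<dots> \<le> (\<Sum>n\<in>F. norm (a n k) * (\<bar>R1 (x n k)\<bar> + \<bar>R2 (x n k)\<bar>))"
        by (intro sum_mono mult_left_mono ge) auto
      also have "\<dots> \<le> norm ((\<Sum>n\<in>F. norm (a n k) * \<bar>R1 (x n k)\<bar>) + (\<Sum>n\<in>F. norm (a n k) * \<bar>R2 (x n k)\<bar>))"
        by (simp add: distrib_left sum.distrib)
      finally show "norm (\<Sum>n\<in>F. coord_mult (a n) (x n) k)
        \<le> norm ((\<Sum>n\<in>F. norm (a n k) * \<bar>R1 (x n k)\<bar>) + (\<Sum>n\<in>F. norm (a n k) * \<bar>R2 (x n k)\<bar>))" .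
    qed
    then show ?thesis by (simp add: algebra_simps)
  qed
  have fin: "lp_finite r (coord_mult (a n) (x n))" for n
  proof -
    have "lp_ball r (\<lambda>k. \<Sum>m\<in>{n}. coord_mult (a m) (x m) k) (4 * C * A * (lp_norm q (x n) + 1))"
    proof (rule both)
      have xn: "lp_ball q (x n) (lp_norm q (x n))" by (rule lp_finite_imp_ball[OF exps(2) x])
      show "0 < lp_norm q (x n) + 1" using lp_ball_nonneg[OF xn] by simp
      fix G assume "G \<subseteq> {n}"
      then have "G = {} \<or> G = {n}" by auto
      then show "lp_ball q (\<lambda>k. \<Sum>m\<in>G. x m k) (lp_norm q (x n) + 1)"
        using lp_ball_mono[OF exps(2) lp_ball_zero, of "lp_norm q (x n) + 1"]
          lp_ball_mono[OF exps(2) xn, of "lp_norm q (x n) + 1"] lp_ball_nonneg[OF xn]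
        by (elim disjE) auto
    qed simp
    then show ?thesis using lp_ball_imp_finite_norm(1)[OF exps(3)] by simp
  qed
  have "unordered_cauchy r (\<lambda>n. coord_mult (a n) (x n))"
    unfolding unordered_cauchy_def
  proof (intro allI impI)
    fix \<epsilon> :: real assume \<epsilon>: "0 < \<epsilon>"
    define \<delta> where "\<delta> = \<epsilon> / (C + 1) / (4 * A)"
    have \<delta>: "0 < \<delta>" using \<epsilon> A C0 by (simp add: \<delta>_def)
    have "4 * C * A * \<delta> = \<epsilon> * (C / (C + 1))" using A by (simp add: \<delta>_def)
    also have "\<dots> \<le> \<epsilon> * 1" using \<epsilon> C0 by (intro mult_left_mono) auto
    finally have \<delta>': "4 * C * A * \<delta> \<le> \<epsilon>" by simp
    obtain N where N: "\<forall>F. finite F \<longrightarrow> F \<subseteq> {N..} \<longrightarrow> lp_ball q (\<lambda>k. \<Sum>n\<in>F. x n k) \<delta>"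
      using U \<delta> unfolding unordered_cauchy_def by blast
    have "lp_ball r (\<lambda>k. \<Sum>n\<in>F. coord_mult (a n) (x n) k) \<epsilon>" if F: "finite F" "F \<subseteq> {N..}" for F
    proof (rule lp_ball_mono[OF exps(3) both \<delta>'])
      show "lp_ball q (\<lambda>k. \<Sum>n\<in>G. x n k) \<delta>" if "G \<subseteq> F" for G
        using N finite_subset[OF that F(1)] that F(2) by auto
    qed (use F \<delta> in auto)
    then show "\<exists>N. \<forall>F. finite F \<longrightarrow> F \<subseteq> {N..} \<longrightarrow>
        lp_ball r (\<lambda>k. \<Sum>n\<in>F. coord_mult (a n) (x n) k) \<epsilon>" by blast
  qed
  then show "converges_unconditionally (ell r) (\<lambda>n. coord_mult (a n) (x n))"
    by (rule unordered_cauchy_imp_unconditional[OF exps(3) fin])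
qed

section \<open>Exponents with a uniform finite bound\<close>

definition inv_exp :: "ereal \<Rightarrow> real" where
  "inv_exp p = (if p = \<infinity> then 0 else 1 / real_of_ereal p)"

lemma inv_exp_less: "1 \<le> r \<Longrightarrow> r < q \<Longrightarrow> inv_exp q < inv_exp r"
  by (cases q; cases r) (auto simp: inv_exp_def frac_less2)

lemma one_divide_exponent:
  assumes "1 \<le> p"
  shows "1 / p = ereal (inv_exp p)"
  using assms by (cases p) (auto simp: inv_exp_def one_ereal_def)

text \<open>
  The inclusions \<open>\<ell>\<^sub>p' \<subseteq> \<ell>\<^sub>p\<close>, \<open>\<ell>\<^sub>q' \<subseteq> \<ell>\<^sub>q\<close> and \<open>\<ell>\<^sub>r \<subseteq> \<ell>\<^sub>r'\<close> have norm \<open>1\<close>.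
\<close>

lemma action_bound_mono:
  assumes exps: "1 \<le> p'" "1 \<le> q'" "1 \<le> r" and le: "p' \<le> p" "q' \<le> q" "r \<le> r'"
    and C: "action_bound p q r C"
  shows "action_bound p' q' r' C"
  unfolding action_bound_def
proof (intro conjI allI impI)
  show "0 \<le> C" using C by (simp add: action_bound_def)
  fix I K :: "nat set" and x a :: "nat \<Rightarrow> nat \<Rightarrow> real"
  assume IK: "finite I" "finite K"
    and x: "\<forall>t. (\<forall>n. t n \<in> {-1, 1}) \<longrightarrow> lp_bound q' K (\<lambda>k. \<Sum>n\<in>I. t n * x n k) 1"
    and a: "\<forall>n\<in>I. lp_bound p' K (a n) 1"
  have "\<forall>t. (\<forall>n. t n \<in> {-1, 1}) \<longrightarrow> lp_bound q K (\<lambda>k. \<Sum>n\<in>I. t n * x n k) 1"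
    by (intro allI impI lp_bound_exponent_mono[OF exps(2) le(2) IK(2)]) (rule x[THEN spec, THEN mp])
  moreover have "\<forall>n\<in>I. lp_bound p K (a n) 1"
    by (intro ballI lp_bound_exponent_mono[OF exps(1) le(1) IK(2)]) (rule a[THEN bspec])
  ultimately have "lp_bound r K (\<lambda>k. \<Sum>n\<in>I. \<bar>a n k\<bar> * \<bar>x n k\<bar>) C"
    using C IK unfolding action_bound_def by simp
  then show "lp_bound r' K (\<lambda>k. \<Sum>n\<in>I. \<bar>a n k\<bar> * \<bar>x n k\<bar>) C"
    by (rule lp_bound_exponent_mono[OF exps(3) le(3) IK(2)])
qed

lemma action_bound_infinity:
  assumes exps: "1 \<le> p" "1 \<le> q"
  shows "action_bound p q \<infinity> 1"
  unfolding action_bound_def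
proof (intro conjI allI impI)
  fix I K :: "nat set" and x a :: "nat \<Rightarrow> nat \<Rightarrow> real"
  assume IK: "finite I" "finite K"
    and x: "\<forall>t. (\<forall>n. t n \<in> {-1, 1}) \<longrightarrow> lp_bound q K (\<lambda>k. \<Sum>n\<in>I. t n * x n k) 1"
    and a: "\<forall>n\<in>I. lp_bound p K (a n) 1"
  have "(\<Sum>n\<in>I. \<bar>a n k\<bar> * \<bar>x n k\<bar>) \<le> 1" if k: "k \<in> K" for k
  proof -
    define t where "t n = (if x n k < 0 then -1 else 1 :: real)" for n
    have "(\<Sum>n\<in>I. \<bar>a n k\<bar> * \<bar>x n k\<bar>) \<le> (\<Sum>n\<in>I. t n * x n k)"
    proof (rule sum_mono)
      fix n assume "n \<in> I"
      then have "\<bar>a n k\<bar> \<le> 1" using lp_bound_component[OF exps(1) IK(2) _ k] a by fastforce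
      then have "\<bar>a n k\<bar> * \<bar>x n k\<bar> \<le> 1 * \<bar>x n k\<bar>" by (intro mult_right_mono) auto
      moreover have "t n * x n k = \<bar>x n k\<bar>" by (simp add: t_def)
      ultimately show "\<bar>a n k\<bar> * \<bar>x n k\<bar> \<le> t n * x n k" by simp
    qed
    also have "\<dots> \<le> norm (\<Sum>n\<in>I. t n * x n k)" by simp
    also have "\<dots> \<le> 1"
    proof -
      have "lp_bound q K (\<lambda>k. \<Sum>n\<in>I. t n * x n k) 1" using x[THEN spec, of t] by (simp add: t_def)
      from lp_bound_component[OF exps(2) IK(2) this k] show ?thesis .
    qed
    finally show ?thesis .
  qed
  then show "lp_bound \<infinity> K (\<lambda>k. \<Sum>n\<in>I. \<bar>a n k\<bar> * \<bar>x n k\<bar>) 1"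
    by (simp add: lp_bound_def sum_nonneg)
qed simp

lemma action_boundI:
  assumes "0 \<le> C"
    and "\<And>(I :: nat set) (K :: nat set) x a. finite I \<Longrightarrow> finite K \<Longrightarrow> sign_bounded q I K x \<Longrightarrow> \<forall>n\<in>I. lp_bound p K (a n) (1::real) \<Longrightarrow>
       (\<Sum>k\<in>K. (\<Sum>n\<in>I. \<bar>a n k\<bar> * \<bar>x n k\<bar>) powr r) \<le> C powr r"
  shows "action_bound p (ereal q) (ereal r) C"
  unfolding action_bound_def
proof (intro conjI allI impI)
  fix I K :: "nat set" and x a :: "nat \<Rightarrow> nat \<Rightarrow> real"
  assume IK: "finite I" "finite K"
    and x: "\<forall>t. (\<forall>n. t n \<in> {-1, 1}) \<longrightarrow> lp_bound (ereal q) K (\<lambda>k. \<Sum>n\<in>I. t n * x n k) 1"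
    and a: "\<forall>n\<in>I. lp_bound p K (a n) 1"
  have "sign_bounded q I K x" using x by (simp add: sign_bounded_def lp_bound_def)
  from assms(2)[OF IK this a] assms(1)
  show "lp_bound (ereal r) K (\<lambda>k. \<Sum>n\<in>I. \<bar>a n k\<bar> * \<bar>x n k\<bar>) C"
    by (simp add: lp_bound_def sum_nonneg)
qed (rule assms)

lemma action_bound_two:
  assumes "1 \<le> q"
  shows "action_bound 2 (ereal q) (ereal q) (32 / 9)"
proof (rule action_boundI)
  fix I K :: "nat set" and x a :: "nat \<Rightarrow> nat \<Rightarrow> real"
  assume *: "finite I" "finite K" "sign_bounded q I K x" and a: "\<forall>n\<in>I. lp_bound 2 K (a n) 1"
  have "(\<Sum>k\<in>K. (a n k)\<^sup>2) \<le> 1" if "n \<in> I" for n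
    using a that unfolding lp_bound_two_iff by simp
  then show "(\<Sum>k\<in>K. (\<Sum>n\<in>I. \<bar>a n k\<bar> * \<bar>x n k\<bar>) powr q) \<le> (32 / 9) powr q"
    by (rule finite_action_l2[OF *(1,2) assms *(3)])
qed simp

lemma action_bound_below:
  assumes "1 \<le> p" "p < q"
  shows "\<exists>C. action_bound (ereal p) (ereal q) (ereal q) C"
proof -
  obtain C where C: "0 < C"
    "\<And>(I :: nat set) (K :: nat set) x a. finite I \<Longrightarrow> finite K \<Longrightarrow> sign_bounded q I K x \<Longrightarrow>
       (\<forall>n\<in>I. (\<Sum>k\<in>K. \<bar>a n k\<bar> powr p) \<le> 1) \<Longrightarrow>
       (\<Sum>k\<in>K. (\<Sum>n\<in>I. \<bar>a n k\<bar> * \<bar>x n k\<bar>) powr q) \<le> C powr q"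
    using finite_action_below[OF assms, where ?'i = nat and ?'k = nat] by blast
  have "action_bound (ereal p) (ereal q) (ereal q) C"
    by (rule action_boundI) (use C in \<open>auto simp: lp_bound_def\<close>)
  then show ?thesis ..
qed

lemma action_bound_above:
  assumes "1 \<le> q" "q < p"
  shows "\<exists>C. action_bound (ereal p) (ereal q) (ereal p) C"
proof -
  obtain C where C: "0 < C"
    "\<And>(I :: nat set) (K :: nat set) x a. finite I \<Longrightarrow> finite K \<Longrightarrow> sign_bounded q I K x \<Longrightarrow>
       (\<forall>n\<in>I. (\<Sum>k\<in>K. \<bar>a n k\<bar> powr p) \<le> 1) \<Longrightarrow>
       (\<Sum>k\<in>K. (\<Sum>n\<in>I. \<bar>a n k\<bar> * \<bar>x n k\<bar>) powr p) \<le> C powr p"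
    using finite_action_above[OF assms, where ?'i = nat and ?'k = nat] by blast
  have "action_bound (ereal p) (ereal q) (ereal p) C"
    by (rule action_boundI) (use C in \<open>auto simp: lp_bound_def\<close>)
  then show ?thesis ..
qed

lemma action_bound_interpolated:
  assumes p: "2 < p" and q: "1 \<le> q" "q < 2" and s: "1 / s = inv_exp p + 1 / q - 1 / 2"
  shows "action_bound p (ereal q) (ereal s) (32 / 9)"
proof (rule action_boundI)
  fix I K :: "nat set" and x a :: "nat \<Rightarrow> nat \<Rightarrow> real"
  assume *: "finite I" "finite K" "sign_bounded q I K x" and a: "\<forall>n\<in>I. lp_bound p K (a n) 1"
  have p1: "1 \<le> p" by (rule order_trans[OF _ less_imp_le[OF p]]) simp
  have pi: "0 \<le> inv_exp p" "inv_exp p < 1 / 2" using p by (cases p; force simp: inv_exp_def field_simps)+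
  have "1 / 2 < 1 / q" using q by (simp add: field_simps)
  then have "0 < 1 / s" unfolding s using pi by simp
  then have s0: "0 < s" by simp
  define b where "b n k = (if p = \<infinity> then 1 / card K else \<bar>a n k\<bar> powr real_of_ereal p)" for n k
  show "(\<Sum>k\<in>K. (\<Sum>n\<in>I. \<bar>a n k\<bar> * \<bar>x n k\<bar>) powr s) \<le> (32 / 9) powr s"
  proof (rule finite_action_interpolated[OF *(1,2) q(1) *(3) pi s0 s, of b])
    show "0 \<le> b n k" for n k by (simp add: b_def)
    show "(\<Sum>k\<in>K. b n k) \<le> 1" if "n \<in> I" for n
      using a that by (cases "p = \<infinity>") (auto simp: b_def lp_bound_def)
    show "\<bar>a n k\<bar> \<le> b n k powr inv_exp p" if "n \<in> I" "k \<in> K" for n k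
    proof (cases "p = \<infinity>")
      case True
      then show ?thesis using a that *(2) by (auto simp: b_def inv_exp_def lp_bound_def)
    next
      case False
      then show ?thesis using real_of_exponent[OF p1 False] by (simp add: b_def inv_exp_def powr_powr)
    qed
  qed
qed simp

text \<open>
  If \<open>p = q < r\<close>, the vectors \<open>x n\<close> are regarded as elements of \<open>\<ell>\<^sub>r\<close>, whose exponent is different from \<open>p\<close>; the same
  inclusion reduces \<open>p < q \<le> r\<close> to \<open>q = r\<close>. In the last case the bound holds with target exponent \<open>s\<close>, where
  \<open>1/s = 1/p + 1/q - 1/2 \<ge> 1/r\<close>.
\<close>

lemma exists_action_bound:
  assumes exps: "1 \<le> p" "1 \<le> q" "1 \<le> r"
    and cond: "(p \<le> 2 \<and> q \<le> r) \<or> (2 < p \<and> p < q \<and> q \<le> r) \<or> (2 < p \<and> p = q \<and> q < r) \<or>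
       (p = q \<and> q = r \<and> r = \<infinity>) \<or> (2 \<le> q \<and> q < p \<and> p \<le> r) \<or>
       (q < 2 \<and> 2 < p \<and> inv_exp p + inv_exp q \<ge> inv_exp r + 1 / 2)"
  shows "\<exists>C. action_bound p q r C"
proof (cases "r = \<infinity>")
  case True
  then show ?thesis using action_bound_infinity[OF exps(1,2)] by blast
next
  case False
  note r = real_of_exponent[OF exps(3) False]
  define r' where "r' = real_of_ereal r"
  have r': "1 \<le> r'" "r = ereal r'" using r by (auto simp: r'_def)
  consider "p \<le> 2" "q \<le> r" | "p < r" "q \<le> r" "p \<le> q" | "q < p" "p \<le> r" |
      "q < 2" "2 < p" "inv_exp p + inv_exp q \<ge> inv_exp r + 1 / 2"
    using cond False by fastforce
  then show ?thesis
  proof cases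
    case 1
    then obtain q' where "q = ereal q'" "1 \<le> q'" using exps(2) r' by (cases q) auto
    then show ?thesis
      using action_bound_mono[OF exps(1,2) exps(2) 1(1) order_refl 1(2)] action_bound_two by blast
  next
    case 2
    then obtain p' where p': "p = ereal p'" "1 \<le> p'" using exps(1) by (cases p) auto
    then obtain C where "action_bound p r r C"
      using action_bound_below[of p' r'] 2 r' by auto
    then show ?thesis using action_bound_mono[OF exps order_refl 2(2) order_refl] by blast
  next
    case 3
    then obtain p' where p': "p = ereal p'" using exps(1) r' by (cases p) auto
    then obtain q' where q': "q = ereal q'" "1 \<le> q'" using 3 exps(2) by (cases q) auto
    obtain C where "action_bound p q p C"
      using action_bound_above[of q' p'] 3 p' q' by auto
    then show ?thesis using action_bound_mono[OF exps(1,2,1) order_refl order_refl 3(2)] by blast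
  next
    case 4
    then obtain q' where q': "q = ereal q'" "1 \<le> q'" "q' < 2" using exps(2) by (cases q) auto
    define s where "s = 1 / (inv_exp p + 1 / q' - 1 / 2)"
    have "inv_exp q = 1 / q'" using q' by (simp add: inv_exp_def)
    then have le: "1 / r' \<le> 1 / s" using 4(3) r' by (simp add: s_def inv_exp_def)
    then have "0 < s" using r' by (smt (verit) zero_less_divide_1_iff)
    then have "s \<le> r'" using le r' by (simp add: field_simps)
    moreover have "1 \<le> s"
    proof -
      have "inv_exp p < 1 / 2" using 4(2) by (cases p) (auto simp: inv_exp_def field_simps)
      moreover have "1 / q' \<le> 1" using q' by simp
      ultimately have "1 / s \<le> 1" by (simp add: s_def)
      then show ?thesis using \<open>0 < s\<close> by simp
    qed
    moreover have "action_bound p q (ereal s) (32 / 9)"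
      unfolding q'(1) by (rule action_bound_interpolated[OF 4(2) q'(2,3)]) (simp add: s_def)
    ultimately show ?thesis
      using action_bound_mono[OF exps(1,2) _ order_refl order_refl, of "ereal s" r] r' by auto
  qed
qed

section \<open>Gluing finite examples\<close>

text \<open>
  The type argument is the index type of the finite families; examples are most naturally indexed by
  numbers or by pairs of numbers.
\<close>

definition unbounded_action :: "'i itself \<Rightarrow> ereal \<Rightarrow> ereal \<Rightarrow> ereal \<Rightarrow> bool" where
  "unbounded_action _ p q r \<longleftrightarrow> (\<forall>C. \<exists>(I :: 'i set) (K :: nat set) x a. finite I \<and> finite K \<and>
     (\<forall>n\<in>I. lp_bound p K (a n) (1::real)) \<and>
     (\<forall>J\<subseteq>I. lp_bound q K (\<lambda>k. \<Sum>n\<in>J. x n k :: real) 1) \<and>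
     \<not> lp_bound r K (\<lambda>k. \<Sum>n\<in>I. a n k * x n k) C)"

text \<open>
  For every \<open>i\<close> there is a finite example exceeding \<open>2 ^ i\<close>. Scaled by \<open>(1 / 2) ^ i\<close> and joined to one
  sequence, these examples form a series in \<open>\<ell>\<^sub>q\<close> whose blocks have summable norms, while every block of the
  product series still has norm greater than \<open>1\<close>. The term number \<open>to_nat (i, n)\<close> is the \<open>n\<close>-th vector of
  example \<open>i\<close>; all other terms are \<open>0\<close>.
\<close>

lemma not_preserves_if_unbounded:
  assumes exps: "1 \<le> p" "1 \<le> q" "1 \<le> r"
    and unb: "unbounded_action TYPE('i::countable) p q r"
  shows "\<not> preserves_unconditional_convergence (ell p) (ell q) (ell r)
    (coord_mult :: (nat \<Rightarrow> 'a::{real_normed_field,banach}) \<Rightarrow> (nat \<Rightarrow> 'a) \<Rightarrow> nat \<Rightarrow> 'a)"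
proof
  assume pres: "preserves_unconditional_convergence (ell p) (ell q) (ell r)
    (coord_mult :: (nat \<Rightarrow> 'a) \<Rightarrow> (nat \<Rightarrow> 'a) \<Rightarrow> nat \<Rightarrow> 'a)"
  define P where "P i I K x a \<longleftrightarrow> finite I \<and> finite K \<and> (\<forall>n\<in>I. lp_bound p K (a n) (1::real)) \<and>
      (\<forall>J\<subseteq>I. lp_bound q K (\<lambda>k. \<Sum>n\<in>J. x n k :: real) 1) \<and>
      \<not> lp_bound r K (\<lambda>k. \<Sum>n\<in>I. a n k * x n k) (2 ^ i)"
    for i :: nat and I :: "'i set" and K :: "nat set" and x a
  have "\<forall>i. \<exists>I K x a. P i I K x a" unfolding P_def by (intro allI unb[unfolded unbounded_action_def, THEN spec])
  then obtain I K x a where P: "\<And>i. P i (I i) (K i) (x i) (a i)" by metis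
  have IK: "finite (I i)" "finite (K i)"
    and a: "n \<in> I i \<Longrightarrow> lp_bound p (K i) (a i n) 1"
    and x: "J \<subseteq> I i \<Longrightarrow> lp_bound q (K i) (\<lambda>k. \<Sum>n\<in>J. x i n k) 1"
    and ax: "\<not> lp_bound r (K i) (\<lambda>k. \<Sum>n\<in>I i. a i n k * x i n k) (2 ^ i)" for i n J
    using P[of i] by (simp_all add: P_def)
  define blk :: "nat \<Rightarrow> nat" where "blk m = fst (from_nat m :: nat \<times> 'i)" for m
  define pos :: "nat \<Rightarrow> 'i" where "pos m = snd (from_nat m :: nat \<times> 'i)" for m
  \<comment> \<open>Since \<open>from_nat\<close> need not be injective, a term counts only at the canonical code of its index.\<close>
  define used where "used m \<longleftrightarrow> m = to_nat (blk m, pos m) \<and> pos m \<in> I (blk m)" for m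
  have dec: "blk (to_nat (i, n)) = i" "pos (to_nat (i, n)) = n" for i and n :: 'i
    by (simp_all add: blk_def pos_def)
  define xt where "xt i n k = (if k \<in> K i then (1 / 2) ^ i * x i n k else 0)" for i n k
  define ta where "ta i n k = (if k \<in> K i then a i n k else 0)" for i n k
  define X :: "nat \<Rightarrow> nat \<Rightarrow> 'a" where "X m = (\<lambda>k. of_real (if used m then xt (blk m) (pos m) k else 0))" for m
  define A :: "nat \<Rightarrow> nat \<Rightarrow> 'a" where "A m = (\<lambda>k. of_real (if used m then ta (blk m) (pos m) k else 0))" for m
  have A1: "lp_ball p (A m) 1" for m
  proof (cases "used m")
    case True
    then have "lp_ball p (ta (blk m) (pos m)) 1"
      unfolding ta_def used_def by (intro lp_ball_truncate IK a) auto
    then show ?thesis by (rule lp_ball_dominated[OF exps(1)]) (use True in \<open>simp add: A_def\<close>)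
  next
    case False
    have "lp_ball p (A m) 0" by (rule lp_ball_dominated[OF exps(1) lp_ball_zero]) (simp add: A_def False)
    then show ?thesis by (rule lp_ball_mono[OF exps(1)]) simp
  qed
  have xt: "lp_ball q (\<lambda>k. \<Sum>n\<in>J. xt i n k) ((1 / 2) ^ i)" if J: "J \<subseteq> I i" for i J
  proof -
    have "lp_bound q (K i) (\<lambda>k. \<Sum>n\<in>J. xt i n k) ((1 / 2) ^ i * 1)"
    proof (rule lp_bound_scale[OF exps(2) x[OF J]])
      fix k assume "k \<in> K i"
      then have "(\<Sum>n\<in>J. xt i n k) = (1 / 2) ^ i * (\<Sum>n\<in>J. x i n k)"
        by (simp add: xt_def sum_distrib_left)
      then show "norm (\<Sum>n\<in>J. xt i n k) = (1 / 2) ^ i * norm (\<Sum>n\<in>J. x i n k)"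
        by (simp add: abs_mult)
    qed simp
    from lp_ball_truncate[OF IK(2) this] show ?thesis
      by simp (erule lp_ball_dominated[OF exps(2)], auto simp: xt_def)
  qed
  have blockX: "lp_ball q (\<lambda>k. \<Sum>m\<in>{m \<in> F. blk m = i}. X m k) ((1 / 2) ^ i)" if F: "finite F" for F i
  proof -
    define J where "J = pos ` {m \<in> F. blk m = i \<and> used m}"
    have J: "J \<subseteq> I i" by (auto simp: J_def used_def)
    have "inj_on pos {m \<in> F. blk m = i \<and> used m}"
      by (rule inj_onI) (metis (mono_tags, lifting) mem_Collect_eq used_def)
    then have J_sum: "(\<Sum>n\<in>J. xt i n k) = (\<Sum>m\<in>{m \<in> F. blk m = i \<and> used m}. xt i (pos m) k)" for k
      unfolding J_def by (simp add: sum.reindex)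
    have "(\<Sum>m\<in>{m \<in> F. blk m = i}. X m k) = of_real (\<Sum>n\<in>J. xt i n k)" for k
    proof -
      have "(\<Sum>m\<in>{m \<in> F. blk m = i}. X m k) = (\<Sum>m\<in>{m \<in> F. blk m = i \<and> used m}. X m k)"
        using F by (intro sum.mono_neutral_right) (auto simp: X_def)
      also have "\<dots> = (\<Sum>m\<in>{m \<in> F. blk m = i \<and> used m}. of_real (xt i (pos m) k))"
        by (intro sum.cong) (auto simp: X_def)
      finally show ?thesis unfolding J_sum by simp
    qed
    then show ?thesis
      by (intro lp_ball_dominated[OF exps(2) xt[OF J]]) (simp only: norm_of_real real_norm_def order_refl)
  qed
  have sumX: "lp_ball q (\<lambda>k. \<Sum>m\<in>F. X m k) (\<Sum>i\<in>blk ` F. (1 / 2) ^ i)" if F: "finite F" for F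
  proof -
    have "(\<Sum>m\<in>F. X m k) = (\<Sum>i\<in>blk ` F. \<Sum>m\<in>{m \<in> F. blk m = i}. X m k)" for k
      using F by (intro sum.group[symmetric]) auto
    then show ?thesis using F by (simp add: lp_ball_sum[OF exps(2)] blockX)
  qed
  have finX: "lp_finite q (X m)" for m
    using lp_ball_imp_finite_norm(1)[OF exps(2) sumX[of "{m}"]] by simp
  have "unordered_cauchy q X"
    unfolding unordered_cauchy_def
  proof (intro allI impI)
    fix \<epsilon> :: real assume "0 < \<epsilon>"
    then obtain i0 where i0: "(1 / 2) ^ i0 < \<epsilon> / 2" using real_arch_pow_inv[of "\<epsilon> / 2" "1 / 2"] by auto
    have "finite (\<Union>i<i0. (\<lambda>n. to_nat (i, n)) ` I i)" using IK by auto
    then obtain N where N: "\<forall>m\<in>(\<Union>i<i0. (\<lambda>n. to_nat (i, n)) ` I i). m < N"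
      using finite_nat_set_iff_bounded by metis
    have "lp_ball q (\<lambda>k. \<Sum>m\<in>F. X m k) \<epsilon>" if F: "finite F" "F \<subseteq> {N..}" for F
    proof -
      define G where "G = {m \<in> F. used m}"
      have "(\<Sum>m\<in>F. X m k) = (\<Sum>m\<in>G. X m k)" for k
        unfolding G_def using F by (intro sum.mono_neutral_right) (auto simp: X_def)
      moreover have "(\<Sum>i\<in>blk ` G. (1 / 2) ^ i) \<le> \<epsilon>"
      proof -
        have ge: "i0 \<le> i" if i: "i \<in> blk ` G" for i
        proof (rule ccontr)
          assume "\<not> i0 \<le> i"
          obtain m where m: "m \<in> F" "used m" "i = blk m" using i by (auto simp: G_def)
          then have "m \<in> (\<Union>i<i0. (\<lambda>n. to_nat (i, n)) ` I i)"
            using \<open>\<not> i0 \<le> i\<close> unfolding used_def by (auto intro!: bexI[of _ "blk m"] image_eqI[of _ _ "pos m"])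
          then show False using N m(1) F(2) by force
        qed
        have fin: "finite (blk ` G)" using F by (simp add: G_def)
        have "inj_on (\<lambda>i. i - i0) (blk ` G)"
          by (rule inj_onI) (metis ge le_add_diff_inverse)
        then have "(\<Sum>i\<in>blk ` G. (1 / 2 :: real) ^ (i - i0)) \<le> 2"
          using sum_power_inj_le[of "1 / 2" "blk ` G" "\<lambda>i. i - i0"] fin by simp
        moreover have "(\<Sum>i\<in>blk ` G. (1 / 2 :: real) ^ i) = (1 / 2) ^ i0 * (\<Sum>i\<in>blk ` G. (1 / 2) ^ (i - i0))"
          unfolding sum_distrib_left using ge by (intro sum.cong) (auto simp flip: power_add)
        ultimately have "(\<Sum>i\<in>blk ` G. (1 / 2 :: real) ^ i) \<le> (1 / 2) ^ i0 * 2"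
          by (simp add: mult_left_mono)
        then show ?thesis using i0 by simp
      qed
      ultimately show ?thesis
        using lp_ball_mono[OF exps(2) sumX[of G]] F by (simp add: G_def)
    qed
    then show "\<exists>N. \<forall>F. finite F \<longrightarrow> F \<subseteq> {N..} \<longrightarrow> lp_ball q (\<lambda>k. \<Sum>m\<in>F. X m k) \<epsilon>" by blast
  qed
  then have "converges_unconditionally (ell q) X"
    by (rule unordered_cauchy_imp_unconditional[OF exps(2) finX])
  moreover have "bounded_sequence (ell p) A"
    using lp_ball_imp_finite_norm(2)[OF exps(1) A1] by (auto simp: bounded_sequence_def ell_def)
  moreover have "lp_finite p (A m)" for m using lp_ball_imp_finite_norm(1)[OF exps(1) A1] .
  ultimately have conv: "converges_unconditionally (ell r) (\<lambda>m. coord_mult (A m) (X m))"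
    using pres finX unfolding preserves_unconditional_convergence_def
    by (auto simp: ell_def image_subset_iff)
  have finAX: "lp_finite r (coord_mult (A m) (X m))" for m
  proof -
    let ?f = "coord_mult (A m) (X m)"
    have "\<exists>B. lp_bound r (K (blk m)) ?f B"
    proof (cases "r = \<infinity>")
      case True
      have "norm (?f k) \<le> (\<Sum>k\<in>K (blk m). norm (?f k))" if "k \<in> K (blk m)" for k
        using that IK by (intro member_le_sum) auto
      then show ?thesis using True
        by (auto simp: lp_bound_def intro!: exI[of _ "\<Sum>k\<in>K (blk m). norm (?f k)"] sum_nonneg)
    next
      case False
      then show ?thesis using real_of_exponent[OF exps(3) False]
        by (auto simp: lp_bound_def powr_powr sum_nonneg
            intro!: exI[of _ "(\<Sum>k\<in>K (blk m). norm (?f k) powr real_of_ereal r) powr (1 / real_of_ereal r)"])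
    qed
    then obtain B where "lp_bound r (K (blk m)) ?f B" by blast
    from lp_ball_truncate[OF IK(2) this]
    have "lp_ball r ?f B"
      by (rule lp_ball_dominated[OF exps(3)]) (simp add: coord_mult_def X_def xt_def)
    then show ?thesis by (rule lp_ball_imp_finite_norm(1)[OF exps(3)])
  qed
  have "unordered_cauchy r (\<lambda>m. coord_mult (A m) (X m))"
    by (rule unconditional_imp_unordered_cauchy[OF exps(3) finAX conv])
  then obtain N where N: "\<forall>F. finite F \<longrightarrow> F \<subseteq> {N..} \<longrightarrow> lp_ball r (\<lambda>k. \<Sum>m\<in>F. coord_mult (A m) (X m) k) 1"
    unfolding unordered_cauchy_def by (meson zero_less_one)
  \<comment> \<open>The terms before \<open>N\<close> belong to finitely many blocks, and block \<open>i\<close> comes after all of these.\<close>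
  define i where "i = Suc (Max (insert 0 (blk ` {..<N})))"
  define F where "F = (\<lambda>n. to_nat (i, n)) ` I i"
  have "blk m \<noteq> i" if "m < N" for m
  proof -
    have "blk m \<le> Max (insert 0 (blk ` {..<N}))" using that by (intro Max_ge) auto
    then show ?thesis by (simp add: i_def)
  qed
  then have "F \<subseteq> {N..}" unfolding F_def using dec by (force simp: not_less[symmetric])
  moreover have "finite F" using IK by (simp add: F_def)
  ultimately have *: "lp_ball r (\<lambda>k. \<Sum>m\<in>F. coord_mult (A m) (X m) k) 1" using N by blast
  have inj: "inj_on (\<lambda>n. to_nat (i, n)) (I i)" by (rule inj_onI) (metis dec(2))
  have eq: "(\<Sum>m\<in>F. coord_mult (A m) (X m) k) = of_real ((1 / 2) ^ i * (\<Sum>n\<in>I i. a i n k * x i n k))"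
    if k: "k \<in> K i" for k
  proof -
    have "used (to_nat (i, n))" if "n \<in> I i" for n using that by (simp add: used_def dec)
    then have "(\<Sum>m\<in>F. coord_mult (A m) (X m) k) = (\<Sum>n\<in>I i. of_real (ta i n k) * of_real (xt i n k))"
      unfolding F_def sum.reindex[OF inj] o_def
      by (intro sum.cong) (auto simp: coord_mult_def A_def X_def dec)
    also have "\<dots> = of_real (\<Sum>n\<in>I i. (1 / 2) ^ i * (a i n k * x i n k))"
      using k by (simp add: ta_def xt_def mult_ac)
    finally show ?thesis by (simp add: sum_distrib_left)
  qed
  have "lp_bound r (K i) (\<lambda>k. \<Sum>n\<in>I i. a i n k * x i n k) (2 ^ i * 1)"
  proof (rule lp_bound_scale[OF exps(3) lp_ballD[OF * IK(2)]])
    fix k assume "k \<in> K i"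
    show "norm (\<Sum>n\<in>I i. a i n k * x i n k) = 2 ^ i * norm (\<Sum>m\<in>F. coord_mult (A m) (X m) k)"
      unfolding eq[OF \<open>k \<in> K i\<close>] norm_of_real by (simp add: abs_mult power_one_over)
  qed simp
  then show False using ax[of i] by simp
qed

section \<open>Diagonal and Hadamard examples\<close>

lemma lp_bound_const_iff:
  assumes p: "1 \<le> p" and K: "finite K" "K \<noteq> {}" and f: "\<And>k. k \<in> K \<Longrightarrow> norm (f k) = c"
  shows "lp_bound p K f B \<longleftrightarrow> c * real (card K) powr inv_exp p \<le> B"
proof -
  obtain k where "k \<in> K" using K by blast
  then have c: "0 \<le> c" using f[of k] norm_ge_zero[of "f k"] by simp
  have N: "0 < card K" using K by (simp add: card_gt_0_iff)
  show ?thesis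
  proof (cases "p = \<infinity>")
    case True
    then show ?thesis using K N c f by (auto simp: lp_bound_def inv_exp_def)
  next
    case False
    note p' = real_of_exponent[OF p False]
    define D where "D = c * real (card K) powr inv_exp p"
    have D: "0 \<le> D" using c by (simp add: D_def)
    have "(\<Sum>k\<in>K. norm (f k) powr real_of_ereal p) = D powr real_of_ereal p"
      using p' False f by (simp add: D_def powr_mult powr_powr inv_exp_def)
    then have "lp_bound p K f B \<longleftrightarrow> 0 \<le> B \<and> D powr real_of_ereal p \<le> B powr real_of_ereal p"
      using False by (simp add: lp_bound_def)
    also have "\<dots> \<longleftrightarrow> D \<le> B"
      using p' D powr_mono2[of "real_of_ereal p" D B] powr_less_mono2[of "real_of_ereal p" B D] by force
    finally show ?thesis by (simp add: D_def)
  qed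
qed

lemma ex_power_gt:
  assumes "0 < (\<eta>::real)"
  shows "\<exists>m. C < real (2 ^ m) powr \<eta>"
proof -
  have "1 < 2 powr \<eta>" using assms by simp
  then obtain m where "C < (2 powr \<eta>) ^ m" using real_arch_pow by blast
  also have "(2 powr \<eta>) ^ m = real (2 ^ m) powr \<eta>"
    by (simp add: powr_powr mult.commute flip: powr_realpow)
  finally show ?thesis by blast
qed

lemma unbounded_diagonal:
  assumes exps: "1 \<le> p" "1 \<le> q" "1 \<le> r" and rq: "r < q"
  shows "unbounded_action TYPE(nat) p q r"
  unfolding unbounded_action_def
proof
  fix C
  obtain m where m: "C < real (2 ^ m) powr (inv_exp r - inv_exp q)"
    using ex_power_gt inv_exp_less[OF exps(3) rq] by (metis diff_gt_0_iff_gt)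
  define N :: nat where "N = 2 ^ m"
  define c where "c = real N powr (- inv_exp q)"
  define x :: "nat \<Rightarrow> nat \<Rightarrow> real" where "x n k = (if n = k then c else 0)" for n k
  define a :: "nat \<Rightarrow> nat \<Rightarrow> real" where "a n k = (if n = k then 1 else 0)" for n k
  have N: "0 < N" "{..<N} \<noteq> {}" by (simp_all add: N_def lessThan_empty_iff)
  have c: "0 \<le> c" by (simp add: c_def)
  have "lp_bound p {..<N} (a n) 1" for n
  proof (cases "p = \<infinity>")
    case False
    have "(\<Sum>k<N. norm (a n k) powr real_of_ereal p) = (\<Sum>k<N. if n = k then 1 else 0)"
      by (intro sum.cong) (auto simp: a_def)
    then show ?thesis using False by (simp add: lp_bound_def)
  qed (auto simp: lp_bound_def a_def)
  moreover have "lp_bound q {..<N} (\<lambda>k. \<Sum>n\<in>J. x n k) 1" if J: "J \<subseteq> {..<N}" for J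
  proof (rule lp_bound_dominated[OF exps(2), of _ "\<lambda>_. c"])
    show "lp_bound q {..<N} (\<lambda>_. c) 1"
      using c N by (subst lp_bound_const_iff[OF exps(2), of _ _ c]) (auto simp: c_def simp flip: powr_add)
    show "norm (\<Sum>n\<in>J. x n k) \<le> norm c" for k
      using finite_subset[OF J] c by (simp add: x_def)
  qed
  moreover have "\<not> lp_bound r {..<N} (\<lambda>k. \<Sum>n<N. a n k * x n k) C"
  proof -
    have "a n k * x n k = (if n = k then c else 0)" for n k by (simp add: a_def x_def)
    then have "norm (\<Sum>n<N. a n k * x n k) = c" if "k \<in> {..<N}" for k
      using that c by simp
    then show ?thesis
      using m N by (subst lp_bound_const_iff[OF exps(3), of _ _ c]) (auto simp: c_def N_def algebra_simps simp flip: powr_add)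
  qed
  ultimately show "\<exists>(I :: nat set) (K :: nat set) x a. finite I \<and> finite K \<and>
     (\<forall>n\<in>I. lp_bound p K (a n) (1::real)) \<and>
     (\<forall>J\<subseteq>I. lp_bound q K (\<lambda>k. \<Sum>n\<in>J. x n k :: real) 1) \<and>
     \<not> lp_bound r K (\<lambda>k. \<Sum>n\<in>I. a n k * x n k) C"
    by (intro exI[of _ "{..<N}"] exI[of _ x] exI[of _ a]) auto
qed

lemma sum_lessThan_double:
  fixes f :: "nat \<Rightarrow> 'a::comm_monoid_add"
  shows "(\<Sum>n<2 * N. f n) = (\<Sum>n<N. f n) + (\<Sum>n<N. f (N + n))"
proof -
  have "(\<Sum>n<2 * N. f n) = (\<Sum>n<N. f n) + (\<Sum>n\<in>{N..<2 * N}. f n)"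
    by (metis atLeast0LessThan le_add2 mult_2 sum.atLeastLessThan_concat zero_le)
  also have "(\<Sum>n\<in>{N..<2 * N}. f n) = (\<Sum>n<N. f (N + n))"
    using sum.shift_bounds_nat_ivl[of f 0 N N] by (simp add: mult_2 atLeast0LessThan add.commute)
  finally show ?thesis .
qed

text \<open>
  The properties used of a block diagonal \<open>N \<times> N\<close> matrix whose diagonal blocks are Hadamard matrices of size
  \<open>2 ^ j\<close>. The last condition is the bound \<open>2 powr (j / 2)\<close> for the operator norm on \<open>\<ell>\<^sub>2\<close>.
\<close>

definition hadamard_blocks :: "nat \<Rightarrow> nat \<Rightarrow> (nat \<Rightarrow> nat \<Rightarrow> real) \<Rightarrow> bool" where
  "hadamard_blocks j N H \<longleftrightarrow> (\<forall>n<N. \<forall>k<N. H n k \<in> {-1, 0, 1}) \<and>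
     (\<forall>k<N. (\<Sum>n<N. \<bar>H n k\<bar>) = 2 ^ j) \<and> (\<forall>n<N. (\<Sum>k<N. \<bar>H n k\<bar>) = 2 ^ j) \<and>
     (\<forall>t. (\<Sum>k<N. (\<Sum>n<N. t n * H n k)\<^sup>2) \<le> 2 ^ j * (\<Sum>n<N. (t n)\<^sup>2))"

lemma less_double_cases:
  fixes n N :: nat
  assumes "n < 2 * N"
  obtains "n < N" | n' where "n' < N" "n = N + n'"
  using assms by (metis add_less_cancel_left le_Suc_ex mult_2 not_less)

text \<open>
  Placing two copies on the diagonal keeps the size of the blocks; Sylvester's construction doubles it when there is a
  single block. The parallelogram identity gives the norm bound of the latter.
\<close>

lemma hadamard_blocks_double:
  assumes H: "hadamard_blocks j N H" and N: "0 < N"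
  shows "hadamard_blocks j (2 * N) (\<lambda>n k. if (n < N) = (k < N) then H (n mod N) (k mod N) else 0)"
    (is "hadamard_blocks _ _ ?D")
    and "hadamard_blocks (Suc j) (2 * N) (\<lambda>n k. (if n < N \<or> k < N then 1 else - 1) * H (n mod N) (k mod N))"
    (is "hadamard_blocks _ _ ?W")
proof -
  have val: "H n k \<in> {-1, 0, 1}" if "n < N" "k < N" for n k using H that by (simp add: hadamard_blocks_def)
  have col: "(\<Sum>n<N. \<bar>H n k\<bar>) = 2 ^ j" and row: "(\<Sum>n<N. \<bar>H k n\<bar>) = 2 ^ j" if "k < N" for k
    using H that by (auto simp: hadamard_blocks_def)
  have sq: "(\<Sum>k<N. (\<Sum>n<N. t n * H n k)\<^sup>2) \<le> 2 ^ j * (\<Sum>n<N. (t n)\<^sup>2)" for t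
    using H by (simp add: hadamard_blocks_def)
  have "?D n k \<in> {-1, 0, 1}" "?W n k \<in> {-1, 0, 1}" for n k
    using val[of "n mod N" "k mod N"] N by auto
  moreover have "(\<Sum>n<2 * N. \<bar>?D n k\<bar>) = 2 ^ j" "(\<Sum>n<2 * N. \<bar>?D k n\<bar>) = 2 ^ j"
    "(\<Sum>n<2 * N. \<bar>?W n k\<bar>) = 2 ^ Suc j" "(\<Sum>n<2 * N. \<bar>?W k n\<bar>) = 2 ^ Suc j" if "k < 2 * N" for k
    using that by (cases rule: less_double_cases; simp add: sum_lessThan_double col row)+
  moreover have "(\<Sum>k<2 * N. (\<Sum>n<2 * N. t n * ?D n k)\<^sup>2) \<le> 2 ^ j * (\<Sum>n<2 * N. (t n)\<^sup>2)" for t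
  proof -
    have "(\<Sum>k<2 * N. (\<Sum>n<2 * N. t n * ?D n k)\<^sup>2) =
       (\<Sum>k<N. (\<Sum>n<N. t n * H n k)\<^sup>2) + (\<Sum>k<N. (\<Sum>n<N. t (N + n) * H n k)\<^sup>2)"
      by (simp add: sum_lessThan_double)
    also have "\<dots> \<le> 2 ^ j * (\<Sum>n<N. (t n)\<^sup>2) + 2 ^ j * (\<Sum>n<N. (t (N + n))\<^sup>2)"
      by (intro add_mono sq)
    finally show ?thesis by (simp add: sum_lessThan_double distrib_left)
  qed
  moreover have "(\<Sum>k<2 * N. (\<Sum>n<2 * N. t n * ?W n k)\<^sup>2) \<le> 2 ^ Suc j * (\<Sum>n<2 * N. (t n)\<^sup>2)" for t
  proof -
    define u v where "u k = (\<Sum>n<N. t n * H n k)" and "v k = (\<Sum>n<N. t (N + n) * H n k)" for k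
    have "(\<Sum>k<2 * N. (\<Sum>n<2 * N. t n * ?W n k)\<^sup>2) = (\<Sum>k<N. (u k + v k)\<^sup>2) + (\<Sum>k<N. (u k - v k)\<^sup>2)"
      by (simp add: sum_lessThan_double u_def v_def sum_negf)
    also have "\<dots> = 2 * (\<Sum>k<N. (u k)\<^sup>2) + 2 * (\<Sum>k<N. (v k)\<^sup>2)"
      by (simp add: sum_distrib_left power2_sum power2_diff flip: sum.distrib)
    also have "\<dots> \<le> 2 * (2 ^ j * (\<Sum>n<N. (t n)\<^sup>2)) + 2 * (2 ^ j * (\<Sum>n<N. (t (N + n))\<^sup>2))"
      unfolding u_def v_def by (intro add_mono mult_left_mono sq) auto
    finally show ?thesis
      by (simp only: sum_lessThan_double[of "\<lambda>n. (t n)\<^sup>2"] distrib_left power_Suc mult.assoc)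
  qed
  ultimately show "hadamard_blocks j (2 * N) ?D" "hadamard_blocks (Suc j) (2 * N) ?W"
    by (simp_all only: hadamard_blocks_def) auto
qed

lemma hadamard_blocks_exist:
  assumes "j \<le> J"
  shows "\<exists>H. hadamard_blocks j (2 ^ J) H"
  using assms
proof (induction J arbitrary: j)
  case 0
  then show ?case by (intro exI[of _ "\<lambda>_ _. 1"]) (simp add: hadamard_blocks_def)
next
  case (Suc J)
  show ?case
  proof (cases "j = Suc J")
    case True
    obtain H where "hadamard_blocks J (2 ^ J) H" using Suc.IH by blast
    from hadamard_blocks_double(2)[OF this] show ?thesis using True by auto
  next
    case False
    then obtain H where "hadamard_blocks j (2 ^ J) H" using Suc by (metis le_SucE)
    from hadamard_blocks_double(1)[OF this] show ?thesis by auto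
  qed
qed

lemma hadamard_subset_sum:
  assumes H: "hadamard_blocks j N H" and J: "J \<subseteq> {..<N}"
  shows "(\<Sum>k<N. (\<Sum>n\<in>J. H n k)\<^sup>2) \<le> 2 ^ j * real N" "k < N \<Longrightarrow> \<bar>\<Sum>n\<in>J. H n k\<bar> \<le> 2 ^ j"
proof -
  \<comment> \<open>A sum of rows is a combination of the rows with coefficients \<open>0\<close> and \<open>1\<close>.\<close>
  define t where "t n = (if n \<in> J then 1 else 0 :: real)" for n
  have t: "(\<Sum>n<N. t n * H n k) = (\<Sum>n\<in>J. H n k)" for k
    using J by (simp add: t_def if_distrib[of "\<lambda>z. z * _"] Int_absorb1 flip: sum.inter_restrict cong: if_cong)
  have "(\<Sum>k<N. (\<Sum>n\<in>J. H n k)\<^sup>2) \<le> 2 ^ j * (\<Sum>n<N. (t n)\<^sup>2)"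
    using H unfolding hadamard_blocks_def t[symmetric] by blast
  also have "\<dots> \<le> 2 ^ j * (\<Sum>n<N. 1)" by (intro mult_left_mono sum_mono) (auto simp: t_def)
  finally show "(\<Sum>k<N. (\<Sum>n\<in>J. H n k)\<^sup>2) \<le> 2 ^ j * real N" by simp
  assume "k < N"
  have "\<bar>\<Sum>n\<in>J. H n k\<bar> \<le> (\<Sum>n\<in>J. \<bar>H n k\<bar>)" by (rule sum_abs)
  also have "\<dots> \<le> (\<Sum>n<N. \<bar>H n k\<bar>)" using J by (intro sum_mono2) auto
  finally show "\<bar>\<Sum>n\<in>J. H n k\<bar> \<le> 2 ^ j" using H \<open>k < N\<close> by (simp add: hadamard_blocks_def)
qed

text \<open>
  The comparison of power means, that is, Jensen's inequality for the exponent \<open>2 / q\<close>.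
\<close>

lemma lp_bound_two_imp_smaller:
  assumes q: "1 \<le> q" "q \<le> 2" and K: "finite K" and f: "lp_bound 2 K f B"
  shows "lp_bound q K f (real (card K) powr (inv_exp q - 1 / 2) * B)"
proof (cases "K = {}")
  case True
  then show ?thesis using f by (auto simp: lp_bound_def)
next
  case False
  have qi: "q \<noteq> \<infinity>" using q by auto
  define s where "s = real_of_ereal q"
  have s: "1 \<le> s" "s \<le> 2" using q real_of_exponent[OF q(1) qi] by (cases q; simp add: s_def)+
  define N where "N = real (card K)"
  have N: "0 < N" using False K by (simp add: N_def card_gt_0_iff)
  have B: "0 \<le> B" using f lp_bound_nonneg by blast
  define S where "S = (\<Sum>k\<in>K. norm (f k) powr s)"
  have S: "0 \<le> S" by (auto simp: S_def intro: sum_nonneg)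
  have "N * (S / N) powr (2 / s) \<le> (\<Sum>k\<in>K. (norm (f k) powr s) powr (2 / s))"
    unfolding N_def S_def using s by (intro powr_mean_le K) auto
  also have "\<dots> = (\<Sum>k\<in>K. (norm (f k))\<^sup>2)"
    using s by (intro sum.cong) (auto simp: powr_powr)
  also have "\<dots> \<le> B\<^sup>2" using f[unfolded lp_bound_two_iff] by simp
  finally have "(S / N) powr (2 / s) \<le> B\<^sup>2 / N" using N by (simp add: field_simps)
  then have "((S / N) powr (2 / s)) powr (s / 2) \<le> (B\<^sup>2 / N) powr (s / 2)"
    using s by (intro powr_mono2) auto
  then have "S / N \<le> (B\<^sup>2 / N) powr (s / 2)" using s S N by (simp add: powr_powr)
  also have "\<dots> = (B\<^sup>2) powr (s / 2) / N powr (s / 2)" by (simp add: powr_divide)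
  also have "(B\<^sup>2) powr (s / 2) = B powr s"
    using B by (cases "B = 0") (auto simp: powr_powr simp flip: powr_numeral)
  finally have "S \<le> N * (B powr s / N powr (s / 2))" using N by (simp add: field_simps)
  also have "\<dots> = N powr (1 - s / 2) * B powr s" using N by (simp add: powr_diff)
  also have "\<dots> = (N powr (1 / s - 1 / 2) * B) powr s"
    using s by (simp add: powr_mult powr_powr algebra_simps)
  finally show ?thesis using B qi by (simp add: lp_bound_def inv_exp_def S_def N_def s_def)
qed

text \<open>
  For an \<open>N \<times> N\<close> Hadamard matrix the sum of any set of rows has \<open>\<ell>\<^sub>2\<close> norm at most \<open>N\<close>, hence \<open>\<ell>\<^sub>q\<close> norm at most
  \<open>N powr \<eta>\<close>. The multipliers are the rows themselves, rescaled, so their products with the rows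
  add up to a constant vector.
\<close>

lemma unbounded_hadamard:
  assumes exps: "1 \<le> p" "1 \<le> q" "1 \<le> r"
    and gap: "(2 \<le> q \<and> inv_exp p < inv_exp r) \<or> (q \<le> 2 \<and> inv_exp p + inv_exp q < inv_exp r + 1 / 2)"
  shows "unbounded_action TYPE(nat) p q r"
  unfolding unbounded_action_def
proof
  fix C
  \<comment> \<open>The exponent of \<open>N\<close> in the bound for the \<open>\<ell>\<^sub>q\<close> norm of a sum of rows.\<close>
  define \<eta> where "\<eta> = (if 2 \<le> q then 1 else inv_exp q + 1 / 2)"
  have "inv_exp 2 = 1 / 2" by (simp add: inv_exp_def)
  then have \<eta>: "0 < 1 - \<eta> - inv_exp p + inv_exp r"
    using gap by (cases "q = 2") (auto simp: \<eta>_def)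
  obtain m where m: "C < real (2 ^ m) powr (1 - \<eta> - inv_exp p + inv_exp r)"
    using ex_power_gt[OF \<eta>] by blast
  define N :: nat where "N = 2 ^ m"
  have N: "0 < N" "{..<N} \<noteq> {}" by (simp_all add: N_def lessThan_empty_iff)
  obtain H where H: "hadamard_blocks m N H" using hadamard_blocks_exist[of m m] by (auto simp: N_def)
  have H1: "\<bar>H n k\<bar> = 1" if n: "n < N" and k: "k < N" for n k
  proof (rule ccontr)
    assume "\<bar>H n k\<bar> \<noteq> 1"
    moreover have "H n' k' \<in> {-1, 0, 1}" if "n' < N" "k' < N" for n' k'
      using H that by (simp add: hadamard_blocks_def)
    ultimately have *: "\<bar>H n k\<bar> < 1" "\<And>n'. n' < N \<Longrightarrow> \<bar>H n' k\<bar> \<le> 1" using n k by force+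
    have "(\<Sum>n'<N. \<bar>H n' k\<bar>) < (\<Sum>n'<N. 1)"
      by (rule sum_strict_mono_ex1) (use * n in auto)
    then show False using H k by (simp add: hadamard_blocks_def N_def)
  qed
  define c where "c = real N powr (- \<eta>)"
  define d where "d = real N powr (- inv_exp p)"
  define x where "x n k = c * H n k" for n k
  define a where "a n k = d * H n k" for n k
  have "lp_bound p {..<N} (a n) 1" if n: "n \<in> {..<N}" for n
    using N H1 n by (subst lp_bound_const_iff[OF exps(1), of _ _ d])
      (auto simp: a_def abs_mult d_def simp flip: powr_add)
  moreover have "lp_bound q {..<N} (\<lambda>k. \<Sum>n\<in>J. x n k) 1" if J: "J \<subseteq> {..<N}" for J
  proof -
    have two: "lp_bound 2 {..<N} (\<lambda>k. \<Sum>n\<in>J. H n k) (real N)"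
      unfolding lp_bound_two_iff using hadamard_subset_sum(1)[OF H J] by (simp add: N_def power2_eq_square)
    have "lp_bound q {..<N} (\<lambda>k. \<Sum>n\<in>J. H n k) (real N powr \<eta>)"
    proof (cases "2 \<le> q")
      case True
      then show ?thesis using lp_bound_exponent_mono[OF _ True _ two] N by (simp add: \<eta>_def)
    next
      case False
      have "real N powr (inv_exp q - 1 / 2) * real N = real N powr \<eta>"
        using False N by (simp add: \<eta>_def powr_mult_base mult.commute add.commute)
      then show ?thesis using lp_bound_two_imp_smaller[OF exps(2) _ _ two] False by simp
    qed
    then have "lp_bound q {..<N} (\<lambda>k. \<Sum>n\<in>J. x n k) (c * real N powr \<eta>)"
      by (rule lp_bound_scale[OF exps(2)]) (auto simp: c_def x_def abs_mult simp flip: sum_distrib_left)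
    then show ?thesis using N by (simp add: c_def flip: powr_add)
  qed
  moreover have "\<not> lp_bound r {..<N} (\<lambda>k. \<Sum>n<N. a n k * x n k) C"
  proof -
    have "norm (\<Sum>n<N. a n k * x n k) = real N * (c * d)" if k: "k \<in> {..<N}" for k
    proof -
      have "a n k * x n k = c * d" if "n \<in> {..<N}" for n
      proof -
        have "H n k * H n k = 1" using H1[of n k] that k by (auto simp: abs_if split: if_splits)
        then show ?thesis by (simp add: a_def x_def mult.commute mult.left_commute)
      qed
      then show ?thesis by (simp add: c_def d_def)
    qed
    then have "lp_bound r {..<N} (\<lambda>k. \<Sum>n<N. a n k * x n k) C \<longleftrightarrow>
        real N * (c * d) * real N powr inv_exp r \<le> C"
      using N by (subst lp_bound_const_iff[OF exps(3), of _ _ "real N * (c * d)"]) auto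
    moreover have "real N * (c * d) * real N powr inv_exp r = real N powr (1 - \<eta> - inv_exp p + inv_exp r)"
      using N by (simp add: c_def d_def powr_add powr_diff powr_minus divide_inverse mult_ac)
    ultimately show ?thesis using m by (simp add: N_def)
  qed
  ultimately show "\<exists>(I :: nat set) (K :: nat set) x a. finite I \<and> finite K \<and>
     (\<forall>n\<in>I. lp_bound p K (a n) (1::real)) \<and>
     (\<forall>J\<subseteq>I. lp_bound q K (\<lambda>k. \<Sum>n\<in>J. x n k :: real) 1) \<and>
     \<not> lp_bound r K (\<lambda>k. \<Sum>n\<in>I. a n k * x n k) C"
    by (intro exI[of _ "{..<N}"] exI[of _ x] exI[of _ a]) auto
qed

section \<open>A multiscale example for three equal exponents\<close>

text \<open>
  Let \<open>i\<close> be the last index before which at most half of \<open>F = (\<Sum>j<J. G j)\<close> has been collected. The remaining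
  tail is at least \<open>F / 2\<close>, and \<open>F\<close> is at most of order \<open>\<beta> ^ i\<close> because the bounds \<open>\<beta> ^ j\<close> grow geometrically. So
  \<open>F powr q = F powr (q - 2) * F\<^sup>2\<close> is bounded by one term of the sum on the right.
\<close>

lemma powr_sum_le_tails:
  fixes G :: "nat \<Rightarrow> real"
  assumes q: "2 < q" and \<beta>: "1 < \<beta>" and G: "\<And>j. j < J \<Longrightarrow> 0 \<le> G j" "\<And>j. j < J \<Longrightarrow> G j \<le> \<beta> ^ j"
  shows "(\<Sum>j<J. G j) powr q \<le>
    4 * (2 * \<beta> / (\<beta> - 1)) powr (q - 2) * (\<Sum>i<J. (\<beta> ^ i) powr (q - 2) * (\<Sum>j\<in>{i..<J}. G j)\<^sup>2)"
proof (cases "(\<Sum>j<J. G j) = 0")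
  case True
  then show ?thesis using \<beta> by (auto intro!: mult_nonneg_nonneg sum_nonneg)
next
  case False
  define F where "F = (\<Sum>j<J. G j)"
  have "0 \<le> F" unfolding F_def using G(1) by (intro sum_nonneg) auto
  then have F: "0 < F" using False by (simp add: F_def)
  have J: "J \<noteq> 0" using False by (intro notI) simp
  have head: "(\<Sum>j<i. G j) \<le> \<beta> ^ i / (\<beta> - 1)" if "i \<le> J" for i
  proof -
    have "(\<Sum>j<i. G j) \<le> (\<Sum>j<i. \<beta> ^ j)" using G(2) that by (intro sum_mono) auto
    also have "\<dots> = (\<beta> ^ i - 1) / (\<beta> - 1)" using \<beta> by (simp add: sum_gp_strict field_simps)
    also have "\<dots> \<le> \<beta> ^ i / (\<beta> - 1)" using \<beta> by (intro divide_right_mono) auto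
    finally show ?thesis .
  qed
  define P where "P i \<longleftrightarrow> i < J \<and> (\<Sum>j<i. G j) \<le> F / 2" for i
  define i where "i = (GREATEST i. P i)"
  have P0: "P 0" using J F by (simp add: P_def)
  have Pb: "P i \<Longrightarrow> i \<le> J" for i by (simp add: P_def)
  have Pi: "P i" unfolding i_def by (rule GreatestI_nat[of P 0 J]) (use P0 Pb in auto)
  have i: "i < J" "(\<Sum>j<i. G j) \<le> F / 2" using Pi by (auto simp: P_def)
  have large: "F \<le> 2 * \<beta> / (\<beta> - 1) * \<beta> ^ i"
  proof -
    have "F / 2 \<le> (\<Sum>j<Suc i. G j)"
    proof (cases "Suc i < J")
      case True
      have "\<not> P (Suc i)" using Greatest_le_nat[of P "Suc i" J] Pb by (auto simp flip: i_def)
      then show ?thesis using True by (simp add: P_def)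
    next
      case F': False
      then have "Suc i = J" using i by simp
      then show ?thesis using F by (simp add: F_def)
    qed
    also have "\<dots> \<le> \<beta> ^ Suc i / (\<beta> - 1)" using i by (intro head) auto
    finally show ?thesis by (simp add: mult_ac)
  qed
  have "{..<J} = {..<i} \<union> {i..<J}" using i by auto
  then have "F = (\<Sum>j<i. G j) + (\<Sum>j\<in>{i..<J}. G j)"
    unfolding F_def by (simp add: sum.union_disjoint ivl_disj_int)
  then have tail: "F \<le> 2 * (\<Sum>j\<in>{i..<J}. G j)" using i by simp
  have "F powr q = F powr (q - 2) * F\<^sup>2"
    using F by (simp flip: powr_numeral powr_add)
  also have "\<dots> \<le> (2 * \<beta> / (\<beta> - 1) * \<beta> ^ i) powr (q - 2) * (2 * (\<Sum>j\<in>{i..<J}. G j))\<^sup>2"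
    using q F large tail by (intro mult_mono powr_mono2 power_mono) auto
  also have "\<dots> = 4 * (2 * \<beta> / (\<beta> - 1)) powr (q - 2) * ((\<beta> ^ i) powr (q - 2) * (\<Sum>j\<in>{i..<J}. G j)\<^sup>2)"
    by (simp only: powr_mult power_mult_distrib) simp
  also have "\<dots> \<le> 4 * (2 * \<beta> / (\<beta> - 1)) powr (q - 2) * (\<Sum>i<J. (\<beta> ^ i) powr (q - 2) * (\<Sum>j\<in>{i..<J}. G j)\<^sup>2)"
    using i by (intro mult_left_mono member_le_sum[where f = "\<lambda>i. (\<beta> ^ i) powr (q - 2) * (\<Sum>j\<in>{i..<J}. G j)\<^sup>2"]) auto
  finally show ?thesis by (simp add: F_def)
qed

text \<open>
  With respect to the uniform probability on \<open>K\<close>, the functions \<open>G j\<close> behave like \<open>2 powr (j / q)\<close> times the indicator of a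
  set of measure \<open>2 powr (- j)\<close>: they are normalized in \<open>L\<^sub>q\<close> and essentially disjoint, so that the \<open>q\<close>-th power of the norm
  of their sum is of order \<open>J\<close>. For \<open>q > 2\<close> the bounds in \<open>L\<^sub>\<infinity>\<close> and \<open>L\<^sub>2\<close> suffice for this, by the
  inequality with tails.
\<close>

lemma multiscale_sum_bound:
  assumes q: "2 < q"
  shows "\<exists>C::real. 0 < C \<and> (\<forall>(J :: nat) (K :: nat set) G. finite K \<longrightarrow>
     (\<forall>j<J. \<forall>k\<in>K. 0 \<le> G j k \<and> G j k \<le> (2 powr (1 / q)) ^ j) \<longrightarrow>
     (\<forall>j<J. (\<Sum>k\<in>K. (G j k)\<^sup>2) \<le> card K * ((2 powr (1 / q - 1 / 2)) ^ j)\<^sup>2) \<longrightarrow>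
     (\<Sum>k\<in>K. (\<Sum>j<J. G j k) powr q) \<le> C * card K * J)"
proof -
  define \<beta> where "\<beta> = 2 powr (1 / q)"
  define \<gamma> where "\<gamma> = 2 powr (1 / q - 1 / 2)"
  define C1 where "C1 = 4 * (2 * \<beta> / (\<beta> - 1)) powr (q - 2)"
  have \<beta>: "1 < \<beta>" using q by (simp add: \<beta>_def)
  have "\<gamma> < 2 powr 0" unfolding \<gamma>_def using q by (intro powr_less_mono) (auto simp: field_simps)
  then have \<gamma>: "0 < \<gamma>" "\<gamma> < 1" by (auto simp: \<gamma>_def)
  have C1: "0 < C1" using \<beta> by (simp add: C1_def)
  have cancel: "(\<beta> ^ i) powr (q - 2) * (\<gamma> ^ i)\<^sup>2 = 1" for i
  proof -
    have "(\<beta> ^ i) powr (q - 2) * (\<gamma> ^ i)\<^sup>2 = (2 powr (i * (1 / q))) powr (q - 2) * (2 powr (i * (1 / q - 1 / 2))) powr 2"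
      by (simp add: \<beta>_def \<gamma>_def powr_powr mult.commute flip: powr_realpow powr_numeral)
    also have "\<dots> = 2 powr (real i * (1 / q) * (q - 2) + real i * (1 / q - 1 / 2) * 2)"
      by (simp only: powr_powr powr_add)
    also have "real i * (1 / q) * (q - 2) + real i * (1 / q - 1 / 2) * 2 = 0"
      using q by (simp add: field_simps)
    finally show ?thesis by simp
  qed
  have bound: "(\<Sum>k\<in>K. (\<Sum>j<J. G j k) powr q) \<le> C1 / (1 - \<gamma>)\<^sup>2 * card K * J"
    if K: "finite K" and G1: "\<forall>j<J. \<forall>k\<in>K. 0 \<le> G j k \<and> G j k \<le> \<beta> ^ j"
      and G2: "\<forall>j<J. (\<Sum>k\<in>K. (G j k)\<^sup>2) \<le> card K * (\<gamma> ^ j)\<^sup>2" for J :: nat and K :: "nat set" and G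
  proof -
    define s where "s = sqrt (card K)"
    have s: "0 \<le> s" "s\<^sup>2 = card K" by (auto simp: s_def)
    have tails: "(\<Sum>k\<in>K. (\<Sum>j\<in>{i..<J}. G j k)\<^sup>2) \<le> (s * (\<gamma> ^ i / (1 - \<gamma>)))\<^sup>2" for i
    proof -
      have "lp_bound 2 K (G j) (s * \<gamma> ^ j)" if "j \<in> {i..<J}" for j
        unfolding lp_bound_two_iff using G2 that s \<gamma> by (simp add: power_mult_distrib)
      then have "lp_bound 2 K (\<lambda>k. \<Sum>j\<in>{i..<J}. G j k) (\<Sum>j\<in>{i..<J}. s * \<gamma> ^ j)"
        by (intro lp_bound_sum K) auto
      then have "lp_bound 2 K (\<lambda>k. \<Sum>j\<in>{i..<J}. G j k) (s * (\<gamma> ^ i / (1 - \<gamma>)))"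
      proof (rule lp_bound_mono[rotated])
        have "(\<Sum>j\<in>{i..<J}. \<gamma> ^ j) = \<gamma> ^ i * (\<Sum>j\<in>{i..<J}. \<gamma> ^ (j - i))"
          unfolding sum_distrib_left by (intro sum.cong) (auto simp flip: power_add)
        also have "\<dots> \<le> \<gamma> ^ i * (1 / (1 - \<gamma>))"
          using \<gamma> by (intro mult_left_mono sum_power_inj_le) (auto simp: inj_on_def)
        finally have "(\<Sum>j\<in>{i..<J}. \<gamma> ^ j) \<le> \<gamma> ^ i / (1 - \<gamma>)" by simp
        from mult_left_mono[OF this s(1)] show "(\<Sum>j\<in>{i..<J}. s * \<gamma> ^ j) \<le> s * (\<gamma> ^ i / (1 - \<gamma>))"
          unfolding sum_distrib_left .
      qed simp
      then show ?thesis unfolding lp_bound_two_iff by simp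
    qed
    have "(\<Sum>k\<in>K. (\<Sum>j<J. G j k) powr q) \<le>
       (\<Sum>k\<in>K. C1 * (\<Sum>i<J. (\<beta> ^ i) powr (q - 2) * (\<Sum>j\<in>{i..<J}. G j k)\<^sup>2))"
      unfolding C1_def using G1 by (intro sum_mono powr_sum_le_tails q \<beta>) auto
    also have "\<dots> = C1 * (\<Sum>i<J. (\<beta> ^ i) powr (q - 2) * (\<Sum>k\<in>K. (\<Sum>j\<in>{i..<J}. G j k)\<^sup>2))"
      unfolding sum_distrib_left[symmetric] by (subst sum.swap) (simp add: sum_distrib_left)
    also have "\<dots> \<le> C1 * (\<Sum>i<J. (\<beta> ^ i) powr (q - 2) * (s * (\<gamma> ^ i / (1 - \<gamma>)))\<^sup>2)"
      using C1 by (intro mult_left_mono sum_mono tails) auto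
    also have "\<dots> = C1 * (\<Sum>i<J. ((\<beta> ^ i) powr (q - 2) * (\<gamma> ^ i)\<^sup>2) * (card K / (1 - \<gamma>)\<^sup>2))"
      unfolding power_mult_distrib power_divide s(2) by (simp add: mult_ac)
    also have "\<dots> = C1 / (1 - \<gamma>)\<^sup>2 * card K * J"
      unfolding cancel by simp
    finally show ?thesis .
  qed
  show ?thesis
    unfolding \<beta>_def[symmetric] \<gamma>_def[symmetric]
  proof (intro exI[of _ "C1 / (1 - \<gamma>)\<^sup>2"] conjI allI impI)
    show "0 < C1 / (1 - \<gamma>)\<^sup>2" using C1 \<gamma> by simp
  qed (rule bound)
qed

text \<open>
  The index \<open>(j, n)\<close> stands for row \<open>n\<close> of the block matrix \<open>H j\<close> with blocks of size \<open>2 ^ j\<close>. The rows are weighted so that every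
  scale \<open>j\<close> contributes the same amount \<open>c\<close> to each coordinate of the product, whose norm is then proportional
  to \<open>J\<close>, whereas the signed sums grow like \<open>J powr (1 / q)\<close> by \<open>multiscale_sum_bound\<close>.
\<close>

lemma unbounded_multiscale:
  assumes q: "2 < q"
  shows "unbounded_action TYPE(nat \<times> nat) (ereal q) (ereal q) (ereal q)"
  unfolding unbounded_action_def
proof
  fix C :: real
  obtain C0 :: real where C0: "0 < C0" and scales: "\<forall>(J :: nat) (K :: nat set) G. finite K \<longrightarrow>
     (\<forall>j<J. \<forall>k\<in>K. 0 \<le> G j k \<and> G j k \<le> (2 powr (1 / q)) ^ j) \<longrightarrow>
     (\<forall>j<J. (\<Sum>k\<in>K. (G j k)\<^sup>2) \<le> card K * ((2 powr (1 / q - 1 / 2)) ^ j)\<^sup>2) \<longrightarrow>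
     (\<Sum>k\<in>K. (\<Sum>j<J. G j k) powr q) \<le> C0 * card K * J"
    using multiscale_sum_bound[OF q] by (elim exE conjE)
  \<comment> \<open>A nonnegative replacement of \<open>C\<close>, for which taking powers is monotone.\<close>
  define D where "D = max 1 C"
  obtain J :: nat where J: "D powr q * C0 < real J powr (q - 1)" "0 < J"
  proof -
    obtain m where "D powr q * C0 < real (2 ^ m) powr (q - 1)" using ex_power_gt[of "q - 1"] q by auto
    then show thesis by (intro that[of "2 ^ m"]) auto
  qed
  define N :: nat where "N = 2 ^ J"
  have N: "0 < N" by (simp add: N_def)
  have "\<forall>j. \<exists>H. j < J \<longrightarrow> hadamard_blocks j N H" unfolding N_def using hadamard_blocks_exist by (meson less_imp_le)
  then obtain H where H: "\<And>j. j < J \<Longrightarrow> hadamard_blocks j N (H j)" by metis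
  \<comment> \<open>The scaling that turns the multiscale bound into \<open>1\<close>.\<close>
  define c where "c = (C0 * N * J) powr (- (1 / q))"
  have c: "0 < c" using C0 N J by (simp add: c_def)
  have cq: "c powr q * (C0 * N * J) = 1" 
  proof -
    define X where "X = C0 * N * J"
    have X: "0 < X" using C0 N J by (simp add: X_def)
    have "c powr q = X powr (- (1 / q) * q)" by (simp only: c_def powr_powr X_def)
    also have "\<dots> = 1 / X" using q X by (simp add: powr_neg_one)
    finally show ?thesis using C0 N J by (simp add: X_def)
  qed
  define x where "x = (\<lambda>(j, n) k. c * (2 powr (- (j * (1 - 1 / q))) * H j n k))"
  define a where "a = (\<lambda>(j :: nat, n) k. 2 powr (- (j / q)) * H j n k)"
  define I where "I = {..<J} \<times> {..<N}"
  have val: "H j n k = - 1 \<or> H j n k = 0 \<or> H j n k = 1" if "j < J" "n < N" "k < N" for j n k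
    using H[OF that(1)] that by (simp add: hadamard_blocks_def)
  have "lp_bound (ereal q) {..<N} (a jn) 1" if jn: "jn \<in> I" for jn
  proof -
    obtain j n where [simp]: "jn = (j, n)" "j < J" "n < N" using jn by (auto simp: I_def)
    have "(\<Sum>k<N. norm (a jn k) powr q) = (\<Sum>k<N. 2 powr (- real j) * \<bar>H j n k\<bar>)"
    proof (intro sum.cong refl)
      fix k assume "k \<in> {..<N}"
      then show "norm (a jn k) powr q = 2 powr (- real j) * \<bar>H j n k\<bar>"
        using val[of j n k] q by (auto simp: a_def abs_mult powr_mult powr_powr)
    qed
    also have "\<dots> = 2 powr (- real j) * 2 ^ j"
      using H[of j] by (simp add: hadamard_blocks_def flip: sum_distrib_left)
    also have "\<dots> = 1" by (simp add: powr_minus powr_realpow)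
    finally show ?thesis by (simp add: lp_bound_def)
  qed
  moreover have "lp_bound (ereal q) {..<N} (\<lambda>k. \<Sum>jn\<in>S. x jn k) 1" if S: "S \<subseteq> I" for S
  proof -
    define T where "T j = {n. (j, n) \<in> S}" for j
    define G where "G j k = 2 powr (- (real j * (1 - 1 / q))) * \<bar>\<Sum>n\<in>T j. H j n k\<bar>" for j k
    have T: "T j \<subseteq> {..<N}" for j using S by (auto simp: T_def I_def)
    have split: "(\<Sum>jn\<in>S. x jn k) = c * (\<Sum>j<J. 2 powr (- (real j * (1 - 1 / q))) * (\<Sum>n\<in>T j. H j n k))" for k
    proof -
      have "S = Sigma {..<J} T" using S by (auto simp: T_def I_def)
      then have "(\<Sum>jn\<in>S. x jn k) = (\<Sum>j<J. \<Sum>n\<in>T j. x (j, n) k)"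
        using finite_subset[OF T] by (simp add: sum.Sigma)
      then show ?thesis by (simp add: x_def sum_distrib_left)
    qed
    have "(\<Sum>k<N. (\<Sum>j<J. G j k) powr q) \<le> C0 * card {..<N} * J"
    proof (rule scales[THEN spec, THEN spec, THEN spec, THEN mp, THEN mp, THEN mp])
      have "G j k \<le> (2 powr (1 / q)) ^ j" if "j < J" "k < N" for j k
      proof -
        have "G j k \<le> 2 powr (- (real j * (1 - 1 / q))) * 2 ^ j"
          unfolding G_def using hadamard_subset_sum(2)[OF H[OF that(1)] T that(2)] by (intro mult_left_mono) auto
        also have "\<dots> = 2 powr (- (real j * (1 - 1 / q)) + real j)"
          unfolding powr_add by (simp add: powr_realpow)
        also have "- (real j * (1 - 1 / q)) + real j = 1 / q * real j" by (simp add: algebra_simps)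
        finally show ?thesis by (simp add: powr_powr flip: powr_realpow)
      qed
      then show "\<forall>j<J. \<forall>k\<in>{..<N}. 0 \<le> G j k \<and> G j k \<le> (2 powr (1 / q)) ^ j" by (simp add: G_def)
      have "(\<Sum>k<N. (G j k)\<^sup>2) \<le> N * ((2 powr (1 / q - 1 / 2)) ^ j)\<^sup>2" if "j < J" for j
      proof -
        have "(\<Sum>k<N. (G j k)\<^sup>2) = (2 powr (- (real j * (1 - 1 / q))))\<^sup>2 * (\<Sum>k<N. (\<Sum>n\<in>T j. H j n k)\<^sup>2)"
          by (simp add: G_def power_mult_distrib sum_distrib_left)
        also have "\<dots> \<le> (2 powr (- (real j * (1 - 1 / q))))\<^sup>2 * (2 ^ j * real N)"
          by (intro mult_left_mono hadamard_subset_sum(1)[OF H[OF that] T]) auto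
        also have "\<dots> = N * 2 powr (- (real j * (1 - 1 / q)) * 2 + real j)"
        proof -
          have "(2 powr y)\<^sup>2 = 2 powr (y * 2)" for y :: real
            by (simp add: powr_powr flip: powr_numeral)
          then show ?thesis unfolding powr_add by (simp add: powr_realpow)
        qed
        also have "- (real j * (1 - 1 / q)) * 2 + real j = (1 / q - 1 / 2) * real j * 2" by (simp add: algebra_simps)
        also have "2 powr ((1 / q - 1 / 2) * real j * 2) = ((2 powr (1 / q - 1 / 2)) ^ j)\<^sup>2"
          by (simp add: powr_powr flip: powr_realpow powr_numeral)
        finally show ?thesis .
      qed
      then show "\<forall>j<J. (\<Sum>k<N. (G j k)\<^sup>2) \<le> card {..<N} * ((2 powr (1 / q - 1 / 2)) ^ j)\<^sup>2" by simp
    qed simp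
    then have GN: "(\<Sum>k<N. (\<Sum>j<J. G j k) powr q) \<le> C0 * N * J" by simp
    have "(\<Sum>k<N. norm (\<Sum>jn\<in>S. x jn k) powr q) \<le> (\<Sum>k<N. c powr q * (\<Sum>j<J. G j k) powr q)"
    proof (rule sum_mono)
      fix k
      have "norm (\<Sum>jn\<in>S. x jn k) \<le> c * (\<Sum>j<J. G j k)"
        unfolding split using c
        by (auto simp: abs_mult G_def intro!: mult_left_mono order_trans[OF sum_abs] sum_mono)
      then have "norm (\<Sum>jn\<in>S. x jn k) powr q \<le> (c * (\<Sum>j<J. G j k)) powr q"
        using q by (intro powr_mono2) auto
      then show "norm (\<Sum>jn\<in>S. x jn k) powr q \<le> c powr q * (\<Sum>j<J. G j k) powr q"
        by (simp add: powr_mult)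
    qed
    also have "\<dots> \<le> c powr q * (C0 * N * J)"
      unfolding sum_distrib_left[symmetric] using GN by (intro mult_left_mono) auto
    finally show ?thesis using cq by (simp add: lp_bound_def)
  qed
  moreover have "\<not> lp_bound (ereal q) {..<N} (\<lambda>k. \<Sum>jn\<in>I. a jn k * x jn k) C"
  proof
    assume "lp_bound (ereal q) {..<N} (\<lambda>k. \<Sum>jn\<in>I. a jn k * x jn k) C"
    then have "lp_bound (ereal q) {..<N} (\<lambda>k. \<Sum>jn\<in>I. a jn k * x jn k) D"
      by (rule lp_bound_mono[rotated]) (use q in \<open>auto simp: D_def\<close>)
    then have le: "(\<Sum>k<N. norm (\<Sum>jn\<in>I. a jn k * x jn k) powr q) \<le> D powr q" by (simp add: lp_bound_def)
    have "norm (\<Sum>jn\<in>I. a jn k * x jn k) = c * J" if k: "k \<in> {..<N}" for k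
    proof -
      have "(\<Sum>jn\<in>I. a jn k * x jn k) = (\<Sum>j<J. \<Sum>n<N. a (j, n) k * x (j, n) k)"
        unfolding I_def by (simp add: sum.cartesian_product)
      also have "\<dots> = (\<Sum>j<J. c)"
      proof (intro sum.cong refl)
        fix j assume j: "j \<in> {..<J}"
        have "(\<Sum>n<N. a (j, n) k * x (j, n) k) = (\<Sum>n<N. c * 2 powr (- real j) * \<bar>H j n k\<bar>)"
        proof (intro sum.cong refl)
          fix n assume n: "n \<in> {..<N}"
          have "H j n k * H j n k = \<bar>H j n k\<bar>" using val[of j n k] j n k by auto
          moreover have "2 powr (- (j / q)) * 2 powr (- (real j * (1 - 1 / q))) = 2 powr (- real j)"
            by (simp add: algebra_simps flip: powr_add)
          ultimately show "a (j, n) k * x (j, n) k = c * 2 powr (- real j) * \<bar>H j n k\<bar>"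
            unfolding a_def x_def prod.case by (metis mult.assoc mult.commute)
        qed
        also have "\<dots> = c * 2 powr (- real j) * 2 ^ j"
          using H[of j] j k by (simp add: hadamard_blocks_def flip: sum_distrib_left)
        also have "\<dots> = c" by (simp add: powr_minus powr_realpow)
        finally show "(\<Sum>n<N. a (j, n) k * x (j, n) k) = c" .
      qed
      finally show ?thesis using c by simp
    qed
    then have "N * (c * J) powr q \<le> D powr q" using le by simp
    then have "N * (c powr q * J powr q) * C0 \<le> D powr q * C0"
      using C0 by (intro mult_right_mono) (auto simp: powr_mult)
    also have "N * (c powr q * J powr q) * C0 = (c powr q * (C0 * N * J)) * J powr (q - 1)"
      using J by (simp add: powr_diff)
    finally show False using J cq by simp
  qed
  ultimately show "\<exists>(I :: (nat \<times> nat) set) (K :: nat set) x a. finite I \<and> finite K \<and>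
     (\<forall>n\<in>I. lp_bound (ereal q) K (a n) (1::real)) \<and>
     (\<forall>J\<subseteq>I. lp_bound (ereal q) K (\<lambda>k. \<Sum>n\<in>J. x n k :: real) 1) \<and>
     \<not> lp_bound (ereal q) K (\<lambda>k. \<Sum>n\<in>I. a n k * x n k) C"
    by (intro exI[of _ I] exI[of _ "{..<N}"] exI[of _ x] exI[of _ a]) (auto simp: I_def)
qed

section \<open>The characterization\<close>

lemma exists_unbounded_action:
  assumes exps: "1 \<le> p" "1 \<le> q" "1 \<le> r"
    and cond: "\<not> ((p \<le> 2 \<and> q \<le> r) \<or> (2 < p \<and> p < q \<and> q \<le> r) \<or> (2 < p \<and> p = q \<and> q < r) \<or>
       (p = q \<and> q = r \<and> r = \<infinity>) \<or> (2 \<le> q \<and> q < p \<and> p \<le> r) \<or>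
       (q < 2 \<and> 2 < p \<and> inv_exp p + inv_exp q \<ge> inv_exp r + 1 / 2))"
  shows "unbounded_action TYPE(nat) p q r \<or> unbounded_action TYPE(nat \<times> nat) p q r"
proof -
  consider "r < q" | "2 \<le> q" "r < p" | "q \<le> 2" "inv_exp p + inv_exp q < inv_exp r + 1 / 2" |
      "2 < p" "p = q" "q = r" "r \<noteq> \<infinity>"
    using cond by (metis not_le order_less_imp_le linorder_cases)
  then show ?thesis
  proof cases
    case 1
    then show ?thesis using unbounded_diagonal[OF exps] by blast
  next
    case 2
    then show ?thesis using unbounded_hadamard[OF exps] inv_exp_less[OF exps(3)] by blast
  next
    case 3
    then show ?thesis using unbounded_hadamard[OF exps] by blast
  next
    case 4
    then obtain s where "r = ereal s" "2 < s" by (cases r) auto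
    then show ?thesis using unbounded_multiscale 4 by blast
  qed
qed

theorem theorem1p2:
  fixes p q r :: ereal
  assumes "1 \<le> p" and "1 \<le> q" and "1 \<le> r"
    and "1 / r \<le> 1 / p + 1 / q"
  shows
    "let condition =
           (p \<le> 2 \<and> q \<le> r) \<or>
           (2 < p \<and> p < q \<and> q \<le> r) \<or>
           (2 < p \<and> p = q \<and> q < r) \<or>
           (p = q \<and> q = r \<and> r = \<infinity>) \<or>
           (2 \<le> q \<and> q < p \<and> p \<le> r) \<or>
           (q < 2 \<and> 2 < p \<and> 1 / p + 1 / q \<ge> 1 / r + 1 / 2)
     in
       (preserves_unconditional_convergence (ell p) (ell q) (ell r)
          (coord_mult :: (nat \<Rightarrow> real) \<Rightarrow> (nat \<Rightarrow> real) \<Rightarrow> nat \<Rightarrow> real) \<longleftrightarrow> condition) \<and>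
       (preserves_unconditional_convergence (ell p) (ell q) (ell r)
          (coord_mult :: (nat \<Rightarrow> complex) \<Rightarrow> (nat \<Rightarrow> complex) \<Rightarrow> nat \<Rightarrow> complex) \<longleftrightarrow> condition)"
proof -
  note exps = assms(1-3)
  have "1 / 2 = ereal (1 / 2)" by (simp add: one_ereal_def)
  then have vi: "1 / p + 1 / q \<ge> 1 / r + 1 / 2 \<longleftrightarrow> inv_exp p + inv_exp q \<ge> inv_exp r + 1 / 2"
    by (simp only: one_divide_exponent[OF exps(1)] one_divide_exponent[OF exps(2)]
        one_divide_exponent[OF exps(3)] plus_ereal.simps ereal_less_eq)
  define cond where "cond \<longleftrightarrow> (p \<le> 2 \<and> q \<le> r) \<or> (2 < p \<and> p < q \<and> q \<le> r) \<or> (2 < p \<and> p = q \<and> q < r) \<or>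
       (p = q \<and> q = r \<and> r = \<infinity>) \<or> (2 \<le> q \<and> q < p \<and> p \<le> r) \<or>
       (q < 2 \<and> 2 < p \<and> inv_exp p + inv_exp q \<ge> inv_exp r + 1 / 2)"
  have pos: "preserves_unconditional_convergence (ell p) (ell q) (ell r)
        (coord_mult :: (nat \<Rightarrow> real) \<Rightarrow> (nat \<Rightarrow> real) \<Rightarrow> nat \<Rightarrow> real)"
      "preserves_unconditional_convergence (ell p) (ell q) (ell r)
        (coord_mult :: (nat \<Rightarrow> complex) \<Rightarrow> (nat \<Rightarrow> complex) \<Rightarrow> nat \<Rightarrow> complex)" if cond
  proof -
    obtain C where C: "action_bound p q r C"
      using exists_action_bound[OF exps] \<open>cond\<close> by (auto simp: cond_def)
    show "preserves_unconditional_convergence (ell p) (ell q) (ell r)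
        (coord_mult :: (nat \<Rightarrow> real) \<Rightarrow> (nat \<Rightarrow> real) \<Rightarrow> nat \<Rightarrow> real)"
      by (rule preserves_if_action_bound[OF exps C, of "\<lambda>z. z" "\<lambda>_. 0"])
        (auto intro: bounded_linear.linear bounded_linear_ident bounded_linear_zero)
    show "preserves_unconditional_convergence (ell p) (ell q) (ell r)
        (coord_mult :: (nat \<Rightarrow> complex) \<Rightarrow> (nat \<Rightarrow> complex) \<Rightarrow> nat \<Rightarrow> complex)"
      by (rule preserves_if_action_bound[OF exps C, of Re Im])
        (auto simp: abs_Re_le_cmod abs_Im_le_cmod cmod_le
          intro: bounded_linear.linear bounded_linear_Re bounded_linear_Im)
  qed
  have neg: "\<not> preserves_unconditional_convergence (ell p) (ell q) (ell r)
        (coord_mult :: (nat \<Rightarrow> real) \<Rightarrow> (nat \<Rightarrow> real) \<Rightarrow> nat \<Rightarrow> real)"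
      "\<not> preserves_unconditional_convergence (ell p) (ell q) (ell r)
        (coord_mult :: (nat \<Rightarrow> complex) \<Rightarrow> (nat \<Rightarrow> complex) \<Rightarrow> nat \<Rightarrow> complex)" if "\<not> cond"
    using exists_unbounded_action[OF exps that[unfolded cond_def]]
    by (auto dest: not_preserves_if_unbounded[OF exps])
  show ?thesis
    unfolding Let_def vi cond_def[symmetric] using pos neg by blast
qed

end
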